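(* Let $\mathcal{L}\in\mathcal{S}\setminus\{1\}$ and let $\alpha$ be a complex number. Then there exists a positive constant $A$, depending only on $\alpha$ (and $\mathcal{L}$), such that for every $T\geq\exp(3)$ there is an $\alpha$-point $\beta_\alpha+i\gamma_\alpha$ of $\mathcal{L}(s)$ satisfying $$|\gamma_\alpha-T|<\frac{A}{\log\log\log T}.$$
   Context: The Selberg class $\mathcal{S}$ consists of Dirichlet series $\mathcal{L}(s)=\sum_{n\geq1}f(n)n^{-s}$ such that: (i) $f(n)\ll_\epsilon n^\epsilon$ for every $\epsilon>0$; (ii) for some integer $k\geq0$, $(s-1)^k\mathcal{L}(s)$ extends to an entire function of finite order; (iii) $\mathcal{L}$ satisfies $\mathfrak{L}(s)=\omega\overline{\mathfrak{L}(1-\overline{s})}$ where $\mathfrak{L}(s)=\mathcal{L}(s)Q^s\prod_{j=1}^J\Gamma(\lambda_js+\mu_j)$ with $Q>0$, $\lambda_j>0$, $\mu_j\in\mathbb{C}$ with $\Re\mu_j\geq0$, and $|\omega|=1$; (iv) $\mathcal{L}(s)=\prod_p\exp\left(\sum_{k\geq1}b(p^k)p^{-ks}\right)$ for $\Re s>1$ with $b(p^k)\ll p^{k\theta}$ for some $\theta<1/2$. Here $1$ denotes the constant function $1$. An $\alpha$-point of $\mathcal{L}$ is a solution $\beta_\alpha+i\gamma_\alpha$ (with $\beta_\alpha,\gamma_\alpha$ real) of $\mathcal{L}(s)=\alpha$. *)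

theory Defs
  imports
    "HOL-Complex_Analysis.Complex_Analysis"
    "HOL-Computational_Algebra.Primes"
    "HOL-Library.Landau_Symbols"
begin

definition dirichlet_expansion :: "(nat \<Rightarrow> complex) \<Rightarrow> (complex \<Rightarrow> complex) \<Rightarrow> bool" where
  "dirichlet_expansion f L \<longleftrightarrow>
     (\<forall>s. Re s > 1 \<longrightarrow> (\<lambda>n. f (Suc n) * of_nat (Suc n) powr (-s)) sums L s)"

definition ramanujan_bound :: "(nat \<Rightarrow> complex) \<Rightarrow> bool" where
  "ramanujan_bound f \<longleftrightarrow>
     (\<forall>\<epsilon>>0. (\<lambda>n. norm (f n)) \<in> O(\<lambda>n. real n powr \<epsilon>))"

definition entire_of_finite_order :: "(complex \<Rightarrow> complex) \<Rightarrow> bool" where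
  "entire_of_finite_order G \<longleftrightarrow> G holomorphic_on UNIV \<and>
     (\<exists>\<rho>::real. (\<lambda>z. norm (G z)) \<in> O[at_infinity](\<lambda>z. exp (norm z powr \<rho>)))"

definition selberg_continuation :: "(complex \<Rightarrow> complex) \<Rightarrow> bool" where
  "selberg_continuation L \<longleftrightarrow>
     (\<exists>(k::nat) G. entire_of_finite_order G \<and> (\<forall>s. s \<noteq> 1 \<longrightarrow> G s = (s - 1) ^ k * L s))"

definition completed_fun ::
    "(complex \<Rightarrow> complex) \<Rightarrow> real \<Rightarrow> nat \<Rightarrow> (nat \<Rightarrow> real) \<Rightarrow> (nat \<Rightarrow> complex) \<Rightarrow> complex \<Rightarrow> complex" where
  "completed_fun L Q J lam mu s =
     L s * of_real Q powr s * (\<Prod>j=1..J. Gamma (of_real (lam j) * s + mu j))"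

text \<open>
  The functional equation is an identity between meromorphic functions. Pointwise it is required
  away from the possible poles of the factors on either side: a possible pole of \<open>L\<close> at \<open>1\<close>
  (i.e. \<open>s = 1\<close> on the left, \<open>s = 0\<close> on the right) and the poles of the Gamma factors, at which
  the library assigns \<^term>\<open>Gamma\<close> the value \<open>0\<close>. The excluded set is discrete. The case \<open>J = 0\<close>
  (no Gamma factors) is allowed, so that the constant function \<open>1\<close> belongs to the class.
\<close>

definition selberg_functional_equation :: "(complex \<Rightarrow> complex) \<Rightarrow> bool" where
  "selberg_functional_equation L \<longleftrightarrow>
     (\<exists>(Q::real) (J::nat) (lam :: nat \<Rightarrow> real) (mu :: nat \<Rightarrow> complex) (\<omega>::complex).
        Q > 0 \<and> (\<forall>j\<in>{1..J}. lam j > 0 \<and> Re (mu j) \<ge> 0) \<and> norm \<omega> = 1 \<and>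
        (\<forall>s. s \<notin> {0, 1} \<longrightarrow>
             (\<forall>j\<in>{1..J}. of_real (lam j) * s + mu j \<notin> \<int>\<^sub>\<le>\<^sub>0 \<and>
                         of_real (lam j) * (1 - cnj s) + mu j \<notin> \<int>\<^sub>\<le>\<^sub>0) \<longrightarrow>
             completed_fun L Q J lam mu s = \<omega> * cnj (completed_fun L Q J lam mu (1 - cnj s))))"

text \<open>
  The product over primes is taken in increasing order, indices that are not prime contributing
  a factor \<open>1\<close>. The inner sum over \<open>k \<ge> 1\<close> converges absolutely because of the bound on \<open>b\<close>.
\<close>

definition selberg_euler_product :: "(complex \<Rightarrow> complex) \<Rightarrow> bool" where
  "selberg_euler_product L \<longleftrightarrow>
     (\<exists>(b :: nat \<Rightarrow> complex) (\<theta>::real) (C::real). \<theta> < 1/2 \<and>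
        (\<forall>p k. prime p \<longrightarrow> k \<ge> 1 \<longrightarrow> norm (b (p ^ k)) \<le> C * real p powr (real k * \<theta>)) \<and>
        (\<forall>s. Re s > 1 \<longrightarrow>
           (\<lambda>p. if prime p
                 then exp (\<Sum>k. b (p ^ Suc k) * of_nat p powr (- of_nat (Suc k) * s))
                 else 1) has_prod L s))"

text \<open>
  An element of the class is the meromorphic continuation to the whole plane. The predicate
  \<open>nicely_meromorphic_on\<close> pins down the value at \<open>1\<close> (the continuous value, or \<open>0\<close> at a pole),
  so that an element is determined by its Dirichlet series.
\<close>

definition selberg_class :: "(complex \<Rightarrow> complex) set" where
  "selberg_class = {L. L nicely_meromorphic_on UNIV \<and>
     (\<exists>f. dirichlet_expansion f L \<and> ramanujan_bound f) \<and>
     selberg_continuation L \<and> selberg_functional_equation L \<and> selberg_euler_product L}"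

text \<open>A pole is never an \<open>\<alpha>\<close>-point, although functions in the class take the value \<open>0\<close> there.\<close>

definition alpha_point :: "(complex \<Rightarrow> complex) \<Rightarrow> complex \<Rightarrow> complex \<Rightarrow> bool" where
  "alpha_point L \<alpha> s \<longleftrightarrow> \<not> is_pole L s \<and> L s = \<alpha>"

end

theory Submission
  imports Defs "HOL-Real_Asymp.Real_Asymp"
begin

text \<open>
  Suppose that \<open>L - \<alpha>\<close> has no zero at height within \<open>2 * d\<close> of \<open>T\<close>. Divided by the leading term of its
  Dirichlet series it tends to \<open>1\<close> on the right, so it has a logarithm \<open>F\<close> on this horizontal strip, bounded
  on the far right. By the functional equation \<open>ln \<bar>L\<bar>\<close> is at least a constant times \<open>ln T\<close> at some fixed abscissa on
  the left, and by Phragmen--Lindelof \<open>Re F\<close> is at most a constant times \<open>ln T\<close> throughout a rectangle. A two-constants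
  estimate gives \<open>\<bar>F\<bar> \<le> 4 * M * M powr (- \<omega>)\<close> on the left, with \<open>M\<close> of size \<open>ln T\<close> and \<open>\<omega>\<close> of size \<open>exp (- C / d)\<close>. If
  \<open>d\<close> is a large multiple of \<open>1 / ln (ln (ln T))\<close>, then \<open>M powr (- \<omega>)\<close> tends to \<open>0\<close>, a contradiction.

  This needs at least one Gamma factor. Without Gamma factors, Liouville's theorem shows that \<open>L\<close> is a
  Dirichlet polynomial, so that only finitely many Euler factors are nontrivial and \<open>L = exp H\<close> to the right of
  some \<open>\<theta> < 1 / 2\<close>. The functional equation extends \<open>H\<close> to an entire function of linear growth which is bounded on
  the right, hence constant, and \<open>L = 1\<close>.
\<close>

section \<open>The Phragmen--Lindelof principle in a strip\<close>

text \<open>The three logarithms of the gap arise as follows. On the left \<open>Re F\<close> has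
  size \<open>ln T\<close>, and the logarithm of that size, \<open>ln (ln T)\<close>, is what the
  estimate multiplies by \<omega>. The exponent \<omega> behaves like the harmonic measure of the
  right edge of a rectangle of half-height d, seen from a point at a fixed distance: it is
  exponentially small in \<open>1 / d\<close>. The method succeeds as long as \<omega> times
  \<open>ln (ln T)\<close> tends to infinity, that is, as long as \<open>1 / d\<close> stays below a
  small multiple of \<open>ln (ln (ln T))\<close>.

  The obstacle is that growth estimates for L bound \<open>Re F\<close> from above only, whereas the
  maximum principle is to be applied to the modulus of a holomorphic function. The upper and lower
  bounds on the left are both of order \<open>ln T\<close> and do not contradict each other; the
  contradiction has to be carried in from the far right, where F is bounded.

  The functional equation pairs s with \<open>1 - cnj s\<close>, a point at the same height. Hence
  quotients of Gamma values at equal imaginary parts suffice, and these are compared factor by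
  factor in the product formula.\<close>

lemma cos_half_ge: "\<bar>x\<bar> \<le> 1/2 \<Longrightarrow> cos x \<ge> 1/2" for x :: real
proof -
  assume x: "\<bar>x\<bar> \<le> 1/2"
  have "cos (pi/3) \<le> cos \<bar>x\<bar>"
    using x pi_gt3 by (intro cos_monotone_0_pi_le) auto
  thus ?thesis by (simp add: cos_60)
qed

lemma Re_cos_ge:
  assumes "\<bar>Re z\<bar> \<le> 1/2"
  shows "Re (cos z) \<ge> cosh (Im z) / 2"
proof -
  have "Re (cos z) = cos (Re z) * cosh (Im z)"
    by (simp add: Re_cos cosh_def exp_minus field_simps)
  moreover have "cosh (Im z) \<ge> 0" by (simp add: cosh_real_pos less_imp_le)
  ultimately show ?thesis using cos_half_ge[OF assms] mult_right_mono[of "1/2" "cos (Re z)" "cosh (Im z)"] by simp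
qed

lemma power_minus_cosh_at_bot:
  fixes \<beta> \<epsilon> K :: real
  assumes \<beta>: "\<beta> > 0" and \<epsilon>: "\<epsilon> > 0"
  shows "filterlim (\<lambda>R. (K + R) ^ n - \<epsilon> * cosh (\<beta> * R)) at_bot at_top"
proof -
  have "filterlim (\<lambda>R. \<beta> * (K + R)) at_top at_top"
    using \<beta> by real_asymp
  hence "((\<lambda>R. (\<beta> * (K + R)) ^ n / exp (\<beta> * (K + R))) \<longlongrightarrow> 0) at_top"
    by (rule filterlim_compose[OF tendsto_power_div_exp_0])
  hence "eventually (\<lambda>R. (\<beta> * (K + R)) ^ n / exp (\<beta> * (K + R)) < \<beta> ^ n * (\<epsilon> / 4) / exp (\<beta> * K)) at_top"
    using \<beta> \<epsilon> by (intro order_tendstoD(2)) auto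
  hence "eventually (\<lambda>R. (K + R) ^ n - \<epsilon> * cosh (\<beta> * R) \<le> - (\<epsilon> / 4) * exp (\<beta> * R)) at_top"
  proof eventually_elim
    case (elim R)
    have "\<beta> ^ n * (K + R) ^ n < \<beta> ^ n * ((\<epsilon> / 4) * exp (\<beta> * R))"
      using elim \<beta> unfolding power_mult_distrib distrib_left[of \<beta>] exp_add
      by (simp add: field_simps flip: distrib_left power_mult_distrib)
    hence "(K + R) ^ n < (\<epsilon> / 4) * exp (\<beta> * R)" using \<beta> by simp
    moreover have "\<epsilon> * cosh (\<beta> * R) \<ge> \<epsilon> * (exp (\<beta> * R) / 2)"
      using \<epsilon> by (intro mult_left_mono) (auto simp: cosh_field_def)
    ultimately show ?case by simp
  qed
  moreover have "filterlim (\<lambda>R. - (\<epsilon> / 4) * exp (\<beta> * R)) at_bot at_top"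
    using \<beta> \<epsilon> by real_asymp
  ultimately show ?thesis by (rule filterlim_at_bot_mono[rotated])
qed

text \<open>Multiplication by \<open>exp (- of_real \<epsilon> * cos (\<beta> * (z - m)))\<close>
  damps doubly exponentially in the height and so beats any growth of finite order. The maximum
  principle applies on the set cut off at a large height, and \<epsilon> then tends to 0. S is an
  arbitrary subset of a vertical strip because both a half-strip and a full strip occur
  later.\<close>

lemma phragmen_lindelof_strip:
  fixes F :: "complex \<Rightarrow> complex"
  assumes strip: "\<And>z. z \<in> S \<Longrightarrow> a \<le> Re z \<and> Re z \<le> b"
    and hol: "F holomorphic_on interior S" and cont: "continuous_on (closure S) F"
    and bound: "\<And>z. z \<in> frontier S \<Longrightarrow> norm (F z) \<le> M"
    and growth: "\<And>z. z \<in> closure S \<Longrightarrow> norm (F z) \<le> C * exp (norm z ^ n)"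
    and z: "z \<in> S" and "M > 0" and "C \<ge> 0"
  shows "norm (F z) \<le> M"
proof -
  define m where "m = complex_of_real ((a + b) / 2)"
  \<comment> \<open>Dividing by \<open>b - a + 1\<close> keeps the real part of the argument of the
    cosine within \<open>1/2\<close>, where \<open>Re_cos_ge\<close> applies, and it also covers
    \<open>a = b\<close>.\<close>
  define \<beta> where "\<beta> = 1 / (b - a + 1)"
  have ab: "a \<le> b" using strip[OF z] by auto
  have \<beta>: "\<beta> > 0" using ab by (simp add: \<beta>_def)
  have clstrip: "a \<le> Re w \<and> Re w \<le> b" if "w \<in> closure S" for w
  proof -
    have "closure S \<subseteq> {w. a \<le> Re w} \<inter> {w. Re w \<le> b}"
      using strip by (intro closure_minimal closed_Int closed_halfspace_Re_ge closed_halfspace_Re_le) auto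
    thus ?thesis using that by auto
  qed
  have arg: "\<bar>Re (\<beta> * (w - m))\<bar> \<le> 1/2" if "w \<in> closure S" for w
  proof -
    have "\<bar>Re w - (a+b)/2\<bar> \<le> (b - a)/2" using clstrip[OF that] by (auto simp: abs_le_iff field_simps)
    hence "\<bar>\<beta> * (Re w - (a+b)/2)\<bar> \<le> \<beta> * ((b - a + 1)/2)"
      using \<beta> by (simp add: abs_mult)
    also have "\<dots> = 1/2" using ab by (simp add: \<beta>_def)
    finally show ?thesis by (simp add: m_def)
  qed
  define K where "K = \<bar>a\<bar> + \<bar>b\<bar> + 1"
  have main: "norm (F z * exp (- of_real \<epsilon> * cos (\<beta> * (z - m)))) \<le> M" if \<epsilon>: "\<epsilon> > 0" for \<epsilon> :: real
  proof -
    define F' where "F' = (\<lambda>z. F z * exp (- of_real \<epsilon> * cos (\<beta> * (z - m))))"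
    have norm_F': "norm (F' w) \<le> norm (F w) * exp (- \<epsilon> * cosh (\<beta> * Im w) / 2)" if "w \<in> closure S" for w
    proof -
      have "Re (cos (\<beta> * (w - m))) \<ge> cosh (\<beta> * Im w) / 2"
        using Re_cos_ge[OF arg[OF that]] by (simp add: m_def)
      hence "- \<epsilon> * Re (cos (\<beta> * (w - m))) \<le> - \<epsilon> * cosh (\<beta> * Im w) / 2"
        using \<epsilon> mult_left_mono[of _ _ \<epsilon>] by fastforce
      thus ?thesis by (simp add: F'_def norm_mult norm_exp mult_left_mono)
    qed
    have lim: "((\<lambda>R. C * exp ((K + R) ^ n) * exp (- \<epsilon> * cosh (\<beta> * R) / 2)) \<longlongrightarrow> 0) at_top"
    proof -
      have "filterlim (\<lambda>R. (K + R) ^ n - \<epsilon> * cosh (\<beta> * R) / 2) at_bot at_top"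
        using power_minus_cosh_at_bot[OF \<beta>, of "\<epsilon> / 2" K n] \<epsilon> by simp
      hence "((\<lambda>R. exp ((K + R) ^ n - \<epsilon> * cosh (\<beta> * R) / 2)) \<longlongrightarrow> 0) at_top"
        by (rule filterlim_compose[OF exp_at_bot])
      hence "((\<lambda>R. C * exp ((K + R) ^ n - \<epsilon> * cosh (\<beta> * R) / 2)) \<longlongrightarrow> C * 0) at_top"
        by (intro tendsto_intros)
      moreover have "(\<lambda>R. C * exp ((K + R) ^ n) * exp (- \<epsilon> * cosh (\<beta> * R) / 2)) =
          (\<lambda>R. C * exp ((K + R) ^ n - \<epsilon> * cosh (\<beta> * R) / 2))"
        by (simp add: fun_eq_iff mult.assoc flip: exp_add)
      ultimately show ?thesis by simp
    qed
    have "eventually (\<lambda>R. C * exp ((K + R) ^ n) * exp (- \<epsilon> * cosh (\<beta> * R) / 2) < M) at_top"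
      using order_tendstoD(2)[OF lim \<open>M > 0\<close>] .
    moreover have "eventually (\<lambda>R. R > \<bar>Im z\<bar>) at_top" by (rule eventually_gt_at_top)
    ultimately obtain R where R: "C * exp ((K + R) ^ n) * exp (- \<epsilon> * cosh (\<beta> * R) / 2) < M" "R > \<bar>Im z\<bar>"
      by (metis (mono_tags, lifting) eventually_conj eventually_happens trivial_limit_at_top_linorder)
    define S' where "S' = S \<inter> {w. \<bar>Im w\<bar> < R}"
    have box: "{w. \<bar>Im w\<bar> < R} = {w. Im w < R} \<inter> {w. - R < Im w}" by auto
    have op: "open {w. \<bar>Im w\<bar> < R}" unfolding box
      by (intro open_Int open_halfspace_Im_lt open_halfspace_Im_gt)
    have cl: "closure {w. \<bar>Im w\<bar> < R} \<subseteq> {w. \<bar>Im w\<bar> \<le> R}"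
    proof (rule closure_minimal)
      have "{w. \<bar>Im w\<bar> \<le> R} = {w. Im w \<le> R} \<inter> {w. - R \<le> Im w}" by auto
      thus "closed {w. \<bar>Im w\<bar> \<le> R}"
        by (auto intro!: closed_Int closed_halfspace_Im_le closed_halfspace_Im_ge)
    qed auto
    have clS': "closure S' \<subseteq> closure S \<inter> {w. \<bar>Im w\<bar> \<le> R}"
      using cl closure_mono[of S' S] closure_mono[of S' "{w. \<bar>Im w\<bar> < R}"] by (auto simp: S'_def)
    have "norm (F' z) \<le> M"
    proof (rule maximum_modulus_frontier[of F' S'])
      show "F' holomorphic_on interior S'"
        unfolding F'_def S'_def
        by (intro holomorphic_intros holomorphic_on_subset[OF hol]) auto
      show "continuous_on (closure S') F'"
        unfolding F'_def using clS'
        by (intro continuous_intros continuous_on_subset[OF cont]) auto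
      show "bounded S'"
      proof (rule boundedI)
        fix w assume "w \<in> S'"
        hence "\<bar>Re w\<bar> \<le> K" "\<bar>Im w\<bar> \<le> R" using strip[of w] by (auto simp: S'_def K_def)
        thus "norm w \<le> K + R" using cmod_le[of w] by linarith
      qed
      show "z \<in> S'" using z R by (auto simp: S'_def)
    next
      fix w assume "w \<in> frontier S'"
      hence w: "w \<in> closure S'" and fr: "w \<in> frontier S \<or> w \<in> frontier {w. \<bar>Im w\<bar> < R}"
        unfolding S'_def using frontier_Int[of S "{w. \<bar>Im w\<bar> < R}"] by auto
      have wS: "w \<in> closure S" using w clS' by auto
      from fr show "norm (F' w) \<le> M"
      proof
        assume "w \<in> frontier S"
        hence "norm (F w) \<le> M" by (rule bound)
        moreover have "exp (- \<epsilon> * cosh (\<beta> * Im w) / 2) \<le> 1"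
          using \<epsilon> by (simp add: cosh_real_pos less_imp_le)
        ultimately have "norm (F w) * exp (- \<epsilon> * cosh (\<beta> * Im w) / 2) \<le> M * 1"
          using \<open>M > 0\<close> by (intro mult_mono) auto
        thus ?thesis using norm_F'[OF wS] by linarith
      next
        assume "w \<in> frontier {w. \<bar>Im w\<bar> < R}"
        hence "\<bar>Im w\<bar> = R" using cl op by (force simp: frontier_def interior_open)
        hence ch: "cosh (\<beta> * Im w) = cosh (\<beta> * R)"
          using cosh_real_abs[of "\<beta> * Im w"] \<beta> by (simp add: abs_mult)
        have "norm w \<le> K + R" 
          using cmod_le[of w] clstrip[OF wS] \<open>\<bar>Im w\<bar> = R\<close> by (auto simp: K_def)
        hence "norm w ^ n \<le> (K + R) ^ n" by (intro power_mono) auto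
        hence "norm (F w) \<le> C * exp ((K + R) ^ n)"
          using growth[OF wS] \<open>C \<ge> 0\<close> by (smt (verit) exp_le_cancel_iff mult_left_mono)
        hence "norm (F w) * exp (- \<epsilon> * cosh (\<beta> * Im w) / 2) \<le> C * exp ((K + R) ^ n) * exp (- \<epsilon> * cosh (\<beta> * R) / 2)"
          unfolding ch by (intro mult_right_mono) auto
        thus ?thesis using norm_F'[OF wS] R by linarith
      qed
    qed
    thus ?thesis by (simp add: F'_def)
  qed
  have "((\<lambda>\<epsilon>. norm (F z * exp (- of_real \<epsilon> * cos (\<beta> * (z - m))))) \<longlongrightarrow> norm (F z * exp (- of_real 0 * cos (\<beta> * (z - m))))) (at_right 0)"
    by (intro tendsto_intros)
  hence "((\<lambda>\<epsilon>. norm (F z * exp (- of_real \<epsilon> * cos (\<beta> * (z - m))))) \<longlongrightarrow> norm (F z)) (at_right 0)"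
    by simp
  thus ?thesis
    by (rule tendsto_upperbound) (use main in \<open>auto simp: eventually_at_right_less intro: eventually_at_rightI[of 0 1]\<close>)
qed

text \<open>The bound near infinity becomes global by adding a bound on a disk. The real order is
  rounded up to a natural exponent, the form of growth that \<open>phragmen_lindelof_strip\<close>
  takes.\<close>

lemma entire_of_finite_order_bound:
  assumes "entire_of_finite_order G"
  obtains C :: real and n :: nat where "C > 0" "\<And>z. norm (G z) \<le> C * exp (norm z ^ n)"
proof -
  from assms obtain \<rho> where hol: "G holomorphic_on UNIV"
    and bigo: "(\<lambda>z. norm (G z)) \<in> O[at_infinity](\<lambda>z. exp (norm z powr \<rho>))"
    unfolding entire_of_finite_order_def by auto
  from bigo obtain c where "c > 0" "eventually (\<lambda>z. norm (norm (G z)) \<le> c * norm (exp (norm z powr \<rho>))) at_infinity"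
    by (elim landau_o.bigE)
  then obtain R where c: "c > 0" and R: "\<And>z. norm z \<ge> R \<Longrightarrow> norm (G z) \<le> c * exp (norm z powr \<rho>)"
    by (auto simp: eventually_at_infinity)
  define R' where "R' = max 1 R"
  have "compact (G ` cball 0 R')"
    by (intro compact_continuous_image continuous_on_subset[OF holomorphic_on_imp_continuous_on[OF hol]]) auto
  then obtain M where M: "\<And>z. norm z \<le> R' \<Longrightarrow> norm (G z) \<le> M"
    by (metis (no_types, lifting) bounded_iff compact_imp_bounded imageI mem_cball_0)
  define n where "n = nat \<lceil>\<rho>\<rceil>"
  have "M \<ge> 0" using order.trans[OF norm_ge_zero M[of 0]] by (auto simp: R'_def)
  show thesis
  proof (rule that[of "c + M" n])
    show "c + M > 0" using \<open>c > 0\<close> \<open>M \<ge> 0\<close> by simp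
    fix z :: complex
    show "norm (G z) \<le> (c + M) * exp (norm z ^ n)"
    proof (cases "norm z \<le> R'")
      case True
      have "norm (G z) \<le> M * 1" using M[OF True] by simp
      also have "\<dots> \<le> (c + M) * exp (norm z ^ n)"
        using \<open>M \<ge> 0\<close> c by (intro mult_mono) auto
      finally show ?thesis .
    next
      case False
      hence z: "norm z \<ge> 1" "norm z \<ge> R" by (auto simp: R'_def)
      have "norm z powr \<rho> \<le> norm z powr real n"
        using z unfolding n_def by (intro powr_mono real_nat_ceiling_ge) auto
      also have "\<dots> = norm z ^ n" using z by (subst powr_realpow) auto
      finally have "c * exp (norm z powr \<rho>) \<le> (c + M) * exp (norm z ^ n)"
        using \<open>M \<ge> 0\<close> c by (intro mult_mono) auto
      thus ?thesis using R[OF z(2)] by linarith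
    qed
  qed
qed

section \<open>Quotients of Gamma values at equal height\<close>

text \<open>Factor by factor: for positive x, the quotient of the modulus of \<open>x + i y\<close>
  by x is the square root of \<open>1 + (y / x)^2\<close>, which does not increase with x.\<close>

lemma norm_pochhammer_mult_le:
  fixes x0 x1 y :: real
  assumes "0 < x0" "x0 \<le> x1"
  shows "norm (pochhammer (Complex x1 y) n) * pochhammer x0 n \<le> norm (pochhammer (Complex x0 y) n) * pochhammer x1 n"
proof -
  have "norm (Complex x1 y + of_nat k) * (x0 + real k) \<le> norm (Complex x0 y + of_nat k) * (x1 + real k)" for k
  proof (rule power2_le_imp_le)
    have "((x1 + real k)\<^sup>2 + y\<^sup>2) * (x0 + real k)\<^sup>2 \<le> ((x0 + real k)\<^sup>2 + y\<^sup>2) * (x1 + real k)\<^sup>2"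
      using assms by (simp add: algebra_simps mult_left_mono power_mono flip: power2_eq_square)
    thus "(norm (Complex x1 y + of_nat k) * (x0 + real k))\<^sup>2 \<le> (norm (Complex x0 y + of_nat k) * (x1 + real k))\<^sup>2"
      by (simp add: power_mult_distrib cmod_power2)
  qed (use assms in auto)
  hence "(\<Prod>k<n. norm (Complex x1 y + of_nat k) * (x0 + real k)) \<le> (\<Prod>k<n. norm (Complex x0 y + of_nat k) * (x1 + real k))"
    using assms by (intro prod_mono) auto
  thus ?thesis
    by (simp add: pochhammer_prod prod_norm prod.distrib atLeast0LessThan)
qed

text \<open>In the limit, the inequality for the finite products says that the quotient of
  \<open>norm (Gamma (Complex x y))\<close> by \<open>Gamma x\<close> is nondecreasing in positive
  x. All Gamma estimates below rest on this monotonicity.\<close>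

lemma norm_Gamma_mult_ge:
  fixes x0 x1 y :: real
  assumes "0 < x0" "x0 \<le> x1"
  shows "norm (Gamma (Complex x0 y)) * Gamma x1 \<le> norm (Gamma (Complex x1 y)) * Gamma x0"
proof (rule tendsto_le[OF sequentially_bot])
  show "(\<lambda>n. norm (Gamma_series (Complex x1 y) n) * Gamma_series x0 n) \<longlonglongrightarrow> norm (Gamma (Complex x1 y)) * Gamma x0"
       "(\<lambda>n. norm (Gamma_series (Complex x0 y) n) * Gamma_series x1 n) \<longlonglongrightarrow> norm (Gamma (Complex x0 y)) * Gamma x1"
    by (intro tendsto_intros)+
  show "eventually (\<lambda>n. norm (Gamma_series (Complex x0 y) n) * Gamma_series x1 n \<le> norm (Gamma_series (Complex x1 y) n) * Gamma_series x0 n) sequentially"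
    using eventually_gt_at_top[of 0]
  proof eventually_elim
    case (elim n)
    have nz: "pochhammer x0 (n+1) > 0" "pochhammer x1 (n+1) > 0"
      using assms by (auto intro!: pochhammer_pos)
    have nz': "pochhammer (Complex x0 y) (n+1) \<noteq> 0" "pochhammer (Complex x1 y) (n+1) \<noteq> 0"
      unfolding pochhammer_eq_0_iff using assms by (auto simp: complex_eq_iff)
    let ?E = "fact n * exp (x0 * ln (real n)) * (fact n * exp (x1 * ln (real n)))"
    have "norm (Gamma_series (Complex x0 y) n) * Gamma_series x1 n = 
        ?E / (norm (pochhammer (Complex x0 y) (n+1)) * pochhammer x1 (n+1))"
      by (simp add: Gamma_series_def norm_divide norm_mult norm_exp)
    also have "\<dots> \<le> ?E / (norm (pochhammer (Complex x1 y) (n+1)) * pochhammer x0 (n+1))"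
      using nz nz' norm_pochhammer_mult_le[OF assms, of y "n+1"] by (intro divide_left_mono mult_pos_pos) auto
    also have "\<dots> = norm (Gamma_series (Complex x1 y) n) * Gamma_series x0 n"
      by (simp add: Gamma_series_def norm_divide norm_mult norm_exp)
    finally show ?case .
  qed
qed

lemma norm_pochhammer_Complex_bounds:
  fixes x y :: real
  assumes y: "\<bar>y\<bar> \<ge> \<bar>x\<bar> + real N"
  shows "\<bar>y\<bar> ^ N \<le> norm (pochhammer (Complex x y) N)" "norm (pochhammer (Complex x y) N) \<le> (2 * \<bar>y\<bar>) ^ N"
proof -
  have eq: "norm (pochhammer (Complex x y) N) = (\<Prod>k<N. norm (Complex x y + of_nat k))"
    by (simp add: pochhammer_prod prod_norm atLeast0LessThan)
  have "(\<Prod>k<N. \<bar>y\<bar>) \<le> (\<Prod>k<N. norm (Complex x y + of_nat k))"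
    using abs_Im_le_cmod[of "Complex x y + of_nat k" for k] by (intro prod_mono) auto
  thus "\<bar>y\<bar> ^ N \<le> norm (pochhammer (Complex x y) N)" by (simp add: eq)
  have "(\<Prod>k<N. norm (Complex x y + of_nat k)) \<le> (\<Prod>k<N. 2 * \<bar>y\<bar>)"
  proof (intro prod_mono conjI)
    fix k assume "k \<in> {..<N}"
    hence "\<bar>x + real k\<bar> \<le> \<bar>y\<bar>" using y by auto
    thus "norm (Complex x y + of_nat k) \<le> 2 * \<bar>y\<bar>" using cmod_le[of "Complex x y + of_nat k"] by simp
  qed auto
  thus "norm (pochhammer (Complex x y) N) \<le> (2 * \<bar>y\<bar>) ^ N" by (simp add: eq)
qed

lemma Complex_not_nonpos_Ints: "y \<noteq> 0 \<Longrightarrow> Complex x y \<notin> \<int>\<^sub>\<le>\<^sub>0"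
  using complex_is_Int_iff[of "Complex x y"] nonpos_Ints_Int by force

lemma norm_Gamma_shift:
  assumes "y \<noteq> 0"
  shows "norm (Gamma (Complex (x + real N) y)) = norm (pochhammer (Complex x y) N) * norm (Gamma (Complex x y))"
proof -
  have "Complex (x + real N) y = Complex x y + of_nat N" by (simp add: complex_eq_iff)
  moreover have "Gamma (Complex x y) \<noteq> 0"
    using Complex_not_nonpos_Ints[OF assms, of x] by (simp add: Gamma_eq_zero_iff)
  ultimately show ?thesis
    using pochhammer_Gamma[OF Complex_not_nonpos_Ints[OF assms, of x], of N] by (simp add: norm_divide)
qed

text \<open>Since \<open>x0\<close> may be negative, both arguments are first moved N steps to the
  right. Each move costs a product of modulus between \<open>\<bar>y\<bar> ^ N\<close> and
  \<open>(2 * \<bar>y\<bar>) ^ N\<close>, so the powers of y cancel in the comparison and only a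
  factor \<open>2 ^ N\<close> is lost.\<close>

lemma norm_Gamma_mono:
  fixes x0 x1 :: real
  assumes "x0 \<le> x1"
  obtains c Y where "c > 0" "Y > 0" "\<And>y. \<bar>y\<bar> \<ge> Y \<Longrightarrow> c * norm (Gamma (Complex x0 y)) \<le> norm (Gamma (Complex x1 y))"
proof -
  define N where "N = nat \<lceil>\<bar>x0\<bar>\<rceil> + 1"
  have N: "x0 + real N > 0" unfolding N_def by linarith
  define g where "g = Gamma (x1 + real N) / Gamma (x0 + real N)"
  have g: "g > 0" unfolding g_def using N assms by (intro divide_pos_pos Gamma_real_pos) auto
  define Y where "Y = \<bar>x0\<bar> + \<bar>x1\<bar> + real N"
  have "real N \<ge> 1" by (simp add: N_def)
  hence "Y > 0" by (simp add: Y_def)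
  show thesis
  proof (rule that[of "g / 2 ^ N" Y])
    show "g / 2 ^ N > 0" using g by simp
    show "Y > 0" by fact
    fix y :: real assume y: "\<bar>y\<bar> \<ge> Y"
    hence y0: "y \<noteq> 0" using \<open>Y > 0\<close> by auto
    from y have y1: "\<bar>y\<bar> \<ge> \<bar>x0\<bar> + real N" "\<bar>y\<bar> \<ge> \<bar>x1\<bar> + real N" by (auto simp: Y_def)
    have "g * (\<bar>y\<bar> ^ N * norm (Gamma (Complex x0 y))) \<le> g * (norm (pochhammer (Complex x0 y) N) * norm (Gamma (Complex x0 y)))"
      using g by (intro mult_left_mono mult_right_mono norm_pochhammer_Complex_bounds y1) auto
    also have "\<dots> = g * norm (Gamma (Complex (x0 + real N) y))" by (simp add: norm_Gamma_shift[OF y0])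
    also have "\<dots> \<le> norm (Gamma (Complex (x1 + real N) y))"
      using norm_Gamma_mult_ge[of "x0 + real N" "x1 + real N" y] N assms Gamma_real_pos[of "x0 + real N"]
      by (simp add: g_def field_simps)
    also have "\<dots> = norm (pochhammer (Complex x1 y) N) * norm (Gamma (Complex x1 y))"
      by (simp add: norm_Gamma_shift[OF y0])
    also have "\<dots> \<le> (2 * \<bar>y\<bar>) ^ N * norm (Gamma (Complex x1 y))"
      by (intro mult_right_mono norm_pochhammer_Complex_bounds y1) auto
    finally have "\<bar>y\<bar> ^ N * (g * norm (Gamma (Complex x0 y))) \<le> \<bar>y\<bar> ^ N * (2 ^ N * norm (Gamma (Complex x1 y)))"
      by (simp add: power_mult_distrib mult_ac)
    hence "g * norm (Gamma (Complex x0 y)) \<le> 2 ^ N * norm (Gamma (Complex x1 y))"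
      using y0 by (simp add: mult_le_cancel_left)
    thus "g / 2 ^ N * norm (Gamma (Complex x0 y)) \<le> norm (Gamma (Complex x1 y))"
      by (simp add: field_simps)
  qed
qed

text \<open>One unit step to the right multiplies Gamma by a number of modulus at least
  \<open>\<bar>y\<bar>\<close>, and the remaining distance to \<open>x1\<close> loses at most a
  constant. For the upper bound, K unit steps lead from \<open>x0\<close> to \<open>x1\<close> or
  beyond.\<close>

lemma norm_Gamma_ratio_bounds:
  fixes x0 x1 :: real
  assumes "x0 + 1 \<le> x1"
  obtains c C Y and K :: nat where "c > 0" "C > 0" "Y > 0"
    "\<And>y. \<bar>y\<bar> \<ge> Y \<Longrightarrow> c * \<bar>y\<bar> \<le> norm (Gamma (Complex x1 y)) / norm (Gamma (Complex x0 y))"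
    "\<And>y. \<bar>y\<bar> \<ge> Y \<Longrightarrow> norm (Gamma (Complex x1 y)) / norm (Gamma (Complex x0 y)) \<le> C * \<bar>y\<bar> ^ K"
proof -
  from norm_Gamma_mono[OF assms] obtain c Y where 1: "c > 0" "Y > 0"
    "\<And>y. \<bar>y\<bar> \<ge> Y \<Longrightarrow> c * norm (Gamma (Complex (x0 + 1) y)) \<le> norm (Gamma (Complex x1 y))" by blast
  define K where "K = nat \<lceil>x1 - x0\<rceil>"
  have "x1 \<le> x0 + real K" unfolding K_def by linarith
  from norm_Gamma_mono[OF this] obtain d Z where 2: "d > 0" "Z > 0"
    "\<And>y. \<bar>y\<bar> \<ge> Z \<Longrightarrow> d * norm (Gamma (Complex x1 y)) \<le> norm (Gamma (Complex (x0 + real K) y))" by blast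
  define W where "W = Y + Z + \<bar>x0\<bar> + real K + 1"
  show thesis
  proof (rule that[of c "2 ^ K / d" W K])
    show "c > 0" "2 ^ K / d > 0" "W > 0" using 1 2 by (auto simp: W_def)
    fix y :: real assume y: "\<bar>y\<bar> \<ge> W"
    hence y': "y \<noteq> 0" "\<bar>y\<bar> \<ge> Y" "\<bar>y\<bar> \<ge> Z" "\<bar>y\<bar> \<ge> \<bar>x0\<bar> + real 1" "\<bar>y\<bar> \<ge> \<bar>x0\<bar> + real K"
      using 1 2 by (auto simp: W_def)
    have nz: "norm (Gamma (Complex x0 y)) > 0"
      using Complex_not_nonpos_Ints[OF y'(1), of x0] by (simp add: Gamma_eq_zero_iff)
    have "c * (\<bar>y\<bar> ^ 1 * norm (Gamma (Complex x0 y))) \<le> c * (norm (pochhammer (Complex x0 y) 1) * norm (Gamma (Complex x0 y)))"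
      using 1 y' by (intro mult_left_mono mult_right_mono norm_pochhammer_Complex_bounds) auto
    also have "\<dots> = c * norm (Gamma (Complex (x0 + 1) y))"
      using norm_Gamma_shift[OF y'(1), of x0 1] by simp
    also have "\<dots> \<le> norm (Gamma (Complex x1 y))" using 1 y' by simp
    finally show "c * \<bar>y\<bar> \<le> norm (Gamma (Complex x1 y)) / norm (Gamma (Complex x0 y))"
      using nz by (simp add: field_simps)
    have "d * norm (Gamma (Complex x1 y)) \<le> norm (Gamma (Complex (x0 + real K) y))" using 2 y' by simp
    also have "\<dots> = norm (pochhammer (Complex x0 y) K) * norm (Gamma (Complex x0 y))"
      by (rule norm_Gamma_shift[OF y'(1)])
    also have "\<dots> \<le> (2 * \<bar>y\<bar>) ^ K * norm (Gamma (Complex x0 y))"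
      using y' by (intro mult_right_mono norm_pochhammer_Complex_bounds) auto
    finally show "norm (Gamma (Complex x1 y)) / norm (Gamma (Complex x0 y)) \<le> 2 ^ K / d * \<bar>y\<bar> ^ K"
      using nz 2 by (simp add: field_simps power_mult_distrib)
  qed
qed

text \<open>The hypothesis \<open>l * (2 * b - 1) \<ge> 1\<close> says that the two arguments have
  real parts at least 1 apart, so that every Gamma factor contributes a full power of t.\<close>

lemma Gamma_factor_ratio_bounds:
  fixes l :: real and m :: complex and b :: real
  assumes "l > 0" "l * (2 * b - 1) \<ge> 1"
  obtains c C :: real and K :: nat where "c > 0" "C > 0"
    "eventually (\<lambda>t. c * t \<le> norm (Gamma (l * Complex b t + m)) / norm (Gamma (l * Complex (1 - b) t + m))) at_top"
    "eventually (\<lambda>t. norm (Gamma (l * Complex b t + m)) / norm (Gamma (l * Complex (1 - b) t + m)) \<le> C * t ^ K) at_top"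
proof -
  have "l * (1 - b) + Re m + 1 \<le> l * b + Re m" using assms by (simp add: algebra_simps)
  from norm_Gamma_ratio_bounds[OF this] obtain c C Y and K :: nat where *: "c > 0" "C > 0" "Y > 0"
    "\<And>y. \<bar>y\<bar> \<ge> Y \<Longrightarrow> c * \<bar>y\<bar> \<le> norm (Gamma (Complex (l * b + Re m) y)) / norm (Gamma (Complex (l * (1 - b) + Re m) y))"
    "\<And>y. \<bar>y\<bar> \<ge> Y \<Longrightarrow> norm (Gamma (Complex (l * b + Re m) y)) / norm (Gamma (Complex (l * (1 - b) + Re m) y)) \<le> C * \<bar>y\<bar> ^ K"
    by blast
  have eq: "l * Complex x t + m = Complex (l * x + Re m) (l * t + Im m)" for x t
    by (simp add: complex_eq_iff)
  have ev: "eventually (\<lambda>t. l * t / 2 \<ge> \<bar>Im m\<bar> + Y) at_top" 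
    using assms by real_asymp
  show thesis
  proof (rule that[of "c * (l / 2)" "C * (2 * l) ^ K" K])
    show "c * (l / 2) > 0" "C * (2 * l) ^ K > 0" using * assms by auto
    show "eventually (\<lambda>t. c * (l / 2) * t \<le> norm (Gamma (l * Complex b t + m)) / norm (Gamma (l * Complex (1 - b) t + m))) at_top"
      using ev
    proof eventually_elim
      case (elim t)
      hence "\<bar>l * t + Im m\<bar> \<ge> l / 2 * t" "\<bar>l * t + Im m\<bar> \<ge> Y" using *(3) by auto
      hence "c * (l / 2 * t) \<le> c * \<bar>l * t + Im m\<bar>" using * by (intro mult_left_mono) auto
      thus ?case unfolding eq mult.assoc by (rule order.trans[OF _ *(4)[OF \<open>\<bar>l * t + Im m\<bar> \<ge> Y\<close>]])
    qed
    show "eventually (\<lambda>t. norm (Gamma (l * Complex b t + m)) / norm (Gamma (l * Complex (1 - b) t + m)) \<le> C * (2 * l) ^ K * t ^ K) at_top"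
      using ev
    proof eventually_elim
      case (elim t)
      hence h: "\<bar>l * t + Im m\<bar> \<le> 2 * l * t" "\<bar>l * t + Im m\<bar> \<ge> Y" using *(3) by auto
      hence "C * \<bar>l * t + Im m\<bar> ^ K \<le> C * (2 * l * t) ^ K" using * by (intro mult_left_mono power_mono) auto
      thus ?case unfolding eq using *(5)[OF h(2)] by (simp add: power_mult_distrib mult_ac)
    qed
  qed
qed

lemma eventually_prod_power_bounds:
  fixes r :: "'a \<Rightarrow> real \<Rightarrow> real"
  assumes "finite A"
    and "\<And>j. j \<in> A \<Longrightarrow> \<exists>c C. \<exists>K::nat. c > 0 \<and> C > 0 \<and> eventually (\<lambda>t. c * t \<le> r j t) at_top \<and> eventually (\<lambda>t. r j t \<le> C * t ^ K) at_top"
  shows "\<exists>c C. \<exists>K::nat. c > 0 \<and> C > 0 \<and> eventually (\<lambda>t. c * t ^ card A \<le> (\<Prod>j\<in>A. r j t)) at_top \<and> eventually (\<lambda>t. (\<Prod>j\<in>A. r j t) \<le> C * t ^ K) at_top"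
  using assms
proof (induction A rule: finite_induct)
  case empty
  show ?case by (rule exI[of _ 1] exI[of _ 0] conjI | simp)+
next
  case (insert a A)
  from insert.IH insert.prems obtain c C and K :: nat where 1: "c > 0" "C > 0" "eventually (\<lambda>t. c * t ^ card A \<le> (\<Prod>j\<in>A. r j t)) at_top" "eventually (\<lambda>t. (\<Prod>j\<in>A. r j t) \<le> C * t ^ K) at_top"
    by (auto simp: insert_iff)
  from insert.prems[of a] obtain d D and L :: nat where 2: "d > 0" "D > 0" "eventually (\<lambda>t. d * t \<le> r a t) at_top" "eventually (\<lambda>t. r a t \<le> D * t ^ L) at_top"
    by blast
  have "eventually (\<lambda>t. (d * c) * t ^ card (insert a A) \<le> (\<Prod>j\<in>insert a A. r j t)) at_top"
    using 1(3) 2(3) eventually_gt_at_top[of 0]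
  proof eventually_elim
    case (elim t)
    have "(d * t) * (c * t ^ card A) \<le> r a t * (\<Prod>j\<in>A. r j t)"
      using elim 1 2 by (intro mult_mono order.trans[OF _ elim(1)]) (auto intro: order.trans[OF _ elim(2)] order.trans[OF _ elim(1)])
    thus ?case using insert.hyps by (simp add: mult_ac)
  qed
  moreover have "eventually (\<lambda>t. (\<Prod>j\<in>insert a A. r j t) \<le> (D * C) * t ^ (L + K)) at_top"
    using 1(3,4) 2(3,4) eventually_gt_at_top[of 0]
  proof eventually_elim
    case (elim t)
    have "0 \<le> c * t ^ card A" "0 \<le> d * t" using 1 2 elim by auto
    hence "0 \<le> (\<Prod>j\<in>A. r j t)" "0 \<le> r a t" using elim by linarith+
    hence "r a t * (\<Prod>j\<in>A. r j t) \<le> (D * t ^ L) * (C * t ^ K)"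
      using elim 1 2 by (intro mult_mono) auto
    thus ?case using insert.hyps by (simp add: mult_ac power_add)
  qed
  ultimately show ?case using 1 2 by (intro exI[of _ "d * c"] exI[of _ "D * C"] exI[of _ "L + K"]) auto
qed

section \<open>Dirichlet series far to the right\<close>

lemma norm_of_nat_powr: "n > 0 \<Longrightarrow> norm (of_nat n powr s :: complex) = real n powr Re s"
  by (subst norm_powr_real_powr) auto

lemma dirichlet_leading_term:
  fixes c :: "nat \<Rightarrow> complex" and \<sigma>1 \<epsilon> :: real
  assumes sm: "summable (\<lambda>n. norm (c (Suc n)) * real (Suc n) powr (-\<sigma>1))"
    and m: "m > 0" "\<And>n. 0 < n \<Longrightarrow> n < m \<Longrightarrow> c n = 0" and \<epsilon>: "\<epsilon> > 0"
  obtains b where "\<And>s D. Re s \<ge> b \<Longrightarrow> (\<lambda>n. c (Suc n) * of_nat (Suc n) powr (-s)) sums D \<Longrightarrow>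
    norm (D * of_nat m powr s - c m) \<le> \<epsilon>"
proof -
  define S where "S = (\<Sum>n. norm (c (Suc n)) * real (Suc n) powr (-\<sigma>1))"
  define q where "q = real m / real (Suc m)"
  have q: "0 < q" "q < 1" using m by (auto simp: q_def)
  have "((\<lambda>x. S * real m powr \<sigma>1 * q powr (x - \<sigma>1)) \<longlongrightarrow> S * real m powr \<sigma>1 * 0) at_top"
    using q by (intro tendsto_mult tendsto_const) real_asymp
  hence "eventually (\<lambda>x. S * real m powr \<sigma>1 * q powr (x - \<sigma>1) < \<epsilon>) at_top"
    using \<epsilon> by (intro order_tendstoD(2)) auto
  then obtain b0 where b0: "\<And>x. x \<ge> b0 \<Longrightarrow> S * real m powr \<sigma>1 * q powr (x - \<sigma>1) < \<epsilon>"
    by (auto simp: eventually_at_top_linorder)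
  show thesis
  proof (rule that[of "max b0 \<sigma>1"])
    fix s D assume s: "Re s \<ge> max b0 \<sigma>1" and D: "(\<lambda>n. c (Suc n) * of_nat (Suc n) powr (-s)) sums D"
    define d where "d = (\<lambda>n. c (Suc n) * of_nat (Suc n) powr (-s) * of_nat m powr s - (if n = m - 1 then c m else 0))"
    have "(\<lambda>n. if n = m - 1 then c m else 0) sums c m" by (rule sums_single)
    hence d: "d sums (D * of_nat m powr s - c m)"
      unfolding d_def by (intro sums_diff sums_mult2 D)
    have bound: "norm (d n) \<le> norm (c (Suc n)) * real (Suc n) powr (-\<sigma>1) * (real m powr \<sigma>1 * q powr (Re s - \<sigma>1))" for n
    proof -
      consider "Suc n < m" | "Suc n = m" | "Suc n > m" by linarith
      thus ?thesis
      proof cases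
        case 1 thus ?thesis using m by (auto simp: d_def)
      next
        case 2
        have "of_nat m powr (- s) * of_nat m powr s = (1 :: complex)"
          using m by (simp add: powr_minus)
        hence "d n = 0" unfolding d_def using 2 by (simp add: mult.assoc)
        thus ?thesis by simp
      next
        case 3
        hence "norm (d n) = norm (c (Suc n)) * (real (Suc n) powr (- Re s) * real m powr Re s)"
          using m unfolding d_def by (auto simp: norm_mult norm_of_nat_powr simp del: of_nat_Suc)
        also have "real (Suc n) powr (- Re s) * real m powr Re s =
           real (Suc n) powr (-\<sigma>1) * real m powr \<sigma>1 * (real m / real (Suc n)) powr (Re s - \<sigma>1)"
          using m by (simp add: powr_divide powr_minus powr_diff field_simps)
        also have "norm (c (Suc n)) * \<dots> \<le> norm (c (Suc n)) * (real (Suc n) powr (-\<sigma>1) * real m powr \<sigma>1 * q powr (Re s - \<sigma>1))"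
          using s m 3 by (intro mult_left_mono powr_mono2) (auto simp: q_def intro!: divide_left_mono)
        finally show ?thesis by (simp only: mult.assoc)
      qed
    qed
    have sm': "summable (\<lambda>n. norm (c (Suc n)) * real (Suc n) powr (-\<sigma>1) * (real m powr \<sigma>1 * q powr (Re s - \<sigma>1)))"
      by (intro summable_mult2 sm)
    have "norm (D * of_nat m powr s - c m) = norm (suminf d)" using sums_unique[OF d] by simp
    also have "\<dots> \<le> (\<Sum>n. norm (c (Suc n)) * real (Suc n) powr (-\<sigma>1) * (real m powr \<sigma>1 * q powr (Re s - \<sigma>1)))"
      by (rule norm_suminf_le[OF bound sm'])
    also have "\<dots> = S * (real m powr \<sigma>1 * q powr (Re s - \<sigma>1))"
      unfolding S_def by (rule suminf_mult2[symmetric, OF sm])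
    also have "\<dots> \<le> \<epsilon>" using b0[of "Re s"] s by (simp add: mult.assoc less_imp_le)
    finally show "norm (D * of_nat m powr s - c m) \<le> \<epsilon>" .
  qed
qed

lemma dirichlet_series_unique:
  fixes c :: "nat \<Rightarrow> complex"
  assumes sm: "summable (\<lambda>n. norm (c (Suc n)) * real (Suc n) powr (-\<sigma>1))"
    and z: "\<And>s. Re s \<ge> b0 \<Longrightarrow> (\<lambda>n. c (Suc n) * of_nat (Suc n) powr (-s)) sums 0"
    and "n > 0"
  shows "c n = 0"
  using \<open>n > 0\<close>
proof (induction n rule: less_induct)
  case (less m)
  show ?case
  proof (rule ccontr)
    assume nz: "c m \<noteq> 0"
    obtain b where b: "\<And>s D. Re s \<ge> b \<Longrightarrow> (\<lambda>n. c (Suc n) * of_nat (Suc n) powr (-s)) sums D \<Longrightarrow>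
        norm (D * of_nat m powr s - c m) \<le> norm (c m) / 2"
      by (rule dirichlet_leading_term[OF sm less.prems, of "norm (c m) / 2"]) (use less nz in auto)
    show False using b[OF _ z, of "of_real (max b b0)"] nz by simp
  qed
qed

text \<open>The exponent \<open>k + 2\<close> leaves the convergent series of inverse squares. The
  case \<open>k = 1\<close> is the source of the abscissa 3 in the later applications.\<close>

lemma polynomial_coeffs_summable:
  fixes c :: "nat \<Rightarrow> complex"
  assumes "\<And>n. n > 0 \<Longrightarrow> norm (c n) \<le> C * real n powr k"
  shows "summable (\<lambda>n. norm (c (Suc n)) * real (Suc n) powr (-(k + 2)))"
proof (rule summable_comparison_test')
  have "summable (\<lambda>n. real n powr (-2))" by (subst summable_real_powr_iff) auto
  hence "summable (\<lambda>n. real (Suc n) powr (-2))" by (subst summable_Suc_iff)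
  thus "summable (\<lambda>n. C * real (Suc n) powr (-2))" by (rule summable_mult)
  fix n :: nat
  have "norm (c (Suc n)) * real (Suc n) powr (-(k + 2)) \<le> (C * real (Suc n) powr k) * real (Suc n) powr (-(k + 2))"
    using assms[of "Suc n"] by (intro mult_right_mono) auto
  also have "\<dots> = C * real (Suc n) powr (-2)" by (simp add: mult.assoc flip: powr_add)
  finally show "norm (norm (c (Suc n)) * real (Suc n) powr (-(k + 2))) \<le> C * real (Suc n) powr (-2)"
    by simp
qed

lemma dirichlet_sums_norm_le:
  fixes c :: "nat \<Rightarrow> complex"
  assumes sm: "summable (\<lambda>n. norm (c (Suc n)) * real (Suc n) powr (-\<sigma>1))" and s: "Re s \<ge> \<sigma>1"
  shows "summable (\<lambda>n. norm (c (Suc n) * of_nat (Suc n) powr (-s)))"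
    and "(\<lambda>n. c (Suc n) * of_nat (Suc n) powr (-s)) sums D \<Longrightarrow>
           norm D \<le> (\<Sum>n. norm (c (Suc n)) * real (Suc n) powr (-\<sigma>1))"
proof -
  have le: "norm (c (Suc n) * of_nat (Suc n) powr (-s)) \<le> norm (c (Suc n)) * real (Suc n) powr (-\<sigma>1)" for n
    using s unfolding norm_mult by (subst norm_of_nat_powr) (auto intro!: mult_left_mono powr_mono)
  show "summable (\<lambda>n. norm (c (Suc n) * of_nat (Suc n) powr (-s)))"
    by (rule summable_comparison_test'[OF sm]) (use le in auto)
  show "norm D \<le> (\<Sum>n. norm (c (Suc n)) * real (Suc n) powr (-\<sigma>1))"
    if "(\<lambda>n. c (Suc n) * of_nat (Suc n) powr (-s)) sums D"
    using norm_suminf_le[OF le sm] sums_unique[OF that] by simp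
qed

lemma ramanujan_bound_linear:
  assumes "ramanujan_bound f"
  obtains C where "C > 0" "\<And>n. n > 0 \<Longrightarrow> norm (f n) \<le> C * real n powr 1"
proof -
  have "(\<lambda>n. norm (f n)) \<in> O(\<lambda>n. real n powr 1)"
    using assms unfolding ramanujan_bound_def by (meson zero_less_one)
  then obtain c where c: "c > 0" "eventually (\<lambda>n. norm (norm (f n)) \<le> c * norm (real n powr 1)) sequentially"
    by (elim landau_o.bigE)
  then obtain N where N: "\<And>n. n \<ge> N \<Longrightarrow> norm (f n) \<le> c * real n"
    by (auto simp: eventually_sequentially)
  define C where "C = c + (\<Sum>n<N. norm (f n))"
  show thesis
  proof (rule that[of C])
    show "C > 0" using c(1) unfolding C_def by (intro add_pos_nonneg sum_nonneg) auto
    fix n :: nat assume n: "n > 0"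
    have nonneg: "(\<Sum>n<N. norm (f n)) \<ge> 0" by (intro sum_nonneg) auto
    show "norm (f n) \<le> C * real n powr 1"
    proof (cases "n \<ge> N")
      case True
      have "norm (f n) \<le> c * real n" by (rule N[OF True])
      also have "\<dots> \<le> C * real n" using nonneg by (intro mult_right_mono) (auto simp: C_def)
      finally show ?thesis using n by simp
    next
      case False
      hence "norm (f n) \<le> (\<Sum>n<N. norm (f n))" by (intro member_le_sum) auto
      also have "\<dots> \<le> C * 1" using c by (simp add: C_def)
      also have "\<dots> \<le> C * real n" using n \<open>C > 0\<close> by (intro mult_left_mono) auto
      finally show ?thesis using n by simp
    qed
  qed
qed

section \<open>Short gaps from one-sided growth\<close>

text \<open>The points 0 and \<open>2 * M\<close> are mirror images in the line
  \<open>Re w = M\<close>; a point on the left of this line is no farther from 0 than from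
  \<open>2 * M\<close>.\<close>

lemma norm_le_norm_reflect:
  fixes w :: complex
  assumes "Re w \<le> M" "M > 0"
  shows "norm w \<le> norm (2 * of_real M - w)" and "2 * of_real M - w \<noteq> 0"
proof -
  have "(Re w)\<^sup>2 \<le> (2 * M - Re w)\<^sup>2"
  proof -
    have "(2 * M - Re w)\<^sup>2 - (Re w)\<^sup>2 = 4 * M * (M - Re w)" by (simp add: power2_eq_square algebra_simps)
    also have "\<dots> \<ge> 0" using assms by simp
    finally show ?thesis by simp
  qed
  thus "norm w \<le> norm (2 * of_real M - w)" by (simp add: cmod_def)
  show "2 * of_real M - w \<noteq> 0" using assms by (auto simp: complex_eq_iff)
qed

lemma Re_sinh: "Re (sinh z) = sinh (Re z) * cos (Im z)" for z :: complex
  by (simp add: sinh_def Re_exp algebra_simps)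

text \<open>
  The exponent of the comparison function is the real part of a holomorphic function that is
  nonpositive off the right edge, where it is at most \<open>ln (2 * M - 1)\<close>; it plays the role of a
  multiple of harmonic measure. The quotient \<open>F / (2 * M - F)\<close> turns the one-sided bound on
  \<open>Re F\<close> into a bound on a modulus, as in the Borel--Caratheodory theorem.
\<close>

lemma two_constants_rectangle:
  fixes F :: "complex \<Rightarrow> complex" and x0 x1 x T d M :: real
  assumes F: "F holomorphic_on U" "open U" "cbox (Complex x0 (T - d)) (Complex x1 (T + d)) \<subseteq> U"
    and upper: "\<And>z. z \<in> cbox (Complex x0 (T - d)) (Complex x1 (T + d)) \<Longrightarrow> Re (F z) \<le> M"
    and right: "\<And>z. Re z = x1 \<Longrightarrow> \<bar>Im z - T\<bar> \<le> d \<Longrightarrow> norm (F z) \<le> 1"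
    and x: "x0 < x" "x < x1" and d: "d > 0" and M: "M \<ge> 1"
    and \<omega>: "\<omega> = sinh (pi * (x - x0) / (2 * d)) / sinh (pi * (x1 - x0) / (2 * d))"
    and \<eta>: "\<eta> = (2 * M - 1) powr (- \<omega>)"
  shows "norm (F (Complex x T)) \<le> \<eta> * norm (2 * of_real M - F (Complex x T))"
proof -
  define R where "R = cbox (Complex x0 (T - d)) (Complex x1 (T + d))"
  have in_R: "z \<in> R \<longleftrightarrow> x0 \<le> Re z \<and> Re z \<le> x1 \<and> \<bar>Im z - T\<bar> \<le> d" for z
    by (auto simp: R_def in_cbox_complex_iff abs_le_iff)
  define \<kappa> where "\<kappa> = ln (2 * M - 1) / sinh (pi * (x1 - x0) / (2 * d))"
  have sh: "sinh (pi * (x1 - x0) / (2 * d)) > 0" using x d by (subst sinh_real_pos_iff) auto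
  have \<kappa>: "\<kappa> \<ge> 0" unfolding \<kappa>_def using sh M by (intro divide_nonneg_pos) auto
  \<comment> \<open>The scale \<open>pi / (2 * d)\<close> makes the cosine in \<open>Re_G\<close>
    vanish on the horizontal edges, the shift by \<open>x0\<close> makes the hyperbolic sine vanish
    on the left edge, and \<kappa> makes the right edge reach \<open>ln (2 * M - 1)\<close> at
    height T.\<close>
  define G where "G = (\<lambda>z. of_real \<kappa> * sinh (of_real (pi / (2 * d)) * (z - Complex x0 T)))"
  define h where "h = (\<lambda>z. F z / (2 * of_real M - F z) * exp (G z))"
  have nz: "2 * of_real M - F z \<noteq> 0" if "z \<in> R" for z
    using norm_le_norm_reflect(2)[OF upper] that M by (auto simp: R_def)
  have quot: "norm (F z / (2 * of_real M - F z)) \<le> 1" if "z \<in> R" for z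
    using norm_le_norm_reflect[OF upper[of z], OF that[unfolded R_def]] M by (simp add: norm_divide)
  have Re_G: "Re (G z) = \<kappa> * (sinh (pi * (Re z - x0) / (2 * d)) * cos (pi * (Im z - T) / (2 * d)))" for z
    by (simp add: G_def Re_sinh)
  have RU: "R \<subseteq> U" using F(3) by (simp add: R_def)
  have "norm (h (Complex x T)) \<le> 1"
  proof (rule maximum_modulus_frontier[of h R])
    show "h holomorphic_on interior R"
      unfolding h_def G_def sinh_field_def
      by (intro holomorphic_intros holomorphic_on_subset[OF F(1)])
        (use RU nz interior_subset[of R] in auto)
    have "closure R = R" by (simp add: R_def)
    show "continuous_on (closure R) h"
      unfolding \<open>closure R = R\<close> h_def G_def sinh_field_def
      by (intro continuous_intros continuous_on_subset[OF holomorphic_on_imp_continuous_on[OF F(1)]])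
        (use RU nz d in auto)
    show "bounded R" by (simp add: R_def)
    show "Complex x T \<in> R" using x d by (simp add: in_R)
  next
    fix z assume "z \<in> frontier R"
    hence zR: "z \<in> R" and "z \<notin> interior R" by (auto simp: R_def frontier_def)
    moreover have "z \<in> interior R" if "x0 < Re z" "Re z < x1" "\<bar>Im z - T\<bar> < d"
      using that by (auto simp: R_def interior_cbox in_box_complex_iff)
    ultimately consider "Re z = x0" | "Re z = x1" | "\<bar>Im z - T\<bar> = d"
      unfolding in_R by fastforce
    thus "norm (h z) \<le> 1"
    proof cases
      case 1
      hence "Re (G z) = 0" by (simp add: Re_G)
      thus ?thesis using quot[OF zR] unfolding h_def norm_mult norm_exp by simp
    next
      case 3
      hence "Im z - T = d \<or> Im z - T = - d" by linarith
      hence "pi * (Im z - T) / (2 * d) = pi / 2 \<or> pi * (Im z - T) / (2 * d) = - (pi / 2)"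
        by (elim disjE) (use d in simp_all)
      hence "cos (pi * (Im z - T) / (2 * d)) = 0" by (metis cos_minus cos_pi_half)
      hence "Re (G z) = 0" by (simp add: Re_G)
      thus ?thesis using quot[OF zR] unfolding h_def norm_mult norm_exp by simp
    next
      case 2
      \<comment> \<open>On the right edge the smallness \<open>1 / (2 * M - 1)\<close> of the
        quotient pays exactly for the growth of \<open>exp (G z)\<close>.\<close>
      have "norm (F z) \<le> 1" using right 2 zR by (auto simp: in_R)
      moreover have "norm (2 * of_real M - F z) \<ge> 2 * M - norm (F z)"
        using norm_triangle_ineq2[of "2 * of_real M" "F z"] M by (simp add: norm_mult)
      ultimately have "norm (F z / (2 * of_real M - F z)) \<le> 1 / (2 * M - 1)"
        using M unfolding norm_divide by (intro frac_le) auto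
      moreover have "exp (Re (G z)) \<le> 2 * M - 1"
      proof -
        have "Re (G z) = ln (2 * M - 1) * cos (pi * (Im z - T) / (2 * d))"
          unfolding Re_G 2 \<kappa>_def using sh by (metis (no_types) less_irrefl mult.assoc nonzero_divide_eq_eq)
        also have "\<dots> \<le> ln (2 * M - 1) * 1" using M by (intro mult_left_mono) auto
        finally show ?thesis using M by (simp add: ln_ge_iff)
      qed
      ultimately have "norm (h z) \<le> 1 / (2 * M - 1) * (2 * M - 1)"
        unfolding h_def norm_mult norm_exp using M by (intro mult_mono) auto
      thus ?thesis using M by simp
    qed
  qed
  moreover have "Re (G (Complex x T)) = \<omega> * ln (2 * M - 1)"
    by (simp add: Re_G \<kappa>_def \<omega>)
  moreover have "exp (\<omega> * ln (2 * M - 1)) = 1 / \<eta>"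
    using M by (simp add: \<eta> powr_def exp_minus inverse_eq_divide)
  ultimately have "norm (F (Complex x T)) / norm (2 * of_real M - F (Complex x T)) * (1 / \<eta>) \<le> 1"
    unfolding h_def norm_mult[of "_ / _"] norm_exp norm_divide by simp
  moreover have "\<eta> > 0" using M by (simp add: \<eta>)
  moreover have "norm (2 * of_real M - F (Complex x T)) > 0"
    using nz[of "Complex x T"] x d by (simp add: in_R)
  moreover have "a \<le> e * N" if "a / N * (1 / e) \<le> 1" "e > 0" "N > 0" for a e N :: real
    using that by (simp add: field_simps)
  ultimately show ?thesis by blast
qed

section \<open>Holomorphic logarithms and their normalisation\<close>

lemma exp_eq_imp_diff_constant:
  assumes "f holomorphic_on S" "g holomorphic_on S" "open S" "connected S"
    and eq: "\<And>s. s \<in> S \<Longrightarrow> exp (f s) = C * exp (g s)"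
  obtains c where "\<And>s. s \<in> S \<Longrightarrow> f s = g s + c"
proof -
  have "(\<lambda>s. f s - g s) constant_on S"
  proof (rule has_field_derivative_0_imp_constant_on)
    fix z assume z: "z \<in> S"
    have hol: "(\<lambda>s. f s - g s) holomorphic_on S" by (intro holomorphic_intros assms)
    define D where "D = deriv (\<lambda>s. f s - g s) z"
    have D: "((\<lambda>s. f s - g s) has_field_derivative D) (at z)"
      unfolding D_def by (rule holomorphic_derivI[OF hol \<open>open S\<close> z])
    have "((\<lambda>s. exp (f s - g s)) has_field_derivative exp (f z - g z) * D) (at z)"
      by (rule DERIV_fun_exp[OF D, unfolded o_def])
    moreover have "((\<lambda>s. exp (f s - g s)) has_field_derivative 0) (at z)"
    proof (rule has_field_derivative_transform_within_open[of "\<lambda>_. C" 0 z S])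
      show "C = exp (f s - g s)" if "s \<in> S" for s
        using eq[OF that] by (simp add: exp_diff)
    qed (use assms z in auto)
    ultimately have "D = 0" using DERIV_unique by fastforce
    thus "((\<lambda>s. f s - g s) has_field_derivative 0) (at z)" using D by simp
  qed (use assms in auto)
  then obtain c where c: "\<And>s. s \<in> S \<Longrightarrow> f s - g s = c" unfolding constant_on_def by blast
  show thesis by (rule that[of c]) (use c in \<open>simp add: algebra_simps\<close>)
qed

text \<open>A logarithm exists on the convex strip but is determined only up to a period. On the
  right part it differs from the principal logarithm by a constant, which is subtracted. The radius
  \<open>1/2\<close> keeps g off the negative real axis there and bounds its principal logarithm by
  1.\<close>

lemma nonvanishing_strip_log:
  assumes hol: "g holomorphic_on {s. \<bar>Im s - T\<bar> < e}" and e: "e > 0"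
    and nz: "\<And>s. \<bar>Im s - T\<bar> < e \<Longrightarrow> g s \<noteq> 0"
    and right: "\<And>s. \<bar>Im s - T\<bar> < e \<Longrightarrow> Re s > b \<Longrightarrow> norm (g s - 1) < 1/2"
  obtains F where "F holomorphic_on {s. \<bar>Im s - T\<bar> < e}" "\<And>s. \<bar>Im s - T\<bar> < e \<Longrightarrow> exp (F s) = g s"
    "\<And>s. \<bar>Im s - T\<bar> < e \<Longrightarrow> Re s > b \<Longrightarrow> norm (F s) \<le> 1"
proof -
  define S where "S = {s. \<bar>Im s - T\<bar> < e}"
  have S: "S = {s. Im s < T + e} \<inter> {s. Im s > T - e}" by (auto simp: S_def)
  have S_props: "convex S" "open S"
    unfolding S by (intro convex_Int open_Int convex_halfspace_Im_lt convex_halfspace_Im_gt open_halfspace_Im_lt open_halfspace_Im_gt)+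
  define W where "W = S \<inter> {s. Re s > b}"
  have W_props: "connected W" "open W"
    unfolding W_def using S_props
    by (intro convex_connected convex_Int open_Int convex_halfspace_Re_gt open_halfspace_Re_gt; simp)+
  have holS: "g holomorphic_on S" using hol by (simp add: S_def)
  obtain F where F: "F holomorphic_on S" "\<And>s. s \<in> S \<Longrightarrow> exp (F s) = g s"
    by (rule holomorphic_logarithm_exists[OF S_props holS, of "Complex 0 T"]) (use nz e in \<open>auto simp: S_def\<close>)
  have pos: "Re (g s) > 0" "norm (Ln (g s)) \<le> 1" if "s \<in> W" for s
  proof -
    have *: "norm (g s - 1) < 1/2" using right[of s] that by (auto simp: W_def S_def)
    show "Re (g s) > 0" using abs_Re_le_cmod[of "g s - 1"] * by simp
    show "norm (Ln (g s)) \<le> 1" using norm_Ln_le[of "g s - 1"] * by simp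
  qed
  have "(\<lambda>s. Ln (g s)) holomorphic_on W"
    by (intro holomorphic_on_Ln' holomorphic_on_subset[OF holS])
      (use pos in \<open>auto simp: W_def complex_nonpos_Reals_iff, fastforce\<close>)
  moreover have "exp (F s) = 1 * exp (Ln (g s))" if "s \<in> W" for s
  proof -
    have "g s \<noteq> 0" using pos(1)[OF that] by force
    thus ?thesis using F(2)[of s] that by (simp add: W_def)
  qed
  moreover have "F holomorphic_on W" by (rule holomorphic_on_subset[OF F(1)]) (auto simp: W_def)
  ultimately obtain c where c: "\<And>s. s \<in> W \<Longrightarrow> F s = Ln (g s) + c"
    using exp_eq_imp_diff_constant[of F W "\<lambda>s. Ln (g s)" 1] W_props by blast
  define s0 where "s0 = Complex (b + 1) T"
  have s0: "s0 \<in> W" using e by (auto simp: s0_def W_def S_def)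
  have "exp c = 1"
  proof -
    have [simp]: "g s0 \<noteq> 0" using pos(1)[OF s0] by force
    have "g s0 = exp (F s0)" using F(2) s0 by (auto simp: W_def)
    also have "\<dots> = g s0 * exp c" using c[OF s0] pos(1)[OF s0] by (auto simp: exp_add)
    finally show ?thesis using pos(1)[OF s0] by auto
  qed
  show thesis
  proof (rule that[of "\<lambda>s. F s - c"])
    show "(\<lambda>s. F s - c) holomorphic_on {s. \<bar>Im s - T\<bar> < e}"
      using F(1) unfolding S_def by (intro holomorphic_intros)
    show "exp (F s - c) = g s" if "\<bar>Im s - T\<bar> < e" for s
      using F(2)[of s] that \<open>exp c = 1\<close> by (simp add: S_def exp_diff)
    show "norm (F s - c) \<le> 1" if "\<bar>Im s - T\<bar> < e" "Re s > b" for s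
      using pos(2)[of s] c[of s] that by (simp add: W_def S_def)
  qed
qed

lemma sinh_ratio_ge:
  fixes u v :: real
  assumes "u \<ge> 2" "v > 0"
  shows "sinh u / sinh v \<ge> exp (- v)"
proof -
  have "exp u \<ge> 1 + u" by (rule exp_ge_add_one_self)
  moreover have "exp (- u) \<le> 1" using assms by simp
  ultimately have "(1 + u) - 1 \<le> exp u - exp (- u)" by (rule diff_mono)
  hence "2 \<le> exp u - exp (- u)" using order.trans[of 2 "(1 + u) - 1" "exp u - exp (- u)"] assms(1) by auto
  hence 1: "sinh u \<ge> 1" by (simp add: sinh_field_def)
  have 2: "sinh v \<le> exp v"
  proof -
    have "(x - y) / 2 \<le> x" if "x > 0" "y > 0" for x y :: real using that by simp
    thus ?thesis unfolding sinh_field_def by (metis exp_gt_zero)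
  qed
  have "sinh v > 0" using assms by (simp add: sinh_real_pos_iff)
  have "exp (- v) = 1 / exp v" by (simp add: exp_minus inverse_eq_divide)
  also have "\<dots> \<le> sinh u / sinh v" using 1 2 \<open>sinh v > 0\<close> assms by (intro frac_le) auto
  finally show ?thesis .
qed

text \<open>Here g stands for \<open>L - \<alpha>\<close> divided by its leading term. The upper
  bound starts at \<open>a - 1\<close>, one unit to the left of the line with the lower bound, so
  that this line runs inside the rectangle at a fixed distance from its left edge.\<close>

lemma short_gaps:
  fixes g :: "complex \<Rightarrow> complex" and a b c C Y :: real and K :: nat
  assumes hol: "g holomorphic_on {s. Im s > Y}"
    and right: "\<And>s. Im s > Y \<Longrightarrow> Re s > b - 1 \<Longrightarrow> norm (g s - 1) < 1/2"
    and upper: "\<And>s. Im s \<ge> Y \<Longrightarrow> a - 1 \<le> Re s \<Longrightarrow> Re s \<le> b \<Longrightarrow> norm (g s) \<le> C * Im s ^ K"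
    and lower: "\<And>t. t \<ge> Y \<Longrightarrow> norm (g (Complex a t)) \<ge> c * t"
    and ab: "a < b" and c: "c > 0" and C: "C > 0"
  obtains A T0 where "A > 0" "T0 > exp 3" 
    "\<And>T. T \<ge> T0 \<Longrightarrow> \<exists>s. g s = 0 \<and> Im s > Y \<and> \<bar>Im s - T\<bar> < A / ln (ln (ln T))"
proof -
  define w where "w = b - a + 1"
  have w: "w > 1" using ab by (simp add: w_def)
  \<comment> \<open>With \<open>d = A / ln (ln (ln T)) / 2\<close> this gives
    \<open>pi * w / (2 * d) = ln (ln (ln T)) / 2\<close>. Hence \<omega> is at least
    \<open>ln (ln T) powr (- (1/2))\<close>, and its product with \<open>ln (2 * M - 1)\<close> is
    at least \<open>ln (ln T) powr (1/2)\<close>, which tends to infinity.\<close>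
  define A where "A = 2 * pi * w"
  have A: "A > 0" using w by (simp add: A_def)
  define B where "B = real K + 1"
  have B: "B \<ge> 1" by (simp add: B_def)
  have "eventually (\<lambda>T::real. T > exp 3) at_top" by (rule eventually_gt_at_top)
  moreover have "eventually (\<lambda>T. T - 1 > Y) at_top" by real_asymp
  moreover have "eventually (\<lambda>T::real. ln (ln (ln T)) > A) at_top" by real_asymp
  moreover have "eventually (\<lambda>T::real. ln (ln (ln T)) > 0) at_top" by real_asymp
  moreover have "eventually (\<lambda>T::real. ln (ln T) > 0) at_top" by real_asymp
  moreover have "eventually (\<lambda>T::real. ln T > 1) at_top" by real_asymp
  moreover have "eventually (\<lambda>T. ln C + real K * ln (T + 1) \<le> B * ln T) at_top"
    unfolding B_def by real_asymp
  moreover have "eventually (\<lambda>T. ln c + ln T \<ge> ln T / 2) at_top" by real_asymp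
  \<comment> \<open>The value \<open>1 / (8 * B)\<close> makes the final bound
    \<open>4 * M * \<eta>\<close>, with \<open>M = B * ln T\<close>, smaller than
    \<open>ln T / 2\<close>, while the lower bound on the line \<open>Re s = a\<close> gives at
    least \<open>ln T / 2\<close>.\<close>
  moreover have "eventually (\<lambda>T. exp (- (ln (ln T) powr (1/2))) < 1 / (8 * B)) at_top"
    using B by real_asymp
  ultimately have "eventually (\<lambda>T. T > exp 3 \<and> T - 1 > Y \<and> ln (ln (ln T)) > A \<and> ln (ln (ln T)) > 0 \<and> ln (ln T) > 0 \<and> ln T > 1 \<and>
     ln C + real K * ln (T + 1) \<le> B * ln T \<and> ln c + ln T \<ge> ln T / 2 \<and> exp (- (ln (ln T) powr (1/2))) < 1 / (8 * B)) at_top"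
    by eventually_elim auto
  then obtain T0 where T0: "\<And>T. T \<ge> T0 \<Longrightarrow> T > exp 3 \<and> T - 1 > Y \<and> ln (ln (ln T)) > A \<and> ln (ln (ln T)) > 0 \<and> ln (ln T) > 0 \<and> ln T > 1 \<and>
     ln C + real K * ln (T + 1) \<le> B * ln T \<and> ln c + ln T \<ge> ln T / 2 \<and> exp (- (ln (ln T) powr (1/2))) < 1 / (8 * B)"
    by (auto simp: eventually_at_top_linorder)
  show thesis
  proof (rule that[of A T0])
    show "A > 0" by fact
    show "T0 > exp 3" using T0[of T0] by simp
    fix T assume "T \<ge> T0"
    note T = T0[OF this]
    \<comment> \<open>Half of the distance in the claim: zeros are excluded within
      \<open>2 * d\<close> of T, and the closed rectangle of half-height d lies inside that open
      strip. The bound \<open>d < 1/2\<close> keeps all heights below \<open>T + 1\<close> and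
      provides the hypothesis \<open>u \<ge> 2\<close> of \<open>sinh_ratio_ge\<close>.\<close>
    define d where "d = A / ln (ln (ln T)) / 2"
    have d: "d > 0" "d < 1/2" using T A by (auto simp: d_def field_simps)
    have "T > exp 3" using T by simp
    hence Tpos: "T > 1" by (smt (verit) exp_gt_one)
    show "\<exists>s. g s = 0 \<and> Im s > Y \<and> \<bar>Im s - T\<bar> < A / ln (ln (ln T))"
    proof (rule ccontr)
      assume contra: "\<not> ?thesis"
      have strip: "Im s > Y" "Im s \<le> T + 1" "Im s > 0" if "\<bar>Im s - T\<bar> < 2 * d" for s
        using that d T Tpos by auto
      have nz: "g s \<noteq> 0" if "\<bar>Im s - T\<bar> < 2 * d" for s
        using contra strip[OF that] that by (auto simp: d_def)
      obtain F where F: "F holomorphic_on {s. \<bar>Im s - T\<bar> < 2 * d}"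
        "\<And>s. \<bar>Im s - T\<bar> < 2 * d \<Longrightarrow> exp (F s) = g s"
        "\<And>s. \<bar>Im s - T\<bar> < 2 * d \<Longrightarrow> Re s > b - 1 \<Longrightarrow> norm (F s) \<le> 1"
      proof (rule nonvanishing_strip_log[of g T "2 * d" "b - 1"])
        show "g holomorphic_on {s. \<bar>Im s - T\<bar> < 2 * d}"
          by (rule holomorphic_on_subset[OF hol]) (use strip in auto)
      qed (use d nz right strip in auto)
      have ReF: "Re (F s) = ln (norm (g s))" if "\<bar>Im s - T\<bar> < 2 * d" for s
        using arg_cong[OF F(2)[OF that], of norm] by (metis ln_exp norm_exp_eq_Re)
      define M where "M = B * ln T"
      have M: "M \<ge> ln T" using mult_right_mono[OF B, of "ln T"] T by (simp add: M_def)
      moreover have "M > 1" using M T by linarith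
      ultimately have M: "M \<ge> ln T" "M > 1" by auto
      define \<omega> where "\<omega> = sinh (pi * (a - (a - 1)) / (2 * d)) / sinh (pi * (b - (a - 1)) / (2 * d))"
      define \<eta> where "\<eta> = (2 * M - 1) powr (- \<omega>)"
      let ?F = "F (Complex a T)"
      have main: "norm ?F \<le> \<eta> * norm (2 * of_real M - ?F)"
      proof (rule two_constants_rectangle[OF F(1) _ _ _ _ _ _ _ _ \<omega>_def \<eta>_def])
        have "{s. \<bar>Im s - T\<bar> < 2 * d} = {s. Im s < T + 2 * d} \<inter> {s. Im s > T - 2 * d}" by auto
        thus "open {s. \<bar>Im s - T\<bar> < 2 * d}"
          by (auto intro!: open_Int open_halfspace_Im_lt open_halfspace_Im_gt)
        show "cbox (Complex (a - 1) (T - d)) (Complex b (T + d)) \<subseteq> {s. \<bar>Im s - T\<bar> < 2 * d}"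
          using d by (auto simp: in_cbox_complex_iff)
        show "norm (F z) \<le> 1" if "Re z = b" "\<bar>Im z - T\<bar> \<le> d" for z
          using F(3)[of z] that d by auto
        show "Re (F z) \<le> M" if "z \<in> cbox (Complex (a - 1) (T - d)) (Complex b (T + d))" for z
        proof -
          have z: "a - 1 \<le> Re z" "Re z \<le> b" "\<bar>Im z - T\<bar> < 2 * d"
            using that d by (auto simp: in_cbox_complex_iff)
          have "norm (g z) \<le> C * Im z ^ K" using strip[OF z(3)] z by (intro upper) auto
          also have "\<dots> \<le> C * (T + 1) ^ K" using strip[OF z(3)] C by (intro mult_left_mono power_mono) auto
          finally have "ln (norm (g z)) \<le> ln (C * (T + 1) ^ K)"
            using nz[OF z(3)] C Tpos by (subst ln_le_cancel_iff) auto
          also have "\<dots> = ln C + real K * ln (T + 1)" using C Tpos by (simp add: ln_mult ln_realpow)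
          also have "\<dots> \<le> M" using T by (simp add: M_def)
          finally show ?thesis by (simp add: ReF[OF z(3)])
        qed
      qed (use d ab M in auto)
      have "exp (- (ln (ln T) powr (1/2))) < 1 / (8 * B)" using T by simp
      moreover have "\<eta> \<le> exp (- (ln (ln T) powr (1/2)))"
      proof -
        have "ln (ln T) powr (1/2) = exp (- (pi * w / (2 * d))) * ln (ln T)"
        proof -
          have "pi * w / (2 * d) = ln (ln (ln T)) / 2" using T w by (simp add: d_def A_def field_simps)
          hence "exp (- (pi * w / (2 * d))) = ln (ln T) powr (- (1/2))" using T by (simp add: powr_def)
          hence "exp (- (pi * w / (2 * d))) * ln (ln T) = ln (ln T) powr (- (1/2)) * ln (ln T) powr 1" using T by simp
          also have "\<dots> = ln (ln T) powr (1/2)" by (simp only: flip: powr_add) simp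
          finally show ?thesis by simp
        qed
        also have "\<dots> \<le> \<omega> * ln (2 * M - 1)"
        proof (rule mult_mono)
          have "pi * (a - (a - 1)) / (2 * d) \<ge> 2" using d pi_gt3 by (simp add: field_simps)
          moreover have "pi * w / (2 * d) > 0" using d w by simp
          ultimately show "exp (- (pi * w / (2 * d))) \<le> \<omega>"
            using sinh_ratio_ge[of "pi * (a - (a - 1)) / (2 * d)" "pi * w / (2 * d)"] by (simp add: \<omega>_def w_def algebra_simps)
          thus "0 \<le> \<omega>" by (smt (verit) exp_gt_zero)
          show "ln (ln T) \<le> ln (2 * M - 1)" using M T by simp
        qed (use T in auto)
        finally show ?thesis using M by (simp add: \<eta>_def powr_def)
      qed
      ultimately have \<eta>: "\<eta> < 1 / (8 * B)" by linarith
      have \<eta>0: "\<eta> > 0" using M by (simp add: \<eta>_def)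
      have "1 / (8 * B) \<le> 1 / 2" using B by (simp add: field_simps)
      hence "\<eta> \<le> 1 / 2" using \<eta> by simp
      \<comment> \<open>Because \<eta> is at most \<open>1/2\<close>, the term with
        \<open>norm ?F\<close> on the right can be absorbed on the left, at the cost of doubling the
        constant 2.\<close>
      have "norm ?F \<le> \<eta> * (2 * M + norm ?F)"
      proof (rule order.trans[OF main])
        have "norm (2 * of_real M - ?F) \<le> 2 * M + norm ?F"
          using norm_triangle_ineq4[of "2 * of_real M" ?F] M by (simp add: norm_mult)
        thus "\<eta> * norm (2 * of_real M - ?F) \<le> \<eta> * (2 * M + norm ?F)"
          using \<eta>0 by (intro mult_left_mono) auto
      qed
      also have "\<dots> \<le> 2 * M * \<eta> + norm ?F / 2" using mult_right_mono[OF \<open>\<eta> \<le> 1 / 2\<close>, of "norm ?F"] by (simp add: algebra_simps)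
      finally have "norm ?F \<le> 4 * M * \<eta>" by simp
      also have "\<dots> < 4 * M * (1 / (8 * B))" using \<eta> M by (intro mult_strict_left_mono) auto
      also have "\<dots> = ln T / 2" using B by (simp add: M_def)
      also have "\<dots> \<le> ln (c * T)" using T c Tpos by (simp add: ln_mult)
      also have "\<dots> \<le> ln (norm (g (Complex a T)))"
        using lower[of T] T c Tpos nz[of "Complex a T"] d by (subst ln_le_cancel_iff) auto
      also have "\<dots> = Re ?F" using ReF[of "Complex a T"] d by simp
      also have "\<dots> \<le> norm ?F" by (rule complex_Re_le_cmod)
      finally show False by simp
    qed
  qed
qed

section \<open>Growth of a function in the class\<close>

lemma selberg_continuation_holomorphic:
  assumes "selberg_continuation L"
  shows "L holomorphic_on - {1}"
proof -
  from assms obtain k G where G: "G holomorphic_on UNIV" "\<And>s. s \<noteq> 1 \<Longrightarrow> G s = (s - 1) ^ k * L s"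
    unfolding selberg_continuation_def entire_of_finite_order_def by blast
  have "(\<lambda>s. G s / (s - 1) ^ k) holomorphic_on - {1}"
    by (intro holomorphic_intros holomorphic_on_subset[OF G(1)]) auto
  thus ?thesis by (rule holomorphic_transform) (use G(2) in auto)
qed

lemma selberg_continuation_growth:
  assumes "selberg_continuation L"
  obtains C :: real and n :: nat where "C > 0" "\<And>s. norm (s - 1) \<ge> 1 \<Longrightarrow> norm (L s) \<le> C * exp (norm s ^ n)"
proof -
  from assms obtain k G where G: "entire_of_finite_order G" "\<And>s. s \<noteq> 1 \<Longrightarrow> G s = (s - 1) ^ k * L s"
    unfolding selberg_continuation_def by blast
  from entire_of_finite_order_bound[OF G(1)] obtain C :: real and n :: nat where
    Cn: "C > 0" "\<And>z. norm (G z) \<le> C * exp (norm z ^ n)" by blast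
  show thesis
  proof (rule that[of C n])
    fix s :: complex assume s: "norm (s - 1) \<ge> 1"
    have "1 * norm (L s) \<le> norm (s - 1) ^ k * norm (L s)"
      using s by (intro mult_right_mono one_le_power) auto
    also have "\<dots> = norm (G s)" using s by (subst G(2)) (auto simp: norm_mult norm_power)
    also have "\<dots> \<le> C * exp (norm s ^ n)" by (rule Cn)
    finally show "norm (L s) \<le> C * exp (norm s ^ n)" by simp
  qed (use Cn in auto)
qed

text \<open>The relation \<open>has_prod\<close> admits the value 0 only if some factor is 0, and
  here every factor is an exponential or 1.\<close>

lemma selberg_euler_product_nonzero:
  assumes "selberg_euler_product L" "Re s > 1"
  shows "L s \<noteq> 0"
proof -
  from assms(1) obtain b :: "nat \<Rightarrow> complex" where "\<forall>s. Re s > 1 \<longrightarrow>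
           (\<lambda>p. if prime p
                 then exp (\<Sum>k. b (p ^ Suc k) * of_nat p powr (- of_nat (Suc k) * s))
                 else 1) has_prod L s"
    unfolding selberg_euler_product_def by blast
  with assms(2) have "(\<lambda>p. if prime p
                 then exp (\<Sum>k. b (p ^ Suc k) * of_nat p powr (- of_nat (Suc k) * s))
                 else 1) has_prod L s" by blast
  thus ?thesis by (subst has_prod_eq_0_iff) (auto split: if_splits)
qed

text \<open>For L itself this yields a positive lower bound on vertical lines far to the right; for
  \<open>L - \<alpha>\<close> it yields the normalisation by the leading term. The leading index can
  exceed 1, for instance when \<alpha> is the first coefficient of L. Working with a third of
  \<open>norm (c m)\<close> leaves room for the strict inequality with \<open>1/2\<close>.\<close>

lemma dirichlet_lower_bound:
  fixes c :: "nat \<Rightarrow> complex"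
  assumes sm: "summable (\<lambda>n. norm (c (Suc n)) * real (Suc n) powr (-\<sigma>1))"
    and sums: "\<And>s. Re s > r \<Longrightarrow> (\<lambda>n. c (Suc n) * of_nat (Suc n) powr (-s)) sums D s"
    and nz: "n > 0" "c n \<noteq> 0"
  obtains m b where "m > 0" "c m \<noteq> 0" 
    "\<And>s. Re s \<ge> b \<Longrightarrow> norm (D s * of_nat m powr s / c m - 1) < 1/2"
    "\<And>s. Re s \<ge> b \<Longrightarrow> norm (D s) \<ge> norm (c m) / 2 * real m powr (- Re s)"
proof -
  define m where "m = (LEAST n. n > 0 \<and> c n \<noteq> 0)"
  have m: "m > 0" "c m \<noteq> 0" using LeastI[of "\<lambda>n. n > 0 \<and> c n \<noteq> 0" n] nz by (auto simp: m_def)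
  have least: "c n = 0" if "0 < n" "n < m" for n
    using not_less_Least[of n "\<lambda>n. n > 0 \<and> c n \<noteq> 0"] that by (auto simp: m_def)
  obtain b where b: "\<And>s D. Re s \<ge> b \<Longrightarrow> (\<lambda>n. c (Suc n) * of_nat (Suc n) powr (-s)) sums D \<Longrightarrow>
      norm (D * of_nat m powr s - c m) \<le> norm (c m) / 3"
    by (rule dirichlet_leading_term[OF sm m(1) least, of "norm (c m) / 3"]) (use m in auto)
  have bd: "norm (D s * of_nat m powr s - c m) \<le> norm (c m) / 3" if "Re s \<ge> max b (r + 1)" for s
    using b[OF _ sums] that by auto
  show thesis
  proof (rule that[of m "max b (r + 1)"])
    fix s assume s: "Re s \<ge> max b (r + 1)"
    have "norm (D s * of_nat m powr s / c m - 1) = norm (D s * of_nat m powr s - c m) / norm (c m)"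
      using m by (simp add: field_simps flip: norm_divide)
    also have "\<dots> \<le> (norm (c m) / 3) / norm (c m)" using bd[OF s] by (intro divide_right_mono) auto
    also have "\<dots> < 1/2" using m by simp
    finally show "norm (D s * of_nat m powr s / c m - 1) < 1/2" .
    have "norm (c m) / 2 \<le> norm (D s * of_nat m powr s)"
      using bd[OF s] norm_triangle_ineq2[of "c m" "D s * of_nat m powr s"]
      unfolding norm_minus_commute[of "c m"] using norm_ge_zero[of "c m"] by linarith
    hence "norm (c m) / 2 * real m powr (- Re s) \<le> norm (D s * of_nat m powr s) * real m powr (- Re s)"
      by (intro mult_right_mono) auto
    also have "\<dots> = norm (D s)"
      using m by (simp add: norm_mult norm_of_nat_powr mult.assoc flip: powr_add)
    finally show "norm (D s) \<ge> norm (c m) / 2 * real m powr (- Re s)" .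
  qed (use m in auto)
qed

text \<open>The reflection that sends s to \<open>1 - cnj s\<close> preserves the imaginary part.
  The hypothesis \<open>nz\<close> keeps all Gamma arguments off the real axis, so that their Gamma
  values are genuine and nonzero.\<close>

lemma functional_equation_norm:
  fixes lam :: "nat \<Rightarrow> real" and mu :: "nat \<Rightarrow> complex"
  assumes FE: "\<And>s. s \<notin> {0, 1} \<Longrightarrow>
             (\<And>j. j \<in> {1..J} \<Longrightarrow> of_real (lam j) * s + mu j \<notin> \<int>\<^sub>\<le>\<^sub>0 \<and>
                         of_real (lam j) * (1 - cnj s) + mu j \<notin> \<int>\<^sub>\<le>\<^sub>0) \<Longrightarrow>
             completed_fun L Q J lam mu s = \<omega> * cnj (completed_fun L Q J lam mu (1 - cnj s))"
    and Q: "Q > 0" and \<omega>: "norm \<omega> = 1" and t: "t \<noteq> 0"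
    and nz: "\<And>j. j \<in> {1..J} \<Longrightarrow> lam j * t + Im (mu j) \<noteq> 0"
  shows "norm (L (Complex (1 - b) t)) = norm (L (Complex b t)) * Q powr (2 * b - 1) *
    (\<Prod>j=1..J. norm (Gamma (lam j * Complex b t + mu j)) / norm (Gamma (lam j * Complex (1 - b) t + mu j)))"
proof -
  define s where "s = Complex (1 - b) t"
  have s': "1 - cnj s = Complex b t" by (simp add: s_def complex_eq_iff)
  have nonpole: "lam j * Complex x t + mu j \<notin> \<int>\<^sub>\<le>\<^sub>0" if "j \<in> {1..J}" for j x
  proof -
    have "lam j * Complex x t + mu j = Complex (lam j * x + Re (mu j)) (lam j * t + Im (mu j))"
      by (simp add: complex_eq_iff)
    thus ?thesis using Complex_not_nonpos_Ints[OF nz[OF that]] by simp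
  qed
  define P where "P = (\<lambda>x. \<Prod>j=1..J. norm (Gamma (lam j * Complex x t + mu j)))"
  have P: "P x > 0" for x
    unfolding P_def using nonpole by (intro prod_pos) (auto simp: Gamma_eq_zero_iff)
  have norm_cf: "norm (completed_fun L Q J lam mu (Complex x t)) = norm (L (Complex x t)) * Q powr x * P x" for x
    using Q by (simp add: completed_fun_def norm_mult norm_powr_real_powr P_def prod_norm)
  have "completed_fun L Q J lam mu s = \<omega> * cnj (completed_fun L Q J lam mu (1 - cnj s))"
  proof (rule FE)
    show "s \<notin> {0, 1}" using t by (auto simp: s_def complex_eq_iff)
  qed (unfold s', use nonpole in \<open>auto simp: s_def\<close>)
  hence "norm (completed_fun L Q J lam mu s) = norm (completed_fun L Q J lam mu (1 - cnj s))"
    using \<omega> by (simp add: norm_mult)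
  hence "norm (L (Complex (1 - b) t)) * Q powr (1 - b) * P (1 - b) = norm (L (Complex b t)) * Q powr b * P b"
    unfolding s' by (simp add: s_def norm_cf)
  hence "norm (L (Complex (1 - b) t)) = norm (L (Complex b t)) * (Q powr b / Q powr (1 - b)) * (P b / P (1 - b))"
    using P[of "1 - b"] Q by (simp add: field_simps)
  also have "Q powr b / Q powr (1 - b) = Q powr (2 * b - 1)" by (simp flip: powr_diff)
  also have "P b / P (1 - b) = (\<Prod>j=1..J. norm (Gamma (lam j * Complex b t + mu j)) / norm (Gamma (lam j * Complex (1 - b) t + mu j)))"
    by (simp add: P_def prod_dividef)
  finally show ?thesis .
qed

text \<open>On the line \<open>Re s = b\<close> the function lies between two positive constants, so
  its size on the reflected line is that of the product of Gamma quotients. Each of the J quotients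
  grows at least linearly, and there is at least one.\<close>

lemma left_growth:
  fixes lam :: "nat \<Rightarrow> real" and mu :: "nat \<Rightarrow> complex"
  assumes FE: "\<And>s. s \<notin> {0, 1} \<Longrightarrow>
             (\<And>j. j \<in> {1..J} \<Longrightarrow> of_real (lam j) * s + mu j \<notin> \<int>\<^sub>\<le>\<^sub>0 \<and>
                         of_real (lam j) * (1 - cnj s) + mu j \<notin> \<int>\<^sub>\<le>\<^sub>0) \<Longrightarrow>
             completed_fun L Q J lam mu s = \<omega> * cnj (completed_fun L Q J lam mu (1 - cnj s))"
    and Q: "Q > 0" and \<omega>: "norm \<omega> = 1" and J: "J \<ge> 1" and lam: "\<And>j. j \<in> {1..J} \<Longrightarrow> lam j > 0"
    and b: "\<And>j. j \<in> {1..J} \<Longrightarrow> lam j * (2 * b - 1) \<ge> 1"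
    and lb: "\<kappa> > 0" "\<And>t. norm (L (Complex b t)) \<ge> \<kappa>" and ub: "\<And>t. norm (L (Complex b t)) \<le> U"
  shows "\<exists>c C. \<exists>K::nat. c > 0 \<and> C > 0 \<and> eventually (\<lambda>t. c * t \<le> norm (L (Complex (1 - b) t))) at_top \<and>
           eventually (\<lambda>t. norm (L (Complex (1 - b) t)) \<le> C * t ^ K) at_top"
proof -
  define r where "r = (\<lambda>j t. norm (Gamma (lam j * Complex b t + mu j)) / norm (Gamma (lam j * Complex (1 - b) t + mu j)))"
  have "\<exists>c C. \<exists>K::nat. c > 0 \<and> C > 0 \<and> eventually (\<lambda>t. c * t ^ card {1..J} \<le> (\<Prod>j\<in>{1..J}. r j t)) at_top \<and> 
          eventually (\<lambda>t. (\<Prod>j\<in>{1..J}. r j t) \<le> C * t ^ K) at_top"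
  proof (rule eventually_prod_power_bounds)
    fix j assume j: "j \<in> {1..J}"
    show "\<exists>c C. \<exists>K::nat. c > 0 \<and> C > 0 \<and> eventually (\<lambda>t. c * t \<le> r j t) at_top \<and> eventually (\<lambda>t. r j t \<le> C * t ^ K) at_top"
      unfolding r_def by (rule Gamma_factor_ratio_bounds[OF lam[OF j] b[OF j], of "mu j"]) blast
  qed auto
  then obtain c C and K :: nat where r: "c > 0" "C > 0" "eventually (\<lambda>t. c * t ^ J \<le> (\<Prod>j\<in>{1..J}. r j t)) at_top"
          "eventually (\<lambda>t. (\<Prod>j\<in>{1..J}. r j t) \<le> C * t ^ K) at_top" by auto
  have "eventually (\<lambda>t. \<forall>j\<in>{1..J}. lam j * t + Im (mu j) \<noteq> 0) at_top"
  proof (intro eventually_ball_finite ballI)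
    fix j assume "j \<in> {1..J}"
    hence "lam j > 0" by (rule lam)
    hence "eventually (\<lambda>t. lam j * t + Im (mu j) > 0) at_top" by real_asymp
    thus "eventually (\<lambda>t. lam j * t + Im (mu j) \<noteq> 0) at_top" by eventually_elim auto
  qed auto
  hence eq: "eventually (\<lambda>t. norm (L (Complex (1 - b) t)) = norm (L (Complex b t)) * Q powr (2 * b - 1) * (\<Prod>j\<in>{1..J}. r j t)) at_top"
    using eventually_gt_at_top[of 0]
  proof eventually_elim
    case (elim t)
    show ?case unfolding r_def by (rule functional_equation_norm[OF FE Q \<omega>]) (use elim in auto)
  qed
  define q where "q = Q powr (2 * b - 1)"
  have q: "q > 0" using Q by (simp add: q_def)
  have U: "U > 0" using lb ub[of 0] lb(2)[of 0] by linarith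
  have 1: "eventually (\<lambda>t. \<kappa> * q * c * t \<le> norm (L (Complex (1 - b) t))) at_top"
    using eq r(3) eventually_ge_at_top[of 1]
  proof eventually_elim
    case (elim t)
    have "t ^ 1 \<le> t ^ J" using elim J by (intro power_increasing) auto
    hence "c * t \<le> (\<Prod>j\<in>{1..J}. r j t)" using elim r(1) by (smt (verit) mult_left_mono power_one_right)
    hence "(\<kappa> * q) * (c * t) \<le> (norm (L (Complex b t)) * q) * (\<Prod>j\<in>{1..J}. r j t)"
      using lb q r elim by (intro mult_mono mult_right_mono) auto
    thus ?case using elim by (simp add: q_def mult.assoc)
  qed
  have 2: "eventually (\<lambda>t. norm (L (Complex (1 - b) t)) \<le> (U * q * C) * t ^ K) at_top"
    using eq r(3,4) eventually_ge_at_top[of 1]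
  proof eventually_elim
    case (elim t)
    have "0 \<le> c * t ^ J" using elim r by simp
    hence "0 \<le> (\<Prod>j\<in>{1..J}. r j t)" using elim by linarith
    hence "(norm (L (Complex b t)) * q) * (\<Prod>j\<in>{1..J}. r j t) \<le> (U * q) * (C * t ^ K)"
      using ub q elim U by (intro mult_mono mult_right_mono) auto
    thus ?case using elim by (simp add: q_def mult.assoc)
  qed
  show ?thesis using 1 2 lb q r U
    by (intro exI[of _ "\<kappa> * q * c"] exI[of _ "U * q * C"] exI[of _ K]) auto
qed

text \<open>The Phragmen--Lindelof principle is applied to \<open>L s / s ^ K\<close> on a
  half-strip. Above height \<open>Y \<ge> 1\<close> neither the possible pole at 1 nor the zero of
  the denominator is met, and \<open>norm s\<close> is comparable with \<open>Im s\<close>. The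
  bottom edge is compact and contributes a constant.\<close>

lemma strip_polynomial_bound:
  fixes L :: "complex \<Rightarrow> complex" and a b C :: real
  assumes cont: "selberg_continuation L"
    and left: "\<And>t. t \<ge> Y \<Longrightarrow> norm (L (Complex a t)) \<le> C * t ^ K"
    and right: "\<And>t. t \<ge> Y \<Longrightarrow> norm (L (Complex b t)) \<le> C"
    and Y: "Y \<ge> 1" and C: "C > 0" and ab: "a < b"
  obtains M where "M > 0" "\<And>s. a \<le> Re s \<Longrightarrow> Re s \<le> b \<Longrightarrow> Im s \<ge> Y \<Longrightarrow> norm (L s) \<le> M * Im s ^ K"
proof -
  define S where "S = {s. a \<le> Re s} \<inter> {s. Re s \<le> b} \<inter> {s. Y \<le> Im s}"
  have closed: "closed S" unfolding S_def
    by (intro closed_Int closed_halfspace_Re_ge closed_halfspace_Re_le closed_halfspace_Im_ge)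
  have op: "{s. a < Re s} \<inter> {s. Re s < b} \<inter> {s. Y < Im s} \<subseteq> interior S"
    by (rule interior_maximal)
      (auto simp: S_def intro!: open_Int open_halfspace_Re_gt open_halfspace_Re_lt open_halfspace_Im_gt)
  have S1: "norm s \<ge> 1" "norm (s - 1) \<ge> 1" "s \<noteq> 1" if "s \<in> S" for s
    using that Y abs_Im_le_cmod[of s] abs_Im_le_cmod[of "s - 1"] by (auto simp: S_def)
  have powS: "norm s ^ K \<ge> 1" if "s \<in> S" for s using S1(1)[OF that] by (rule one_le_power)
  have holL: "L holomorphic_on - {1}" by (rule selberg_continuation_holomorphic[OF cont])
  obtain B :: real and n :: nat where B: "B > 0" "\<And>s. norm (s - 1) \<ge> 1 \<Longrightarrow> norm (L s) \<le> B * exp (norm s ^ n)"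
    using selberg_continuation_growth[OF cont] by blast
  define F where "F = (\<lambda>s. L s / s ^ K)"
  define k where "k = \<bar>a\<bar> + \<bar>b\<bar> + 1"
  have normS: "norm s \<le> k * Im s" if "s \<in> S" for s
  proof -
    have "\<bar>Re s\<bar> \<le> \<bar>a\<bar> + \<bar>b\<bar>" using that by (auto simp: S_def)
    also have "\<dots> \<le> (\<bar>a\<bar> + \<bar>b\<bar>) * Im s"
      using mult_left_mono[of 1 "Im s" "\<bar>a\<bar> + \<bar>b\<bar>"] that Y by (simp add: S_def)
    finally show ?thesis using cmod_le[of s] that Y by (simp add: k_def S_def algebra_simps)
  qed
  have "compact ((\<lambda>x. L (Complex x Y)) ` {a..b})"
  proof (intro compact_continuous_image)
    have "continuous_on (- {1}) L" by (rule holomorphic_on_imp_continuous_on[OF holL])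
    moreover have "continuous_on {a..b} (\<lambda>x. Complex x Y)" by (simp add: Complex_eq continuous_intros)
    ultimately show "continuous_on {a..b} (\<lambda>x. L (Complex x Y))"
      by (rule continuous_on_compose2) (use Y in \<open>auto simp: complex_eq_iff\<close>)
  qed auto
  then obtain D where D: "\<And>x. x \<in> {a..b} \<Longrightarrow> norm (L (Complex x Y)) \<le> D"
    by (metis (no_types, lifting) bounded_iff compact_imp_bounded imageI)
  define M where "M = max C D"
  have M: "M > 0" using C by (simp add: M_def)
  have F_bound: "norm (F s) \<le> M" if s: "s \<in> S" for s
  proof (rule phragmen_lindelof_strip[of S a b F M B n])
    show "a \<le> Re z \<and> Re z \<le> b" if "z \<in> S" for z using that by (auto simp: S_def)
    show "F holomorphic_on interior S"
      unfolding F_def using S1 interior_subset[of S]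
      by (intro holomorphic_intros holomorphic_on_subset[OF holL]) fastforce+
    show "continuous_on (closure S) F"
      unfolding F_def closure_closed[OF closed] using S1
      by (intro continuous_intros continuous_on_subset[OF holomorphic_on_imp_continuous_on[OF holL]]) fastforce+
    show "norm (F z) \<le> B * exp (norm z ^ n)" if "z \<in> closure S" for z
    proof -
      have z: "z \<in> S" using that closed by simp
      have "norm (F z) \<le> norm (L z) / 1" unfolding F_def norm_divide
        using powS[OF z] unfolding norm_power by (intro divide_left_mono) auto
      thus ?thesis using B(2)[of z] S1[OF z] by simp
    qed
    show "norm (F z) \<le> M" if "z \<in> frontier S" for z
    proof -
      have z: "z \<in> S" and "z \<notin> interior S" using that closed by (auto simp: frontier_def)
      hence "\<not> (a < Re z \<and> Re z < b \<and> Y < Im z)" using op by auto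
      hence "Re z = a \<or> Re z = b \<or> Im z = Y" using z by (auto simp: S_def)
      moreover have zpow: "Im z ^ K \<le> norm z ^ K" using z Y abs_Im_le_cmod[of z] by (intro power_mono) (auto simp: S_def)
      moreover have one: "1 \<le> Im z ^ K" "Im z \<ge> Y" using z Y by (auto simp: S_def)
      moreover have zeq: "z = Complex (Re z) (Im z)" by simp
      ultimately have "norm (L z) \<le> M * Im z ^ K"
      proof (elim disjE)
        assume "Re z = a"
        hence "norm (L z) \<le> C * Im z ^ K" using left[of "Im z"] one zeq by metis
        also have "\<dots> \<le> M * Im z ^ K" using one by (intro mult_right_mono) (auto simp: M_def)
        finally show ?thesis .
      next
        assume "Re z = b"
        hence "norm (L z) \<le> C * 1" using right[of "Im z"] one zeq by (metis mult.right_neutral)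
        also have "\<dots> \<le> M * Im z ^ K" using one C by (intro mult_mono) (auto simp: M_def)
        finally show ?thesis .
      next
        assume "Im z = Y"
        hence "norm (L z) \<le> D * 1" using D[of "Re z"] z zeq by (metis (no_types, lifting) mult.right_neutral IntD1 IntD2 S_def atLeastAtMost_iff mem_Collect_eq)
        also have "\<dots> \<le> M * Im z ^ K" using one C order.trans[OF norm_ge_zero D[of a]] ab by (intro mult_mono) (auto simp: M_def)
        finally show ?thesis .
      qed
      also have "\<dots> \<le> M * norm z ^ K" using zpow M by (intro mult_left_mono) auto
      finally show ?thesis using powS[OF z] unfolding F_def norm_divide norm_power by (subst pos_divide_le_eq) auto
    qed
  qed (use s M B in auto)
  show thesis
  proof (rule that[of "M * k ^ K"])
    have "k > 0" by (simp add: k_def)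
    thus "M * k ^ K > 0" using M by simp
    fix s assume "a \<le> Re s" "Re s \<le> b" "Im s \<ge> Y"
    hence s: "s \<in> S" by (auto simp: S_def)
    have "norm (L s) = norm (F s) * norm s ^ K"
      using S1[OF s] by (auto simp: F_def norm_divide norm_power)
    also have "\<dots> \<le> M * (k * Im s) ^ K"
      using F_bound[OF s] normS[OF s] M by (intro mult_mono power_mono) auto
    finally show "norm (L s) \<le> M * k ^ K * Im s ^ K" by (simp add: power_mult_distrib mult.assoc)
  qed
qed

section \<open>The alpha-points in the presence of Gamma factors\<close>

lemma selberg_dirichlet_series:
  assumes "L \<in> selberg_class"
  obtains f :: "nat \<Rightarrow> complex" and C :: real where "C > 0" "\<And>n. n > 0 \<Longrightarrow> norm (f n) \<le> C * real n powr 1"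
    "\<And>s. Re s > 1 \<Longrightarrow> (\<lambda>n. f (Suc n) * of_nat (Suc n) powr (-s)) sums L s"
proof -
  from assms obtain f where f: "dirichlet_expansion f L" "ramanujan_bound f"
    unfolding selberg_class_def by blast
  from ramanujan_bound_linear[OF f(2)] obtain C where "C > 0" "\<And>n. n > 0 \<Longrightarrow> norm (f n) \<le> C * real n powr 1" by blast
  with f(1) that show thesis unfolding dirichlet_expansion_def by blast
qed

lemma minus_const_sums:
  fixes f :: "nat \<Rightarrow> complex" and \<alpha> :: complex
  assumes "(\<lambda>n. f (Suc n) * of_nat (Suc n) powr (-s)) sums D"
  shows "(\<lambda>n. (f (Suc n) - (if Suc n = 1 then \<alpha> else 0)) * of_nat (Suc n) powr (-s)) sums (D - \<alpha>)"
proof -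
  have "(\<lambda>n. if n = 0 then \<alpha> else 0) sums \<alpha>" by (rule sums_single)
  hence "(\<lambda>n. f (Suc n) * of_nat (Suc n) powr (-s) - (if n = 0 then \<alpha> else 0)) sums (D - \<alpha>)"
    by (rule sums_diff[OF assms])
  also have "(\<lambda>n. f (Suc n) * of_nat (Suc n) powr (-s) - (if n = 0 then \<alpha> else 0)) =
      (\<lambda>n. (f (Suc n) - (if Suc n = 1 then \<alpha> else 0)) * of_nat (Suc n) powr (-s))"
    by (auto simp: fun_eq_iff)
  finally show ?thesis .
qed

lemma zero_coeffs_sums:
  fixes c :: "nat \<Rightarrow> complex"
  assumes "\<And>n. n > 0 \<Longrightarrow> c n = 0" "(\<lambda>n. c (Suc n) * of_nat (Suc n) powr (-s)) sums D"
  shows "D = 0"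
proof -
  have "(\<lambda>n. 0) sums D" using assms(2) by (simp add: assms(1))
  thus ?thesis using sums_unique2[OF sums_zero] by metis
qed

lemma alpha_points_gamma_factors:
  fixes L :: "complex \<Rightarrow> complex" and \<alpha> :: complex and lam :: "nat \<Rightarrow> real" and mu :: "nat \<Rightarrow> complex"
  assumes L: "L \<in> selberg_class"
    and FE: "\<And>s. s \<notin> {0, 1} \<Longrightarrow>
             (\<And>j. j \<in> {1..J} \<Longrightarrow> of_real (lam j) * s + mu j \<notin> \<int>\<^sub>\<le>\<^sub>0 \<and>
                         of_real (lam j) * (1 - cnj s) + mu j \<notin> \<int>\<^sub>\<le>\<^sub>0) \<Longrightarrow>
             completed_fun L Q J lam mu s = \<omega> * cnj (completed_fun L Q J lam mu (1 - cnj s))"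
    and Q: "Q > 0" and \<omega>: "norm \<omega> = 1" and J: "J \<ge> 1" and lam: "\<And>j. j \<in> {1..J} \<Longrightarrow> lam j > 0"
  obtains A T0 where "A > 0" "T0 > exp 3"
    "\<And>T. T \<ge> T0 \<Longrightarrow> \<exists>s. L s = \<alpha> \<and> s \<noteq> 1 \<and> \<bar>Im s - T\<bar> < A / ln (ln (ln T))"
proof -
  have cont: "selberg_continuation L" and euler: "selberg_euler_product L"
    using L by (auto simp: selberg_class_def)
  have holL: "L holomorphic_on - {1}" by (rule selberg_continuation_holomorphic[OF cont])
  obtain f C where C: "C > 0" and f: "\<And>n. n > 0 \<Longrightarrow> norm (f n) \<le> C * real n powr 1"
    and sums: "\<And>s. Re s > 1 \<Longrightarrow> (\<lambda>n. f (Suc n) * of_nat (Suc n) powr (-s)) sums L s"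
    by (rule selberg_dirichlet_series[OF L]) (rule that)
  have sm: "summable (\<lambda>n. norm (f (Suc n)) * real (Suc n) powr (-3))"
    using polynomial_coeffs_summable[OF f] by simp
  define U where "U = (\<Sum>n. norm (f (Suc n)) * real (Suc n) powr (-3))"
  have U: "norm (L s) \<le> U" if "Re s \<ge> 3" for s
    unfolding U_def using dirichlet_sums_norm_le(2)[OF sm that sums] that by auto
  have "\<exists>n>0. f n \<noteq> 0"
  proof (rule ccontr)
    assume "\<not> ?thesis"
    hence "f n = 0" if "n > 0" for n using that by blast
    hence "L 2 = 0" using zero_coeffs_sums[OF _ sums[of 2]] by simp
    thus False using selberg_euler_product_nonzero[OF euler, of 2] by simp
  qed
  then obtain n where n: "n > 0" "f n \<noteq> 0" by blast
  obtain m b1 where m: "m > 0" "f m \<noteq> 0"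
    "\<And>s. Re s \<ge> b1 \<Longrightarrow> norm (L s) \<ge> norm (f m) / 2 * real m powr (- Re s)"
    by (rule dirichlet_lower_bound[where r = 1, OF sm sums n]; (rule that)?; assumption)
  obtain b2 where b2: "\<And>b. b \<ge> b2 \<Longrightarrow> \<forall>j\<in>{1..J}. lam j * (2 * b - 1) \<ge> 1"
  proof -
    have "eventually (\<lambda>b. \<forall>j\<in>{1..J}. lam j * (2 * b - 1) \<ge> 1) at_top"
    proof (intro eventually_ball_finite ballI)
      fix j assume "j \<in> {1..J}"
      hence "lam j > 0" by (rule lam)
      thus "eventually (\<lambda>b. lam j * (2 * b - 1) \<ge> 1) at_top" by real_asymp
    qed auto
    thus thesis using that by (auto simp: eventually_at_top_linorder)
  qed
  have growth: "\<exists>c C. \<exists>K::nat. c > 0 \<and> C > 0 \<and> eventually (\<lambda>t. c * t \<le> norm (L (Complex (1 - b) t))) at_top \<and>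
           eventually (\<lambda>t. norm (L (Complex (1 - b) t)) \<le> C * t ^ K) at_top"
    if "b \<ge> b1" "b \<ge> b2" "b \<ge> 3" for b
  proof (rule left_growth[OF FE Q \<omega> J lam, where b = b and U = U and \<kappa> = "norm (f m) / 2 * real m powr (- b)"])
    show "norm (f m) / 2 * real m powr (- b) > 0" using m by simp
    show "norm (L (Complex b t)) \<ge> norm (f m) / 2 * real m powr (- b)" for t
      using m(3)[of "Complex b t"] that by simp
    show "norm (L (Complex b t)) \<le> U" for t using U[of "Complex b t"] that by simp
  qed (use b2 that in auto)

  \<comment> \<open>Growth is used at two abscissae: \<open>b0\<close> gives the lower bound on
    \<open>Re s = 1 - b0\<close>, and \<open>b0 + 1\<close> gives the upper bound on
    \<open>Re s = - b0\<close>, which becomes the left edge of the rectangle.\<close>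
  define b0 where "b0 = Max {b1, b2, 3}"
  have b0: "b0 \<ge> b1" "b0 \<ge> b2" "b0 \<ge> 3" by (auto simp: b0_def)
  obtain c0 where c0: "c0 > 0" "eventually (\<lambda>t. c0 * t \<le> norm (L (Complex (1 - b0) t))) at_top"
    using growth[of b0] b0 by blast
  obtain C1 and K :: nat where C1: "C1 > 0" "eventually (\<lambda>t. norm (L (Complex (- b0) t)) \<le> C1 * t ^ K) at_top"
    using growth[of "b0 + 1"] b0 by auto

  define c where "c = (\<lambda>n. f n - (if n = 1 then \<alpha> else 0))"
  have c_bound: "norm (c n) \<le> (C + norm \<alpha>) * real n powr 1" if "n > 0" for n
  proof -
    have "norm (c n) \<le> norm (f n) + norm \<alpha> * 1"
      unfolding c_def by (rule order.trans[OF norm_triangle_ineq4]) auto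
    also have "\<dots> \<le> C * real n powr 1 + norm \<alpha> * real n powr 1"
      using f[OF that] that by (intro add_mono mult_left_mono) auto
    finally show ?thesis by (simp add: algebra_simps)
  qed
  have smc: "summable (\<lambda>n. norm (c (Suc n)) * real (Suc n) powr (-3))"
    using polynomial_coeffs_summable[OF c_bound] by simp
  have sumsc: "(\<lambda>n. c (Suc n) * of_nat (Suc n) powr (-s)) sums (L s - \<alpha>)" if "Re s > 1" for s
    unfolding c_def by (rule minus_const_sums[OF sums[OF that]])
  \<comment> \<open>If all coefficients of \<open>L - \<alpha>\<close> were 0, then L would be
    constant on the punctured plane, contrary to its linear growth on the line
    \<open>Re s = 1 - b0\<close>.\<close>
  have "\<exists>n>0. c n \<noteq> 0"
  proof (rule ccontr)
    assume "\<not> ?thesis"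
    hence "c n = 0" if "n > 0" for n using that by blast
    hence eq: "L s = \<alpha>" if "Re s > 1" for s
      using zero_coeffs_sums[OF _ sumsc[OF that]] by simp
    have all_eq: "L s = \<alpha>" if "s \<in> - {1}" for s
    proof (rule analytic_continuation_open[where s = "{s. Re s > 1}" and s' = "- {1}" and f = L and g = "\<lambda>_. \<alpha>"])
      show "{s::complex. Re s > 1} \<noteq> {}" by (auto intro: exI[of _ 2])
      show "connected (- {1::complex})" by (intro connected_punctured_universe) auto
    qed (use eq that holL in \<open>auto simp: open_halfspace_Re_gt\<close>)
    have "eventually (\<lambda>t. c0 * t \<le> norm \<alpha>) at_top"
      using c0(2) eventually_gt_at_top[of 0] by eventually_elim (subst (asm) all_eq; auto simp: complex_eq_iff)
    moreover have "eventually (\<lambda>t. c0 * t > norm \<alpha>) at_top" using c0(1) by real_asymp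
    ultimately have "eventually (\<lambda>t::real. False) at_top" by eventually_elim auto
    thus False by simp
  qed
  then obtain n' where n': "n' > 0" "c n' \<noteq> 0" by blast
  obtain N b3 where N: "N > 0" "c N \<noteq> 0" "\<And>s. Re s \<ge> b3 \<Longrightarrow> norm ((L s - \<alpha>) * of_nat N powr s / c N - 1) < 1/2"
    by (rule dirichlet_lower_bound[where r = 1, OF smc sumsc n']; (rule that)?; assumption)

  define a where "a = 1 - b0"
  define b where "b = max b3 3 + 1"
  have b3': "b \<ge> 3" unfolding b_def by linarith
  have ab: "a < b" using b0 by (simp add: a_def b_def)
  \<comment> \<open>The extra factor has no zeros, so g and \<open>L - \<alpha>\<close> vanish at
    the same points, and it makes g tend to 1 on the right.\<close>
  define g where "g = (\<lambda>s. (L s - \<alpha>) * of_nat N powr s / c N)"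
  have norm_g: "norm (g s) = norm (L s - \<alpha>) * (real N powr Re s / norm (c N))" for s
    using N by (simp add: g_def norm_mult norm_divide norm_of_nat_powr)
  define C2 where "C2 = max C1 U + 1"
  have C2: "C2 > 0" "C2 \<ge> C1" "C2 \<ge> U" using C1 by (auto simp: C2_def)
  define q where "q = real N powr a / norm (c N)"
  have q: "q > 0" using N by (simp add: q_def)
  have "eventually (\<lambda>t. c0 * t - norm \<alpha> \<ge> c0 / 2 * t) at_top" using c0(1) by real_asymp
  hence "eventually (\<lambda>t. c0 * t \<le> norm (L (Complex a t)) \<and> norm (L (Complex (a - 1) t)) \<le> C2 * t ^ K \<and>
           c0 * t - norm \<alpha> \<ge> c0 / 2 * t \<and> t \<ge> 1) at_top"
    using c0(2) C1(2) eventually_ge_at_top[of 1]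
  proof eventually_elim
    case (elim t)
    have "C1 * t ^ K \<le> C2 * t ^ K" using C2 elim by (intro mult_right_mono) auto
    hence "norm (L (Complex (- b0) t)) \<le> C2 * t ^ K" using elim by linarith
    thus ?case using elim by (auto simp: a_def)
  qed
  then obtain Y where Y: "\<And>t. t \<ge> Y \<Longrightarrow> c0 * t \<le> norm (L (Complex a t)) \<and> norm (L (Complex (a - 1) t)) \<le> C2 * t ^ K \<and>
           c0 * t - norm \<alpha> \<ge> c0 / 2 * t \<and> t \<ge> 1"
    by (auto simp: eventually_at_top_linorder)
  have Y1: "Y \<ge> 1" using Y[of Y] by simp
  obtain M where M: "M > 0" "\<And>s. a - 1 \<le> Re s \<Longrightarrow> Re s \<le> b \<Longrightarrow> Im s \<ge> Y \<Longrightarrow> norm (L s) \<le> M * Im s ^ K"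
  proof (rule strip_polynomial_bound[OF cont, of Y "a - 1" C2 K b])
    show "norm (L (Complex (a - 1) t)) \<le> C2 * t ^ K" if "t \<ge> Y" for t using Y[OF that] by simp
    show "norm (L (Complex b t)) \<le> C2" if "t \<ge> Y" for t
      using order.trans[OF U[of "Complex b t"] C2(3)] b3' by simp
  qed (use Y1 C2 ab in auto)
  define B where "B = (M + norm \<alpha>) * (real N powr b / norm (c N))"
  obtain A T0 where AT: "A > 0" "T0 > exp 3"
    "\<And>T. T \<ge> T0 \<Longrightarrow> \<exists>s. g s = 0 \<and> Im s > Y \<and> \<bar>Im s - T\<bar> < A / ln (ln (ln T))"
  proof (rule short_gaps[of g Y b a B K "c0 / 2 * q"])
    show "g holomorphic_on {s. Y < Im s}"
      unfolding g_def using N Y1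
      by (intro holomorphic_intros holomorphic_on_subset[OF holL]) auto
    show "norm (g s - 1) < 1/2" if "Im s > Y" "Re s > b - 1" for s
      unfolding g_def by (rule N(3)) (use that in \<open>simp add: b_def\<close>)
    show "norm (g s) \<le> B * Im s ^ K" if s: "Im s \<ge> Y" "a - 1 \<le> Re s" "Re s \<le> b" for s
    proof -
      have one: "1 \<le> Im s ^ K" using s Y1 by auto
      have "norm (L s - \<alpha>) \<le> M * Im s ^ K + norm \<alpha> * 1"
        using M(2)[OF s(2,3,1)] norm_triangle_ineq4[of "L s" \<alpha>] by linarith
      also have "\<dots> \<le> (M + norm \<alpha>) * Im s ^ K"
        using mult_left_mono[OF one, of "norm \<alpha>"] by (simp add: algebra_simps)
      finally have "norm (g s) \<le> ((M + norm \<alpha>) * Im s ^ K) * (real N powr b / norm (c N))"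
        unfolding norm_g using s N one M by (intro mult_mono divide_right_mono powr_mono mult_nonneg_nonneg) auto
      thus ?thesis by (simp add: B_def mult_ac)
    qed
    show "c0 / 2 * q * t \<le> norm (g (Complex a t))" if "t \<ge> Y" for t
    proof -
      have "c0 / 2 * t \<le> norm (L (Complex a t) - \<alpha>)"
        using Y[OF that] norm_triangle_ineq2[of "L (Complex a t)" \<alpha>] by linarith
      hence "c0 / 2 * t * q \<le> norm (L (Complex a t) - \<alpha>) * q" using q by (intro mult_right_mono) auto
      thus ?thesis by (simp add: norm_g q_def mult_ac)
    qed
    show "B > 0" using M N by (auto simp: B_def intro!: mult_pos_pos add_pos_nonneg divide_pos_pos)
  qed (use ab c0 q in auto)
  show thesis
  proof (rule that[OF AT(1,2)])
    fix T assume "T \<ge> T0"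
    then obtain s where s: "g s = 0" "Im s > Y" "\<bar>Im s - T\<bar> < A / ln (ln (ln T))" using AT(3) by blast
    have "L s = \<alpha>" using s(1) N by (auto simp: g_def)
    moreover have "s \<noteq> 1" using s(2) Y1 by auto
    ultimately show "\<exists>s. L s = \<alpha> \<and> s \<noteq> 1 \<and> \<bar>Im s - T\<bar> < A / ln (ln (ln T))" using s(3) by blast
  qed
qed

text \<open>For T between \<open>exp 3\<close> and \<open>T0\<close> one fixed \<alpha>-point
  serves, since its distance from T is bounded there; enlarging A covers this range. The triple
  logarithm is positive on the whole range because \<open>ln T \<ge> 3 > exp 1\<close>.\<close>

lemma alpha_point_gap_all:
  fixes L :: "complex \<Rightarrow> complex" and \<alpha> :: complex
  assumes L: "selberg_continuation L" and A: "A > 0" "T0 > exp 3"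
    and ex: "\<And>T. T \<ge> T0 \<Longrightarrow> \<exists>s. L s = \<alpha> \<and> s \<noteq> 1 \<and> \<bar>Im s - T\<bar> < A / ln (ln (ln T))"
  shows "\<exists>A::real. A > 0 \<and>
           (\<forall>T::real. T \<ge> exp 3 \<longrightarrow>
              (\<exists>\<beta> \<gamma>. alpha_point L \<alpha> (Complex \<beta> \<gamma>) \<and> \<bar>\<gamma> - T\<bar> < A / ln (ln (ln T))))"
proof -
  have ap: "alpha_point L \<alpha> (Complex (Re s) (Im s))" if "L s = \<alpha>" "s \<noteq> 1" for s
    unfolding alpha_point_def
  proof
    have "L analytic_on - {1}"
      using selberg_continuation_holomorphic[OF L] by (simp add: analytic_on_open open_Compl)
    hence "L analytic_on {s}" by (rule analytic_on_subset) (use that in auto)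
    thus "\<not> is_pole L (Complex (Re s) (Im s))" by (simp add: analytic_at_imp_no_pole)
  qed (use that in simp)
  have lnpos: "ln (ln (ln T)) > 0" if "T \<ge> exp 3" for T :: real
  proof -
    have "(3::real) > exp 1" using e_less_272 by simp
    have "T > 0" using that by (smt (verit) exp_gt_zero)
    have "ln T \<ge> 3" using that ln_ge_iff[OF \<open>T > 0\<close>] by simp
    hence "ln (ln T) > ln (exp 1)" using \<open>3 > exp 1\<close> by (subst ln_less_cancel_iff) auto
    thus ?thesis by simp
  qed
  have mono: "ln (ln (ln T)) \<le> ln (ln (ln T'))" if "T \<ge> exp 3" "T \<le> T'" for T T' :: real
  proof -
    have "T > 0" using that(1) by (smt (verit) exp_gt_zero)
    have 1: "ln T \<ge> 3" using that ln_ge_iff[OF \<open>T > 0\<close>] by simp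
    have 2: "ln T \<le> ln T'" using that \<open>T > 0\<close> by simp
    have "ln (ln T) \<le> ln (ln T')" using 1 2 by simp
    moreover have "ln (ln T) > 0" using 1 by simp
    ultimately show ?thesis by simp
  qed
  from ex[of T0] obtain s0 where s0: "L s0 = \<alpha>" "s0 \<noteq> 1" by auto
  define l where "l = ln (ln (ln T0))"
  have l: "l > 0" using lnpos[of T0] A by (simp add: l_def)
  define A' where "A' = max A ((\<bar>Im s0\<bar> + T0 + 1) * l)"
  show ?thesis
  proof (rule exI[of _ A'], intro conjI allI impI)
    show "A' > 0" using A by (simp add: A'_def)
    fix T :: real assume T: "T \<ge> exp 3"
    show "\<exists>\<beta> \<gamma>. alpha_point L \<alpha> (Complex \<beta> \<gamma>) \<and> \<bar>\<gamma> - T\<bar> < A' / ln (ln (ln T))"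
    proof (cases "T \<ge> T0")
      case True
      then obtain s where s: "L s = \<alpha>" "s \<noteq> 1" "\<bar>Im s - T\<bar> < A / ln (ln (ln T))" using ex by blast
      have "A / ln (ln (ln T)) \<le> A' / ln (ln (ln T))"
        using lnpos[OF T] by (intro divide_right_mono) (auto simp: A'_def)
      thus ?thesis using ap[OF s(1,2)] s(3) by (meson less_le_trans)
    next
      case False
      have "T > 0" using T by (smt (verit) exp_gt_zero)
      hence "\<bar>Im s0 - T\<bar> < \<bar>Im s0\<bar> + T0 + 1" using False by linarith
      also have "\<dots> = (\<bar>Im s0\<bar> + T0 + 1) * l / l" using l by simp
      also have "\<dots> \<le> A' / l" using l by (intro divide_right_mono) (auto simp: A'_def)
      also have "\<dots> \<le> A' / ln (ln (ln T))"
        using mono[OF T, of T0] lnpos[OF T] False A l by (intro divide_left_mono) (auto simp: A'_def l_def)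
      finally show ?thesis using ap[OF s0] by blast
    qed
  qed
qed

section \<open>The case without Gamma factors\<close>

text \<open>The functional equation expresses L near 1 through its values near 0, where L is
  continuous. Hence L has a finite limit at 1, and nice meromorphy makes L analytic there.\<close>

lemma no_gamma_factors_entire:
  assumes nicely: "L nicely_meromorphic_on UNIV" and cont: "selberg_continuation L"
    and FE: "\<And>s. s \<notin> {0, 1} \<Longrightarrow> L s * of_real Q powr s = \<omega> * cnj (L (1 - cnj s) * of_real Q powr (1 - cnj s))"
    and Q: "Q > 0"
  shows "L holomorphic_on UNIV"
proof -
  have holL: "L holomorphic_on - {1}" by (rule selberg_continuation_holomorphic[OF cont])
  hence "continuous_on (- {1}) L" by (rule holomorphic_on_imp_continuous_on)
  hence cont0: "isCont L 0" by (rule continuous_on_interior) (auto simp: interior_open open_Compl)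
  define R where "R = (\<lambda>s. \<omega> * cnj (L (1 - cnj s) * of_real Q powr (1 - cnj s)) / of_real Q powr s)"
  have "isCont (\<lambda>s. L (1 - cnj s)) 1"
    by (rule isCont_o2[where g = L]) (use cont0 in \<open>auto intro!: continuous_intros\<close>)
  hence "isCont R 1"
    unfolding R_def using Q by (intro continuous_intros) auto
  hence "R \<midarrow>1\<rightarrow> R 1" by (simp add: isCont_def)
  moreover have "eventually (\<lambda>s. L s = R s) (at 1)"
  proof -
    have "eventually (\<lambda>s::complex. s \<in> ball 1 1 - {1}) (at 1)"
      by (rule eventually_at_in_open) auto
    thus ?thesis
    proof eventually_elim
      case (elim s)
      hence "s \<notin> {0, 1}" by auto
      from FE[OF this] show ?case using Q by (simp add: R_def field_simps)
    qed
  qed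
  ultimately have lim: "L \<midarrow>1\<rightarrow> R 1" by (simp add: tendsto_cong)
  have "\<not> is_pole L 1"
    using not_tendsto_and_filterlim_at_infinity[OF _ lim] by (auto simp: is_pole_def)
  hence "L analytic_on {1}"
    by (intro nicely_meromorphic_on_imp_analytic_at[OF nicely]) auto
  moreover have "L analytic_on - {1}" using holL by (simp add: analytic_on_open open_Compl)
  ultimately have "L analytic_on ({1} \<union> - {1})" by (simp only: analytic_on_Un)
  thus ?thesis by (simp add: Un_commute analytic_imp_holomorphic)
qed

text \<open>By the functional equation, L is at most of order
  \<open>(1 / Q\<^sup>2) powr Re s\<close> far to the left, which leaves no room for terms of index
  above \<open>Q\<^sup>2\<close>. The function E is the tail beyond N, scaled by the first index
  \<open>Suc N\<close> of the tail. It is bounded on the right, tends to 0 on the left because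
  \<open>Suc N\<close> exceeds \<open>Q\<^sup>2\<close>, and is bounded in between since it has
  finite order. So it is constant, and the constant is 0.\<close>

lemma no_gamma_factors_dirichlet_polynomial:
  fixes L :: "complex \<Rightarrow> complex" and f :: "nat \<Rightarrow> complex" and Q :: real
  assumes entire: "L holomorphic_on UNIV" and cont: "selberg_continuation L"
    and sums: "\<And>s. Re s > 1 \<Longrightarrow> (\<lambda>n. f (Suc n) * of_nat (Suc n) powr (-s)) sums L s"
    and sm: "summable (\<lambda>n. norm (f (Suc n)) * real (Suc n) powr (-3))"
    and FE: "\<And>s. s \<notin> {0, 1} \<Longrightarrow> L s * of_real Q powr s = \<omega> * cnj (L (1 - cnj s) * of_real Q powr (1 - cnj s))"
    and Q: "Q > 0" and \<omega>: "norm \<omega> = 1"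
  obtains N where "\<And>s. L s = (\<Sum>n<N. f (Suc n) * of_nat (Suc n) powr (-s))"
proof -
  define N where "N = nat \<lfloor>Q\<^sup>2\<rfloor>"
  have "real N \<le> Q\<^sup>2" unfolding N_def by (simp add: of_nat_floor)
  have N: "Q\<^sup>2 < real (Suc N)" unfolding N_def by linarith
  define P where "P = (\<lambda>s. \<Sum>n<N. f (Suc n) * of_nat (Suc n) powr (-s))"
  define E where "E = (\<lambda>s. (L s - P s) * of_nat (Suc N) powr s)"
  define U where "U = (\<Sum>n. norm (f (Suc n)) * real (Suc n) powr (-3))"
  have U: "norm (L s) \<le> U" if "Re s \<ge> 3" for s
    unfolding U_def using dirichlet_sums_norm_le(2)[OF sm that sums] that by auto
  have U0: "U \<ge> 0" unfolding U_def by (intro suminf_nonneg sm) auto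
  define p where "p = (\<Sum>n<N. norm (f (Suc n)))"
  have p0: "p \<ge> 0" unfolding p_def by (intro sum_nonneg) auto

  have right: "norm (E s) \<le> U * real (Suc N) powr 3" if s: "Re s \<ge> 3" for s
  proof -
    define h where "h = (\<lambda>n. f (Suc n) * of_nat (Suc n) powr (-s) - (if n \<in> {..<N} then f (Suc n) * of_nat (Suc n) powr (-s) else 0))"
    have "h sums (L s - P s)"
      unfolding h_def P_def using s by (intro sums_diff sums sums_If_finite_set) auto
    hence hE: "(\<lambda>n. h n * of_nat (Suc N) powr s) sums E s" unfolding E_def by (rule sums_mult2)
    have bd: "norm (h n * of_nat (Suc N) powr s) \<le> norm (f (Suc n)) * real (Suc n) powr (-3) * real (Suc N) powr 3" for n
    proof (cases "n < N")
      case True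
      thus ?thesis by (simp add: h_def)
    next
      case False
      have "real (Suc n) powr (- Re s) * real (Suc N) powr Re s = (real (Suc N) / real (Suc n)) powr Re s"
        by (simp add: powr_divide powr_minus field_simps)
      also have "\<dots> \<le> (real (Suc N) / real (Suc n)) powr 3"
        using False s by (intro powr_mono') auto
      also have "\<dots> = real (Suc n) powr (-3) * real (Suc N) powr 3"
        by (simp add: powr_divide powr_minus field_simps)
      finally have "norm (f (Suc n)) * (real (Suc n) powr (- Re s) * real (Suc N) powr Re s) \<le>
         norm (f (Suc n)) * (real (Suc n) powr (-3) * real (Suc N) powr 3)"
        by (intro mult_left_mono) auto
      moreover have "norm (h n * of_nat (Suc N) powr s) = norm (f (Suc n)) * (real (Suc n) powr (- Re s) * real (Suc N) powr Re s)"
        using False unfolding h_def by (simp add: norm_mult norm_of_nat_powr del: of_nat_Suc)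
      ultimately show ?thesis by (simp only: mult.assoc)
    qed
    have sm': "summable (\<lambda>n. norm (f (Suc n)) * real (Suc n) powr (-3) * real (Suc N) powr 3)"
      by (intro summable_mult2 sm)
    have "norm (E s) \<le> (\<Sum>n. norm (f (Suc n)) * real (Suc n) powr (-3) * real (Suc N) powr 3)"
      unfolding sums_unique[OF hE] by (rule norm_suminf_le[OF bd sm'])
    also have "\<dots> = U * real (Suc N) powr 3" unfolding U_def by (rule suminf_mult2[symmetric, OF sm])
    finally show ?thesis .
  qed

  \<comment> \<open>The half-plane \<open>Re s \<le> -2\<close> is the reflection of
    \<open>Re s \<ge> 3\<close>, where U bounds L.\<close>
  have left: "norm (E s) \<le> Q * U * (real (Suc N) / Q\<^sup>2) powr Re s + (\<Sum>n<N. norm (f (Suc n)) * (real (Suc N) / real (Suc n)) powr Re s)"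
    if s: "Re s \<le> -2" for s
  proof -
    have "s \<notin> {0, 1}" using s by auto
    from arg_cong[OF FE[OF this], of norm]
    have "norm (L s) * Q powr Re s = norm (L (1 - cnj s)) * Q powr (1 - Re s)"
      using Q \<omega> by (simp add: norm_mult norm_powr_real_powr)
    also have "\<dots> \<le> U * Q powr (1 - Re s)"
      using s by (intro mult_right_mono U) auto
    finally have "norm (L s) \<le> U * (Q powr (1 - Re s) / Q powr Re s)"
      using Q by (simp add: field_simps)
    also have "Q powr (1 - Re s) / Q powr Re s = Q * (1 / Q\<^sup>2) powr Re s"
    proof -
      have "Q powr (1 - Re s) / Q powr Re s = Q powr (1 + (-2 * Re s))"
        unfolding powr_diff[symmetric] by (simp add: algebra_simps)
      also have "\<dots> = Q powr 1 * Q powr (-2 * Re s)" by (rule powr_add)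
      also have "Q powr (-2 * Re s) = (Q powr (-2)) powr Re s" by (simp add: powr_powr)
      also have "Q powr (-2) = 1 / Q\<^sup>2" using Q by (simp add: powr_minus powr_numeral inverse_eq_divide)
      finally show ?thesis using Q by simp
    qed
    finally have "norm (L s) * real (Suc N) powr Re s \<le> U * (Q * (1 / Q\<^sup>2) powr Re s) * real (Suc N) powr Re s"
      by (intro mult_right_mono) auto
    also have "\<dots> = Q * U * (real (Suc N) / Q\<^sup>2) powr Re s"
      using Q by (simp add: powr_divide field_simps)
    finally have 1: "norm (L s) * real (Suc N) powr Re s \<le> Q * U * (real (Suc N) / Q\<^sup>2) powr Re s" .
    have "norm (P s) * real (Suc N) powr Re s \<le> (\<Sum>n<N. norm (f (Suc n) * of_nat (Suc n) powr (-s))) * real (Suc N) powr Re s"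
      unfolding P_def by (intro mult_right_mono norm_sum) auto
    also have "\<dots> = (\<Sum>n<N. norm (f (Suc n)) * (real (Suc N) / real (Suc n)) powr Re s)"
      unfolding sum_distrib_right
    proof (intro sum.cong refl)
      fix n
      have "(real (Suc N) / real (Suc n)) powr Re s = real (Suc n) powr (- Re s) * real (Suc N) powr Re s"
        by (simp add: powr_divide powr_minus field_simps)
      thus "norm (f (Suc n) * of_nat (Suc n) powr (-s)) * real (Suc N) powr Re s = norm (f (Suc n)) * (real (Suc N) / real (Suc n)) powr Re s"
        by (simp add: norm_mult norm_of_nat_powr del: of_nat_Suc)
    qed
    finally have 2: "norm (P s) * real (Suc N) powr Re s \<le> (\<Sum>n<N. norm (f (Suc n)) * (real (Suc N) / real (Suc n)) powr Re s)" .
    have "norm (E s) = norm (L s - P s) * real (Suc N) powr Re s"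
      by (simp add: E_def norm_mult norm_of_nat_powr del: of_nat_Suc)
    also have "\<dots> \<le> (norm (L s) + norm (P s)) * real (Suc N) powr Re s"
      by (intro mult_right_mono norm_triangle_ineq4) auto
    finally show ?thesis using 1 2 by (simp add: algebra_simps)
  qed

  have left_bdd: "norm (E s) \<le> Q * U + p" if s: "Re s \<le> -2" for s
  proof -
    have "x powr Re s \<le> 1" if "x \<ge> 1" for x
      using powr_mono[of "Re s" 0 x] that s by simp
    moreover have "real (Suc N) / Q\<^sup>2 \<ge> 1" using N Q by (simp add: field_simps)
    ultimately have "Q * U * (real (Suc N) / Q\<^sup>2) powr Re s + (\<Sum>n<N. norm (f (Suc n)) * (real (Suc N) / real (Suc n)) powr Re s)
        \<le> Q * U * 1 + (\<Sum>n<N. norm (f (Suc n)) * 1)"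
      using Q U0 by (intro add_mono sum_mono mult_left_mono) auto
    thus ?thesis using left[OF s] by (simp add: p_def)
  qed

  obtain C :: real and k :: nat where C: "C > 0" "\<And>s. norm (L s) \<le> C * exp (norm s ^ k)"
  proof -
    obtain B :: real and k :: nat where B: "B > 0" "\<And>s. norm (s - 1) \<ge> 1 \<Longrightarrow> norm (L s) \<le> B * exp (norm s ^ k)"
      using selberg_continuation_growth[OF cont] by blast
    have "compact (L ` cball 1 1)"
      by (intro compact_continuous_image continuous_on_subset[OF holomorphic_on_imp_continuous_on[OF entire]]) auto
    then obtain D where D: "\<And>s. s \<in> cball 1 1 \<Longrightarrow> norm (L s) \<le> D"
      by (metis (no_types, lifting) bounded_iff compact_imp_bounded imageI)
    have D0: "D \<ge> 0" using order.trans[OF norm_ge_zero D[of 1]] by simp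
    show thesis
    proof (rule that[of "B + D" k])
      show "B + D > 0" using B D0 by simp
      fix s :: complex
      have "D * 1 \<le> D * exp (norm s ^ k)" using D0 by (intro mult_left_mono) auto
      moreover have "0 \<le> B * exp (norm s ^ k)" using B by simp
      ultimately show "norm (L s) \<le> (B + D) * exp (norm s ^ k)"
        using B(2)[of s] D[of s] D0 unfolding distrib_right
        by (cases "norm (s - 1) \<ge> 1") (auto simp: dist_norm norm_minus_commute)
    qed
  qed

  have holE: "E holomorphic_on UNIV"
    unfolding E_def P_def by (intro holomorphic_intros entire)
  define M where "M = U * real (Suc N) powr 3 + (Q * U + p) + 1"
  have M: "M > 0" "M \<ge> U * real (Suc N) powr 3" "M \<ge> Q * U + p"
    using U0 p0 Q by (auto simp: M_def intro!: add_nonneg_pos add_nonneg_nonneg)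
  define S where "S = {s. -2 \<le> Re s} \<inter> {s. Re s \<le> 3}"
  have closed: "closed S" unfolding S_def
    by (intro closed_Int closed_halfspace_Re_ge closed_halfspace_Re_le)
  have op: "{s. -2 < Re s} \<inter> {s. Re s < 3} \<subseteq> interior S"
    by (rule interior_maximal) (auto simp: S_def intro!: open_Int open_halfspace_Re_gt open_halfspace_Re_lt)
  define pp where "pp = (\<Sum>n<N. norm (f (Suc n)) * real (Suc n) powr 2)"
  have pp0: "pp \<ge> 0" unfolding pp_def by (intro sum_nonneg) auto
  have mid: "norm (E s) \<le> M" if s: "s \<in> S" for s
  proof (rule phragmen_lindelof_strip[of S "-2" 3 E M "(C + pp) * real (Suc N) powr 3" k])
    show "norm (E z) \<le> M" if "z \<in> frontier S" for z
    proof -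
      have "z \<in> S" "z \<notin> interior S" using that closed by (auto simp: frontier_def)
      hence "\<not> (-2 < Re z \<and> Re z < 3)" using op by auto
      hence "Re z \<le> -2 \<or> Re z \<ge> 3" by linarith
      thus ?thesis using left_bdd[of z] right[of z] M by linarith
    qed
    show "norm (E z) \<le> (C + pp) * real (Suc N) powr 3 * exp (norm z ^ k)" if "z \<in> closure S" for z
    proof -
      have z: "-2 \<le> Re z" "Re z \<le> 3" using that closed by (auto simp: S_def)
      have "norm (P z) \<le> (\<Sum>n<N. norm (f (Suc n)) * real (Suc n) powr 2)"
        unfolding P_def
      proof (intro order.trans[OF norm_sum] sum_mono)
        fix n
        have "real (Suc n) powr (- Re z) \<le> real (Suc n) powr 2" using z by (intro powr_mono) auto
        thus "norm (f (Suc n) * of_nat (Suc n) powr (-z)) \<le> norm (f (Suc n)) * real (Suc n) powr 2"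
          by (simp add: norm_mult norm_of_nat_powr mult_left_mono del: of_nat_Suc)
      qed
      also have "\<dots> = pp * 1" by (simp add: pp_def)
      also have "\<dots> \<le> pp * exp (norm z ^ k)" using pp0 by (intro mult_left_mono) auto
      finally have "norm (L z - P z) \<le> (C + pp) * exp (norm z ^ k)"
        using C(2)[of z] norm_triangle_ineq4[of "L z" "P z"] by (simp add: algebra_simps)
      moreover have "real (Suc N) powr Re z \<le> real (Suc N) powr 3" using z by (intro powr_mono) auto
      ultimately have "norm (L z - P z) * real (Suc N) powr Re z \<le> ((C + pp) * exp (norm z ^ k)) * real (Suc N) powr 3"
        using C pp0 by (intro mult_mono) auto
      thus ?thesis by (simp add: E_def norm_mult norm_of_nat_powr mult_ac del: of_nat_Suc)
    qed
    show "E holomorphic_on interior S" by (rule holomorphic_on_subset[OF holE]) auto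
    show "continuous_on (closure S) E"
      by (rule continuous_on_subset[OF holomorphic_on_imp_continuous_on[OF holE]]) auto
  qed (use s M C pp0 in \<open>auto simp: S_def\<close>)
  have "norm (E s) \<le> M" for s
  proof (cases "s \<in> S")
    case False
    hence "Re s \<le> -2 \<or> Re s \<ge> 3" by (auto simp: S_def)
    thus ?thesis using left_bdd[of s] right[of s] M by linarith
  qed (rule mid)
  hence "bounded (range E)" by (intro boundedI[of _ M]) auto
  then obtain e where e: "\<And>s. E s = e"
    using Liouville_theorem[OF holE] by (auto simp: constant_on_def)
  have "((\<lambda>x::real. Q * U * (real (Suc N) / Q\<^sup>2) powr x + (\<Sum>n<N. norm (f (Suc n)) * (real (Suc N) / real (Suc n)) powr x)) \<longlongrightarrow>
          Q * U * 0 + (\<Sum>n<N. norm (f (Suc n)) * 0)) at_bot"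
  proof (intro tendsto_add tendsto_mult tendsto_sum tendsto_const)
    have *: "((\<lambda>x::real. a powr x) \<longlongrightarrow> 0) at_bot" if "a > 1" for a :: real
      using that by real_asymp
    show "((\<lambda>x::real. (real (Suc N) / Q\<^sup>2) powr x) \<longlongrightarrow> 0) at_bot"
      by (rule *) (use N Q in \<open>simp add: field_simps\<close>)
    show "((\<lambda>x::real. (real (Suc N) / real (Suc n)) powr x) \<longlongrightarrow> 0) at_bot" if "n \<in> {..<N}" for n
      by (rule *) (use that in \<open>simp add: field_simps\<close>)
  qed
  moreover have "eventually (\<lambda>x. norm e \<le> Q * U * (real (Suc N) / Q\<^sup>2) powr x + (\<Sum>n<N. norm (f (Suc n)) * (real (Suc N) / real (Suc n)) powr x)) at_bot"
    using eventually_le_at_bot[of "-2"]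
  proof eventually_elim
    case (elim x)
    thus ?case using left[of "of_real x"] e[of "of_real x"] by simp
  qed
  ultimately have "norm e \<le> Q * U * 0 + (\<Sum>n<N. norm (f (Suc n)) * 0)"
    by (rule tendsto_lowerbound) auto
  hence "E s = 0" for s using e[of s] by simp
  hence "L s = P s" for s by (simp add: E_def del: of_nat_Suc)
  thus thesis using that[of N] by (simp add: P_def)
qed

section \<open>Dirichlet coefficients of the logarithm of the Euler product\<close>

lemma of_nat_power_powr:
  assumes "p > 0"
  shows "of_nat (p ^ m) powr (- s) = (of_nat p :: complex) powr (- of_nat m * s)"
proof -
  have "Ln (of_nat (p ^ m)) = of_nat m * Ln (of_nat p)"
    using assms by (subst (1 2) Ln_of_nat) (auto simp: ln_realpow)
  thus ?thesis using assms by (simp add: powr_def mult_ac)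
qed

lemma has_field_derivative_of_nat_powr_minus:
  assumes "n > 0"
  shows "((\<lambda>s. of_nat n powr (-s)) has_field_derivative (- (of_real (ln (real n)) * of_nat n powr (-s)) :: complex)) (at s)"
proof -
  have "((\<lambda>s. of_nat n powr (-s)) has_field_derivative (Ln (of_nat n) * of_nat n powr (-s)) * (-1 :: complex)) (at s)"
    by (rule DERIV_chain2[OF has_field_derivative_powr_right]) (use assms in \<open>auto intro!: derivative_eq_intros\<close>)
  thus ?thesis using assms by simp
qed

text \<open>Absolute convergence at r dominates the series for \<open>Re s > r\<close>, which
  permits termwise differentiation. The sign is chosen so that the coefficients of \<open>D'\<close>
  are those of D times \<open>ln n\<close>.\<close>

lemma dirichlet_series_deriv:
  fixes c :: "nat \<Rightarrow> complex"
  assumes sm: "summable (\<lambda>n. norm (c (Suc n)) * real (Suc n) powr (-r))"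
    and sums: "\<And>s. Re s > r \<Longrightarrow> (\<lambda>n. c (Suc n) * of_nat (Suc n) powr (-s)) sums D s"
  obtains D' where "\<And>s. Re s > r \<Longrightarrow> (D has_field_derivative - D' s) (at s)"
    "\<And>s. Re s > r \<Longrightarrow> (\<lambda>n. (c (Suc n) * of_real (ln (real (Suc n)))) * of_nat (Suc n) powr (-s)) sums D' s"
proof -
  define S where "S = {s. Re s > r}"
  have S: "open S" by (simp add: S_def open_halfspace_Re_gt)
  define h where "h = (\<lambda>n. norm (c (Suc n)) * real (Suc n) powr (-r))"
  have "\<exists>g g'. \<forall>x \<in> S. ((\<lambda>n. c (Suc n) * of_nat (Suc n) powr (-x)) sums g x) \<and>
     ((\<lambda>n. - (c (Suc n) * of_real (ln (real (Suc n)))) * of_nat (Suc n) powr (-x)) sums g' x) \<and> (g has_field_derivative g' x) (at x)"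
  proof (rule series_and_derivative_comparison_complex[OF S])
    fix n x
    show "((\<lambda>x. c (Suc n) * of_nat (Suc n) powr (-x)) has_field_derivative
        - (c (Suc n) * of_real (ln (real (Suc n)))) * of_nat (Suc n) powr (-x)) (at x)"
      using DERIV_cmult[OF has_field_derivative_of_nat_powr_minus[of "Suc n" x], of "c (Suc n)"]
      by (simp add: mult.assoc del: of_nat_Suc)
  next
    fix x assume "x \<in> S"
    show "\<exists>d h. 0 < d \<and> summable h \<and> range h \<subseteq> \<real>\<^sub>\<ge>\<^sub>0 \<and> (\<forall>\<^sub>F n in sequentially. \<forall>y\<in>ball x d \<inter> S. cmod (c (Suc n) * of_nat (Suc n) powr (-y)) \<le> cmod (h n))"
    proof (intro exI[of _ 1] exI[of _ "\<lambda>n. of_real (h n)"] conjI always_eventually allI ballI)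
      show "summable (\<lambda>n. complex_of_real (h n))"
        unfolding summable_of_real_iff h_def by (rule sm)
      show "range (\<lambda>n. complex_of_real (h n)) \<subseteq> \<real>\<^sub>\<ge>\<^sub>0" by (auto simp: h_def)
      fix n y assume "y \<in> ball x 1 \<inter> S"
      hence "Re y > r" by (simp add: S_def)
      hence "real (Suc n) powr (- Re y) \<le> real (Suc n) powr (- r)" by (intro powr_mono) auto
      thus "cmod (c (Suc n) * of_nat (Suc n) powr (-y)) \<le> cmod (complex_of_real (h n))"
        by (simp add: h_def norm_mult norm_of_nat_powr mult_left_mono del: of_nat_Suc)
    qed auto
  qed
  then obtain g g' where g: "\<And>x. x \<in> S \<Longrightarrow> (\<lambda>n. c (Suc n) * of_nat (Suc n) powr (-x)) sums g x"
     "\<And>x. x \<in> S \<Longrightarrow> (\<lambda>n. - (c (Suc n) * of_real (ln (real (Suc n)))) * of_nat (Suc n) powr (-x)) sums g' x"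
     "\<And>x. x \<in> S \<Longrightarrow> (g has_field_derivative g' x) (at x)" by blast
  show thesis
  proof (rule that[of "\<lambda>s. - g' s"])
    fix s assume s: "Re s > r"
    show "(D has_field_derivative - (- g' s)) (at s)"
    proof (rule has_field_derivative_transform_within_open[of g _ s S])
      show "g x = D x" if "x \<in> S" for x
        using sums_unique2[OF g(1)[OF that] sums[of x]] that by (simp add: S_def)
    qed (use g(3)[of s] S s in \<open>auto simp: S_def\<close>)
    show "(\<lambda>n. (c (Suc n) * of_real (ln (real (Suc n)))) * of_nat (Suc n) powr (-s)) sums (- g' s)"
      using sums_minus[OF g(2)[of s]] s by (simp add: S_def del: of_nat_Suc)
  qed
qed

lemma dirichlet_tendsto_first_coeff:
  fixes c :: "nat \<Rightarrow> complex"
  assumes sm: "summable (\<lambda>n. norm (c (Suc n)) * real (Suc n) powr (-\<sigma>1))"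
    and sums: "\<And>s. Re s \<ge> r \<Longrightarrow> (\<lambda>n. c (Suc n) * of_nat (Suc n) powr (-s)) sums D s"
  shows "((\<lambda>x::real. D (of_real x)) \<longlongrightarrow> c 1) at_top"
proof (rule tendstoI)
  fix \<epsilon> :: real assume \<epsilon>: "\<epsilon> > 0"
  obtain b where b: "\<And>s D. Re s \<ge> b \<Longrightarrow> (\<lambda>n. c (Suc n) * of_nat (Suc n) powr (-s)) sums D \<Longrightarrow>
      norm (D * of_nat 1 powr s - c 1) \<le> \<epsilon> / 2"
    by (rule dirichlet_leading_term[OF sm, of 1 "\<epsilon> / 2"]) (use \<epsilon> in auto)
  show "eventually (\<lambda>x. dist (D (of_real x)) (c 1) < \<epsilon>) at_top"
    using eventually_ge_at_top[of "max b r"]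
  proof eventually_elim
    case (elim x)
    thus ?case using b[of "of_real x", OF _ sums] \<epsilon> by (auto simp: dist_norm)
  qed
qed

text \<open>These are the coefficients of log L as an ordinary Dirichlet series. The class does not
  restrict b away from prime powers, so other values are cut off; the exponent \<open>Suc k\<close>
  excludes \<open>n = 1\<close>.\<close>

definition prime_power_coeff :: "(nat \<Rightarrow> complex) \<Rightarrow> nat \<Rightarrow> complex" where
  "prime_power_coeff b n = (if \<exists>p k. prime p \<and> n = p ^ Suc k then b n else 0)"

lemma prime_power_coeff_bound:
  assumes bound: "\<And>p k. prime p \<Longrightarrow> k \<ge> 1 \<Longrightarrow> norm (b (p ^ k)) \<le> C * real p powr (real k * \<theta>)"
    and \<theta>: "\<theta> < 1/2" and "n > 0"
  shows "norm (prime_power_coeff b n) \<le> \<bar>C\<bar> * real n powr 1"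
proof (cases "\<exists>p k. prime p \<and> n = p ^ Suc k")
  case True
  then obtain p k where p: "prime p" "n = p ^ Suc k" by blast
  have "norm (b n) \<le> C * real p powr (real (Suc k) * \<theta>)" using bound[OF p(1), of "Suc k"] p(2) by simp
  also have "real p powr (real (Suc k) * \<theta>) = real n powr \<theta>"
    using p prime_gt_0_nat[OF p(1)] by (simp add: powr_powr flip: powr_realpow del: power_Suc of_nat_Suc)
  also have "C * real n powr \<theta> \<le> \<bar>C\<bar> * real n powr 1"
    using \<theta> \<open>n > 0\<close> by (intro mult_mono powr_mono) auto
  finally show ?thesis using True by (simp add: prime_power_coeff_def)
qed (auto simp: prime_power_coeff_def)

text \<open>By uniqueness of the representation \<open>n = p ^ Suc k\<close>, the absolutely
  convergent series over n can be regrouped as a double sum over primes and exponents. Exponentials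
  of the partial sums over p are then the partial products.\<close>

lemma euler_product_eq_exp_dirichlet:
  fixes b :: "nat \<Rightarrow> complex"
  assumes sm: "summable (\<lambda>n. norm (prime_power_coeff b (Suc n) * of_nat (Suc n) powr (-s)))"
    and B: "(\<lambda>n. prime_power_coeff b (Suc n) * of_nat (Suc n) powr (-s)) sums B"
    and prod: "(\<lambda>p. if prime p
                 then exp (\<Sum>k. b (p ^ Suc k) * of_nat p powr (- of_nat (Suc k) * s))
                 else 1) has_prod P"
  shows "P = exp B"
proof -
  define h where "h = (\<lambda>n. prime_power_coeff b n * of_nat n powr (-s))"
  have "((\<lambda>n. h (Suc n)) has_sum B) UNIV"
    unfolding h_def by (rule norm_summable_imp_has_sum[OF sm B])
  hence "(h has_sum B) (range Suc)" by (subst has_sum_reindex) (auto simp: o_def)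
  define A where "A = {p :: nat. prime p}"
  define g where "g = (\<lambda>(p, k). p ^ Suc k :: nat)"
  have "(h has_sum B) (g ` (A \<times> UNIV))"
  proof -
    have "(h has_sum B) (range Suc) \<longleftrightarrow> (h has_sum B) (g ` (A \<times> UNIV))"
    proof (rule has_sum_cong_neutral)
      show "h n = 0" if "n \<in> g ` (A \<times> UNIV) - range Suc" for n
      proof -
        have "n \<noteq> 0" using that by (auto simp: g_def A_def)
        then obtain m where "n = Suc m" by (cases n) auto
        thus ?thesis using that by auto
      qed
      show "h n = 0" if n: "n \<in> range Suc - g ` (A \<times> UNIV)" for n
      proof -
        have "\<not> (\<exists>p k. prime p \<and> n = p ^ Suc k)"
        proof
          assume "\<exists>p k. prime p \<and> n = p ^ Suc k"
          then obtain p k where "prime p" "n = p ^ Suc k" by blast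
          hence "n = g (p, k)" "(p, k) \<in> A \<times> UNIV" by (simp_all add: g_def A_def)
          hence "n \<in> g ` (A \<times> UNIV)" by (rule image_eqI)
          thus False using n by blast
        qed
        thus ?thesis by (simp only: h_def prime_power_coeff_def if_False mult_zero_left)
      qed
    qed auto
    thus ?thesis using \<open>(h has_sum B) (range Suc)\<close> by simp
  qed
  moreover have "inj_on g (A \<times> UNIV)"
  proof (rule inj_onI, clarify)
    fix p k q l assume "p \<in> A" "q \<in> A" "g (p, k) = g (q, l)"
    hence "prime p" "prime q" "p ^ Suc k = q ^ Suc l" by (auto simp: A_def g_def)
    from prime_power_inj'[OF this] show "p = q \<and> k = l" by simp
  qed
  ultimately have hg: "((h \<circ> g) has_sum B) (A \<times> UNIV)" by (simp add: has_sum_reindex)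
  define e where "e = (\<lambda>p k. b (p ^ Suc k) * of_nat p powr (- of_nat (Suc k) * s))"
  have hg_eq: "(h \<circ> g) (p, k) = e p k" if "p \<in> A" for p k
  proof -
    have "prime p" using that by (simp add: A_def)
    hence "prime_power_coeff b (p ^ Suc k) = b (p ^ Suc k)" unfolding prime_power_coeff_def by metis
    thus ?thesis
      using of_nat_power_powr[of p "Suc k" s] prime_gt_0_nat[OF \<open>prime p\<close>]
      by (simp only: o_def h_def g_def e_def prod.case)
  qed
  have hsum: "((\<lambda>(p, k). e p k) has_sum B) (A \<times> UNIV)"
    using hg by (rule has_sum_cong[THEN iffD1, rotated]) (use hg_eq in auto)
  have inner: "(e p has_sum (\<Sum>k. e p k)) UNIV" if "p \<in> A" for p
  proof -
    have "e p summable_on UNIV"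
      by (rule summable_on_SigmaD1[of e A "\<lambda>_. UNIV"]) (use hsum that in \<open>auto simp: summable_on_def\<close>)
    hence "(e p has_sum infsum (e p) UNIV) UNIV" by (rule has_sum_infsum)
    moreover from has_sum_imp_sums[OF this] have "infsum (e p) UNIV = (\<Sum>k. e p k)" by (rule sums_unique)
    ultimately show ?thesis by simp
  qed
  have "((\<lambda>p. \<Sum>k. e p k) has_sum B) A"
    by (rule has_sum_SigmaD[OF hsum]) (use inner in auto)
  hence "((\<lambda>p. if prime p then \<Sum>k. e p k else 0) has_sum B) UNIV"
    by (rule has_sum_cong_neutral[THEN iffD1, rotated -1]) (auto simp: A_def)
  hence "(\<lambda>p. if prime p then \<Sum>k. e p k else 0) sums B" by (rule has_sum_imp_sums)
  hence "(\<lambda>n. \<Sum>p\<le>n. if prime p then \<Sum>k. e p k else 0) \<longlonglongrightarrow> B" by (simp add: sums_def_le)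
  hence "(\<lambda>n. exp (\<Sum>p\<le>n. if prime p then \<Sum>k. e p k else 0)) \<longlonglongrightarrow> exp B" by (intro tendsto_intros)
  moreover have "exp (\<Sum>p\<le>n. if prime p then \<Sum>k. e p k else 0) = (\<Prod>p\<le>n. if prime p then exp (\<Sum>k. e p k) else 1)" for n
    by (subst exp_sum) (auto intro!: prod.cong)
  moreover have "(\<lambda>n. \<Prod>p\<le>n. if prime p then exp (\<Sum>k. e p k) else 1) \<longlonglongrightarrow> P"
    using has_prod_imp_tendsto[OF prod] by (simp only: e_def)
  ultimately show ?thesis using LIMSEQ_unique by fastforce
qed

text \<open>One row of a Dirichlet convolution: the factor \<open>of_nat (Suc m) powr (-s)\<close>
  moves the coefficient at n to \<open>Suc m * n\<close>. Since term n of a series carries the index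
  \<open>Suc n\<close>, the reindexing map is \<open>Suc m * Suc n - 1\<close>.\<close>

lemma dirichlet_shift_sums:
  fixes \<gamma> :: "nat \<Rightarrow> complex"
  assumes "(\<lambda>n. \<gamma> (Suc n) * of_nat (Suc n) powr (-s)) sums X"
  shows "(\<lambda>n. (if Suc m dvd Suc n then \<gamma> (Suc n div Suc m) else 0) * of_nat (Suc n) powr (-s)) sums (of_nat (Suc m) powr (-s) * X)"
proof -
  define g where "g = (\<lambda>n. Suc m * Suc n - 1)"
  have Suc_g: "Suc (g n) = Suc m * Suc n" for n by (simp add: g_def)
  have mono: "strict_mono g" by (rule strict_monoI_Suc) (simp add: g_def)
  let ?F = "\<lambda>n. (if Suc m dvd Suc n then \<gamma> (Suc n div Suc m) else 0) * of_nat (Suc n) powr (-s)"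
  have "(\<lambda>n. ?F (g n)) sums (of_nat (Suc m) powr (-s) * X)"
  proof -
    have "?F (g n) = of_nat (Suc m) powr (-s) * (\<gamma> (Suc n) * of_nat (Suc n) powr (-s))" for n
    proof -
      have "of_nat (Suc m * Suc n) powr (-s) = (of_nat (Suc m) powr (-s) * of_nat (Suc n) powr (-s) :: complex)"
        unfolding of_nat_mult by (rule powr_times_real) auto
      thus ?thesis unfolding Suc_g by (simp only: dvd_triv_left if_True nonzero_mult_div_cancel_left[OF Suc_not_Zero] mult_ac)
    qed
    thus ?thesis using sums_mult[OF assms] by presburger
  qed
  moreover have "?F n = 0" if "n \<notin> range g" for n
  proof -
    have "\<not> Suc m dvd Suc n"
    proof
      assume "Suc m dvd Suc n"
      then obtain k where k: "Suc n = Suc m * k" by (elim dvdE)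
      then obtain l where "k = Suc l" by (cases k) auto
      hence "n = g l" using k Suc_g[of l] by simp
      thus False using that by blast
    qed
    thus ?thesis by simp
  qed
  ultimately show ?thesis by (subst (asm) sums_mono_reindex[OF mono])
qed

text \<open>
  Comparing coefficients in \<open>L' = L * (log L)'\<close>: if \<open>L\<close> is a Dirichlet polynomial of length \<open>N\<close>, then at a
  power of a prime \<open>p > N\<close> only the divisor \<open>1\<close> contributes to the convolution on the right.
\<close>

lemma dirichlet_polynomial_log_coeffs:
  fixes \<beta> f :: "nat \<Rightarrow> complex"
  assumes \<beta>: "\<And>n. n > 0 \<Longrightarrow> norm (\<beta> n) \<le> C * real n powr 1"
    and f1: "f 1 \<noteq> 0"
    and D: "\<And>s. Re s > 3 \<Longrightarrow> (\<lambda>n. \<beta> (Suc n) * of_nat (Suc n) powr (-s)) sums D s"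
    and eq: "\<And>s. Re s > 3 \<Longrightarrow> exp (D s) = (\<Sum>m<N. f (Suc m) * of_nat (Suc m) powr (-s))"
    and p: "prime p" "p > N"
  shows "\<beta> (p ^ Suc k) = 0"
proof -
  have C0: "C \<ge> 0" using order.trans[OF norm_ge_zero \<beta>[of 1]] by simp
  have sm\<beta>: "summable (\<lambda>n. norm (\<beta> (Suc n)) * real (Suc n) powr (-3))"
    using polynomial_coeffs_summable[OF \<beta>] by simp
  define \<gamma> where "\<gamma> = (\<lambda>n. \<beta> n * of_real (ln (real n)))"
  obtain X where X: "\<And>s. Re s > 3 \<Longrightarrow> (D has_field_derivative - X s) (at s)"
    "\<And>s. Re s > 3 \<Longrightarrow> (\<lambda>n. (\<beta> (Suc n) * of_real (ln (real (Suc n)))) * of_nat (Suc n) powr (-s)) sums X s"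
    by (rule dirichlet_series_deriv[where c = \<beta> and r = 3 and D = D, OF sm\<beta> D]; (rule that)?; assumption)
  have X2: "(\<lambda>n. \<gamma> (Suc n) * of_nat (Suc n) powr (-s)) sums X s" if "Re s > 3" for s
    unfolding \<gamma>_def by (rule X(2)[OF that])
  \<comment> \<open>With P the Dirichlet polynomial, equal to \<open>exp (D s)\<close>, and X minus
    the derivative of D, these are the coefficients of \<open>P * X + P'\<close>, which is
    identically 0.\<close>
  define c where "c = (\<lambda>n. (\<Sum>m<N. f (Suc m) * (if Suc m dvd n then \<gamma> (n div Suc m) else 0)) -
      (if n \<le> N then f n * of_real (ln (real n)) else 0))"
  have sums0: "(\<lambda>n. c (Suc n) * of_nat (Suc n) powr (-s)) sums 0" if s: "Re s \<ge> 4" for s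
  proof -
    have s3: "Re s > 3" using s by simp
    have 1: "(\<lambda>n. \<Sum>m<N. f (Suc m) * ((if Suc m dvd Suc n then \<gamma> (Suc n div Suc m) else 0) * of_nat (Suc n) powr (-s))) sums
        (\<Sum>m<N. f (Suc m) * (of_nat (Suc m) powr (-s) * X s))"
      by (intro sums_sum sums_mult dirichlet_shift_sums X2[OF s3])
    have 2: "(\<lambda>n. if n \<in> {..<N} then f (Suc n) * of_real (ln (real (Suc n))) * of_nat (Suc n) powr (-s) else 0) sums
        (\<Sum>n<N. f (Suc n) * of_real (ln (real (Suc n))) * of_nat (Suc n) powr (-s))"
      by (rule sums_If_finite_set) auto
    have "((\<lambda>s. exp (D s)) has_field_derivative exp (D s) * (- X s)) (at s)"
      by (rule DERIV_fun_exp[OF X(1)[OF s3], unfolded o_def])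
    hence "((\<lambda>s. \<Sum>m<N. f (Suc m) * of_nat (Suc m) powr (-s)) has_field_derivative exp (D s) * (- X s)) (at s)"
    proof (rule has_field_derivative_transform_within_open[of _ _ _ "{s. Re s > 3}"])
      show "open {s. Re s > 3}" by (rule open_halfspace_Re_gt)
    qed (use s3 eq in auto)
    moreover have "((\<lambda>s. \<Sum>m<N. f (Suc m) * of_nat (Suc m) powr (-s)) has_field_derivative
        (\<Sum>m<N. f (Suc m) * - (of_real (ln (real (Suc m))) * of_nat (Suc m) powr (-s)))) (at s)"
      by (intro DERIV_sum DERIV_cmult has_field_derivative_of_nat_powr_minus) auto
    ultimately have "exp (D s) * (- X s) = (\<Sum>m<N. f (Suc m) * - (of_real (ln (real (Suc m))) * of_nat (Suc m) powr (-s)))"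
      by (rule DERIV_unique)
    hence 3: "(\<Sum>m<N. f (Suc m) * (of_nat (Suc m) powr (-s) * X s)) - (\<Sum>n<N. f (Suc n) * of_real (ln (real (Suc n))) * of_nat (Suc n) powr (-s)) = 0"
      unfolding eq[OF s3] by (simp add: sum_distrib_right mult.assoc sum_negf del: of_nat_Suc)
    have eqf: "c (Suc n) * of_nat (Suc n) powr (-s) =
       (\<Sum>m<N. f (Suc m) * ((if Suc m dvd Suc n then \<gamma> (Suc n div Suc m) else 0) * of_nat (Suc n) powr (-s))) -
       (if n \<in> {..<N} then f (Suc n) * of_real (ln (real (Suc n))) * of_nat (Suc n) powr (-s) else 0)" for n
      unfolding c_def left_diff_distrib sum_distrib_right by (simp add: mult.assoc Suc_le_eq del: of_nat_Suc)
    show ?thesis using sums_diff[OF 1 2] unfolding eqf 3 .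
  qed
  define F where "F = (\<Sum>m<N. norm (f (Suc m)))"
  define F' where "F' = (\<Sum>m<N. norm (f (Suc m)) * ln (real (Suc m)))"
  have F'0: "F' \<ge> 0" unfolding F'_def by (intro sum_nonneg mult_nonneg_nonneg) auto
  have \<gamma>_bound: "norm (\<gamma> n) \<le> C * real n powr 2" if "n > 0" for n
  proof -
    have "norm (\<gamma> n) = norm (\<beta> n) * ln (real n)" using that by (simp add: \<gamma>_def norm_mult)
    also have "\<dots> \<le> (C * real n powr 1) * real n"
      using that C0 less_imp_le[OF ln_less_self[of "real n"]] by (intro mult_mono \<beta>) simp_all
    also have "\<dots> = C * real n powr 2" using that by (simp add: powr_numeral power2_eq_square)
    finally show ?thesis .
  qed
  have c_bound: "norm (c n) \<le> (F * C + F') * real n powr 2" if n: "n > 0" for n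
  proof -
    have "norm (\<Sum>m<N. f (Suc m) * (if Suc m dvd n then \<gamma> (n div Suc m) else 0)) \<le> (\<Sum>m<N. norm (f (Suc m)) * (C * real n powr 2))"
    proof (intro order.trans[OF norm_sum] sum_mono)
      fix m
      have "norm (if Suc m dvd n then \<gamma> (n div Suc m) else 0) \<le> C * real n powr 2"
      proof (cases "Suc m dvd n")
        case True
        hence pos: "n div Suc m > 0" using dvd_imp_le[OF _ n] by (simp add: div_greater_zero_iff)
        have "norm (\<gamma> (n div Suc m)) \<le> C * real (n div Suc m) powr 2" by (rule \<gamma>_bound[OF pos])
        also have "\<dots> \<le> C * real n powr 2" using C0 by (intro mult_left_mono powr_mono2) (auto simp: div_le_dividend)
        finally show ?thesis using True by simp
      qed (use C0 in auto)
      thus "norm (f (Suc m) * (if Suc m dvd n then \<gamma> (n div Suc m) else 0)) \<le> norm (f (Suc m)) * (C * real n powr 2)"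
        unfolding norm_mult by (rule mult_left_mono) auto
    qed
    also have "\<dots> = F * C * real n powr 2" by (simp add: F_def sum_distrib_right mult.assoc)
    finally have 1: "norm (\<Sum>m<N. f (Suc m) * (if Suc m dvd n then \<gamma> (n div Suc m) else 0)) \<le> F * C * real n powr 2" .
    have "norm (if n \<le> N then f n * of_real (ln (real n)) else 0) \<le> F' * 1"
    proof (cases "n \<le> N")
      case True
      have "norm (f (Suc (n - 1))) * ln (real (Suc (n - 1))) \<le> F'"
        unfolding F'_def by (rule member_le_sum) (use True n in \<open>auto intro!: mult_nonneg_nonneg\<close>)
      thus ?thesis using True n by (simp add: norm_mult)
    qed (use F'0 in auto)
    also have "\<dots> \<le> F' * real n powr 2" using F'0 n by (intro mult_left_mono) (auto simp: ge_one_powr_ge_zero)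
    finally have 2: "norm (if n \<le> N then f n * of_real (ln (real n)) else 0) \<le> F' * real n powr 2" .
    show ?thesis unfolding c_def using order.trans[OF norm_triangle_ineq4 add_mono[OF 1 2]] by (simp add: algebra_simps)
  qed
  have n0: "p ^ Suc k > 0" using prime_gt_0_nat[OF p(1)] by simp
  have "c (p ^ Suc k) = 0"
    by (rule dirichlet_series_unique[OF polynomial_coeffs_summable[OF c_bound] sums0 n0])
  moreover have "\<not> p ^ Suc k \<le> N"
  proof -
    have "p \<le> p ^ Suc k" using prime_gt_0_nat[OF p(1)] by (intro self_le_power) auto
    thus ?thesis using p(2) by linarith
  qed
  moreover have "(\<Sum>m<N. f (Suc m) * (if Suc m dvd p ^ Suc k then \<gamma> (p ^ Suc k div Suc m) else 0)) =
      (\<Sum>m<N. if m = 0 then f 1 * \<gamma> (p ^ Suc k) else 0)"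
  proof (intro sum.cong refl)
    fix m assume m: "m \<in> {..<N}"
    have "m = 0" if "Suc m dvd p ^ Suc k"
    proof -
      obtain i where i: "Suc m = p ^ i" using \<open>Suc m dvd p ^ Suc k\<close> divides_primepow_nat[OF p(1)] by metis
      have "i = 0"
      proof (rule ccontr)
        assume "i \<noteq> 0"
        hence "p \<le> p ^ i" using prime_gt_0_nat[OF p(1)] by (intro self_le_power) auto
        thus False using i m p(2) by auto
      qed
      thus ?thesis using i by simp
    qed
    thus "f (Suc m) * (if Suc m dvd p ^ Suc k then \<gamma> (p ^ Suc k div Suc m) else 0) = (if m = 0 then f 1 * \<gamma> (p ^ Suc k) else 0)"
      by auto
  qed
  \<comment> \<open>An empty sum would be 0 and could not equal an exponential. Hence
    \<open>m = 0\<close>, which stands for the divisor 1, does occur in the sum.\<close>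
  moreover have "N > 0"
  proof (rule ccontr)
    assume "\<not> N > 0"
    thus False using eq[of 4] by simp
  qed
  ultimately have "f 1 * \<gamma> (p ^ Suc k) = 0" by (simp add: c_def del: power_Suc)
  hence "\<gamma> (p ^ Suc k) = 0" using f1 by simp
  moreover have "ln (real (p ^ Suc k)) \<noteq> 0"
  proof -
    have "p ^ Suc k > 1" using prime_gt_1_nat[OF p(1)] by (intro one_less_power) auto
    hence "ln (real (p ^ Suc k)) > 0" by (intro ln_gt_zero) linarith
    thus ?thesis by simp
  qed
  ultimately show ?thesis unfolding \<gamma>_def by simp
qed

section \<open>The holomorphic logarithm to the right of \<theta> and its reflection\<close>

lemma local_log_holomorphic:
  fixes b :: "nat \<Rightarrow> complex"
  assumes p: "prime p" and bound: "\<And>k. k \<ge> 1 \<Longrightarrow> norm (b (p ^ k)) \<le> C * real p powr (real k * \<theta>)"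
  shows "(\<lambda>s. \<Sum>k. b (p ^ Suc k) * of_nat p powr (- of_nat (Suc k) * s)) holomorphic_on {s. Re s > \<theta>}" (is ?hol)
    and "\<And>s. Re s \<ge> \<sigma> \<Longrightarrow> \<sigma> > \<theta> \<Longrightarrow>
           norm (\<Sum>k. b (p ^ Suc k) * of_nat p powr (- of_nat (Suc k) * s)) \<le> (\<Sum>k. \<bar>C\<bar> * (real p powr (\<theta> - \<sigma>)) ^ Suc k)" (is "\<And>s. _ \<Longrightarrow> _ \<Longrightarrow> ?bd s")
proof -
  have p1: "real p > 1" using prime_gt_1_nat[OF p] by simp
  have term_eq: "b (p ^ Suc k) * of_nat p powr (- of_nat (Suc k) * s) = b (p ^ Suc k) * (of_nat p powr (-s)) ^ Suc k" for k s
  proof -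
    have "of_nat p powr (- of_nat (Suc k) * s) = (of_nat p powr (-s) :: complex) ^ Suc k"
      using p1 by (simp add: powr_def mult_ac flip: exp_of_nat_mult del: power_Suc of_nat_Suc)
    thus ?thesis by simp
  qed
  have bd: "norm (b (p ^ Suc k)) * x ^ Suc k \<le> \<bar>C\<bar> * (real p powr \<theta> * x) ^ Suc k" if "x \<ge> 0" for k x
  proof -
    have "norm (b (p ^ Suc k)) \<le> C * real p powr (real (Suc k) * \<theta>)" by (rule bound) auto
    also have "\<dots> \<le> \<bar>C\<bar> * real p powr (real (Suc k) * \<theta>)" by (intro mult_right_mono) auto
    also have "real p powr (real (Suc k) * \<theta>) = (real p powr \<theta>) ^ Suc k"
      using p1 by (subst powr_realpow[symmetric]) (auto simp: powr_powr mult_ac simp del: of_nat_Suc)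
    finally show ?thesis using that by (simp add: power_mult_distrib mult_right_mono mult.assoc[symmetric] del: power_Suc)
  qed
  have norm_x: "norm (of_nat p powr (-s) :: complex) = real p powr (- Re s)" for s
    using p1 by (subst norm_powr_real_powr) auto
  \<comment> \<open>In the variable \<open>x = of_nat p powr (-s)\<close> the local logarithm is a
    power series converging for \<open>norm x < r\<close>, and this inequality is the same as
    \<open>Re s > \<theta>\<close>.\<close>
  define G where "G = (\<lambda>x :: complex. \<Sum>k. b (p ^ Suc k) * x ^ Suc k)"
  define r where "r = real p powr (-\<theta>)"
  have sm: "summable (\<lambda>k. \<bar>C\<bar> * y ^ Suc k)" if "0 \<le> y" "y < 1" for y :: real
    using that by (intro summable_mult) (subst summable_Suc_iff, auto intro!: summable_geometric)
  have norm_sm: "summable (\<lambda>k. norm (b (p ^ Suc k) * x ^ Suc k))" if x: "norm x < r" for x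
  proof (rule summable_comparison_test'[OF sm[of "real p powr \<theta> * norm x"]])
    show "real p powr \<theta> * norm x < 1" using x p1 by (simp add: r_def powr_minus field_simps)
    show "norm (norm (b (p ^ Suc k) * x ^ Suc k)) \<le> \<bar>C\<bar> * (real p powr \<theta> * norm x) ^ Suc k" for k
      using bd[of "norm x" k] by (simp add: norm_mult norm_power del: power_Suc)
  qed auto
  have holG: "G holomorphic_on ball 0 r"
  proof (rule power_series_holomorphic[where a = "\<lambda>k. if k = 0 then 0 else b (p ^ k)"])
    fix w :: complex assume "w \<in> ball 0 r"
    hence "norm w < r" by simp
    hence "(\<lambda>k. b (p ^ Suc k) * w ^ Suc k) sums G w"
      unfolding G_def by (rule summable_sums[OF summable_norm_cancel[OF norm_sm]])
    hence "(\<lambda>k. (if Suc k = 0 then 0 else b (p ^ Suc k)) * w ^ Suc k) sums G w" by simp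
    hence "(\<lambda>k. (if k = 0 then 0 else b (p ^ k)) * w ^ k) sums (G w + (if (0::nat) = 0 then 0 else b (p ^ 0)) * w ^ 0)"
      by (subst sums_Suc_iff[symmetric])
    thus "(\<lambda>k. (if k = 0 then 0 else b (p ^ k)) * (w - 0) ^ k) sums G w" by simp
  qed
  have "(\<lambda>s. G (of_nat p powr (-s))) holomorphic_on {s. Re s > \<theta>}"
  proof (rule holomorphic_on_compose_gen[where g = G, unfolded o_def, OF _ holG])
    show "(\<lambda>s. of_nat p powr (-s) :: complex) holomorphic_on {s. Re s > \<theta>}"
      using p1 by (intro holomorphic_intros) auto
    show "(\<lambda>s. of_nat p powr (-s) :: complex) ` {s. Re s > \<theta>} \<subseteq> ball 0 r"
      using p1 by (auto simp: norm_x r_def)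
  qed
  thus ?hol unfolding G_def term_eq .
  fix s assume s: "Re s \<ge> \<sigma>" "\<sigma> > \<theta>"
  have le: "real p powr (- Re s) \<le> real p powr (-\<sigma>)" using p1 s by simp
  have "norm (b (p ^ Suc k) * (of_nat p powr (-s)) ^ Suc k) \<le> \<bar>C\<bar> * (real p powr (\<theta> - \<sigma>)) ^ Suc k" for k
  proof -
    have "norm (b (p ^ Suc k) * (of_nat p powr (-s)) ^ Suc k) = norm (b (p ^ Suc k)) * (real p powr (- Re s)) ^ Suc k"
      by (simp add: norm_mult norm_power norm_x del: power_Suc)
    also have "\<dots> \<le> norm (b (p ^ Suc k)) * (real p powr (-\<sigma>)) ^ Suc k"
      using le by (intro mult_left_mono power_mono) auto
    also have "\<dots> \<le> \<bar>C\<bar> * (real p powr \<theta> * real p powr (-\<sigma>)) ^ Suc k" by (rule bd) auto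
    also have "real p powr \<theta> * real p powr (-\<sigma>) = real p powr (\<theta> - \<sigma>)" by (simp flip: powr_add)
    finally show ?thesis .
  qed
  moreover have "real p powr (\<theta> - \<sigma>) < 1" using p1 s by (simp add: powr_less_one)
  ultimately show "?bd s" unfolding term_eq by (intro norm_suminf_le sm) auto
qed

text \<open>As \<theta> is below \<open>1/2\<close>, the half-planes \<open>Re s > \<theta>\<close>
  and \<open>Re s < 1 - \<theta>\<close> overlap and cover the plane. On the overlap H and its
  reflection exponentiate to the same function up to the factor \<omega>, so they differ by a
  constant and can be glued. The linear term stems from \<open>Q powr (1 - 2 * s)\<close>, with
  \<open>l = ln Q\<close>.\<close>

lemma reflected_log_constant:
  fixes H :: "complex \<Rightarrow> complex" and \<theta> l :: real
  assumes H: "H holomorphic_on {s. Re s > \<theta>}" and \<theta>: "\<theta> < 1/2"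
    and bound: "\<And>s. Re s \<ge> 1/2 \<Longrightarrow> norm (H s) \<le> K"
    and eq: "\<And>s. \<theta> < Re s \<Longrightarrow> Re s < 1 - \<theta> \<Longrightarrow> exp (H s) = \<omega> * exp (cnj (H (1 - cnj s)) + (1 - 2 * s) * of_real l)"
  obtains c where "\<And>s. Re s > \<theta> \<Longrightarrow> H s = c"
proof -
  define V where "V = {s. Re s > \<theta>}"
  define V' where "V' = {s. Re s < 1 - \<theta>}"
  have opV: "open V" "open V'" by (auto simp: V_def V'_def open_halfspace_Re_gt open_halfspace_Re_lt)
  define H2 where "H2 = (\<lambda>s. cnj (H (1 - cnj s)) + (1 - 2 * s) * of_real l)"
  have "(\<lambda>s. H (1 - s)) holomorphic_on V'"
    by (rule holomorphic_on_compose_gen[where g = H, unfolded o_def, OF _ H])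
      (auto intro!: holomorphic_intros simp: V'_def)
  moreover have "cnj ` V' = V'"
    by (auto simp: V'_def image_iff intro!: exI[of _ "cnj _"])
  ultimately have "cnj \<circ> (\<lambda>s. H (1 - s)) \<circ> cnj holomorphic_on V'"
    using opV by (intro holomorphic_on_compose_cnj_cnj) auto
  hence H2: "H2 holomorphic_on V'"
    unfolding H2_def o_def by (intro holomorphic_intros)
  have conn: "connected (V \<inter> V')"
    unfolding V_def V'_def
    by (intro convex_connected convex_Int convex_halfspace_Re_gt convex_halfspace_Re_lt)
  obtain c where c: "\<And>s. s \<in> V \<inter> V' \<Longrightarrow> H s = H2 s + c"
  proof (rule exp_eq_imp_diff_constant[of H "V \<inter> V'" H2 \<omega>])
    show "H holomorphic_on V \<inter> V'" by (rule holomorphic_on_subset[OF H]) (auto simp: V_def)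
    show "H2 holomorphic_on V \<inter> V'" by (rule holomorphic_on_subset[OF H2]) auto
    show "exp (H s) = \<omega> * exp (H2 s)" if "s \<in> V \<inter> V'" for s
      unfolding H2_def by (rule eq) (use that in \<open>auto simp: V_def V'_def\<close>)
  qed (use opV conn in auto)
  define K' where "K' = (\<lambda>s. if s \<in> V then H s else H2 s + c)"
  have "K' holomorphic_on (V \<union> V')"
    unfolding K'_def
    by (intro holomorphic_on_If_Un holomorphic_intros H2 opV) (use H c in \<open>auto simp: V_def\<close>)
  moreover have "V \<union> V' = UNIV" using \<theta> by (auto simp: V_def V'_def)
  ultimately have hol: "K' holomorphic_on UNIV" by simp
  have K'_right: "K' s = H s" if "Re s > \<theta>" for s using that by (simp add: K'_def V_def)
  have K'_left: "K' s = H2 s + c" if "Re s \<le> 1/2" for s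
    using that \<theta> c[of s] by (auto simp: K'_def V_def V'_def)
  have K0: "K \<ge> 0" using order.trans[OF norm_ge_zero bound[of 1]] by simp
  have lin: "norm (K' s) \<le> (K + norm c + 3 * \<bar>l\<bar>) * norm s ^ 1" if s: "1 \<le> norm s" for s
  proof -
    have "norm (K' s) \<le> K + norm c + 3 * \<bar>l\<bar> * norm s"
    proof (cases "Re s \<ge> 1/2")
      case True
      thus ?thesis using bound[of s] K'_right[of s] \<theta> by (auto intro!: add_increasing2)
    next
      case False
      have "norm (1 - 2 * s) \<le> 1 + 2 * norm s" using norm_triangle_ineq4[of 1 "2 * s"] by (simp add: norm_mult)
      also have "\<dots> \<le> 3 * norm s" using s by simp
      finally have "norm ((1 - 2 * s) * of_real l) \<le> 3 * norm s * \<bar>l\<bar>"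
        unfolding norm_mult by (intro mult_mono) auto
      moreover have "norm (cnj (H (1 - cnj s))) \<le> K" using bound[of "1 - cnj s"] False by simp
      moreover have "norm (K' s) \<le> norm (cnj (H (1 - cnj s))) + norm ((1 - 2 * s) * of_real l) + norm c"
        using False unfolding K'_left[of s, OF less_imp_le] H2_def
        by (subst K'_left) (auto simp: H2_def intro!: order.trans[OF norm_triangle_ineq] add_mono)
      ultimately show ?thesis by (simp add: mult_ac)
    qed
    also have "\<dots> \<le> (K + norm c) * norm s + 3 * \<bar>l\<bar> * norm s"
      using K0 s mult_left_mono[of 1 "norm s" "K + norm c"] by simp
    finally show ?thesis by (simp add: algebra_simps)
  qed
  define k where "k = deriv K' 0"
  have K'_eq: "K' s = K' 0 + k * s" for s
    using Liouville_polynomial[OF hol lin, of 1 s] by (simp add: k_def)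
  have "k = 0"
  proof (rule ccontr)
    assume k: "k \<noteq> 0"
    \<comment> \<open>So far to the right that an affine function of slope k would exceed the bound
      K.\<close>
    define x where "x = 1 + (K + norm (K' 0) + 1) / norm k"
    have x: "x \<ge> 1" using K0 by (simp add: x_def)
    have "norm (k * of_real x) \<le> norm (K' (of_real x)) + norm (K' 0)"
      using K'_eq[of "of_real x"] norm_triangle_ineq4[of "K' (of_real x)" "K' 0"] by simp
    also have "norm (K' (of_real x)) \<le> K" using bound[of "of_real x"] K'_right[of "of_real x"] x \<theta> by simp
    finally have "norm k * x \<le> K + norm (K' 0)" using x by (simp add: norm_mult)
    moreover have "norm k * x = norm k + (K + norm (K' 0) + 1)" using k by (simp add: x_def field_simps)
    ultimately show False using norm_ge_zero[of k] by linarith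
  qed
  show thesis
  proof (rule that[of "K' 0"])
    fix s assume "Re s > \<theta>"
    thus "H s = K' 0" using K'_right[of s] K'_eq[of s] \<open>k = 0\<close> by simp
  qed
qed

lemma no_gamma_factors_trivial:
  fixes L :: "complex \<Rightarrow> complex" and Q :: real
  assumes L: "L \<in> selberg_class"
    and FE: "\<And>s. s \<notin> {0, 1} \<Longrightarrow> L s * of_real Q powr s = \<omega> * cnj (L (1 - cnj s) * of_real Q powr (1 - cnj s))"
    and Q: "Q > 0" and \<omega>: "norm \<omega> = 1"
  shows "L = (\<lambda>_. 1)"
proof -
  have nicely: "L nicely_meromorphic_on UNIV" and cont: "selberg_continuation L" and euler: "selberg_euler_product L"
    using L by (auto simp: selberg_class_def)
  have entire: "L holomorphic_on UNIV" by (rule no_gamma_factors_entire[OF nicely cont FE Q])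
  obtain f :: "nat \<Rightarrow> complex" and C0 :: real where f: "C0 > 0" "\<And>n. n > 0 \<Longrightarrow> norm (f n) \<le> C0 * real n powr 1"
    "\<And>s. Re s > 1 \<Longrightarrow> (\<lambda>n. f (Suc n) * of_nat (Suc n) powr (-s)) sums L s"
    by (rule selberg_dirichlet_series[OF L]) (rule that)
  have smf: "summable (\<lambda>n. norm (f (Suc n)) * real (Suc n) powr (-3))"
    using polynomial_coeffs_summable[OF f(2)] by simp
  obtain N where N: "\<And>s. L s = (\<Sum>n<N. f (Suc n) * of_nat (Suc n) powr (-s))"
    by (rule no_gamma_factors_dirichlet_polynomial[OF entire cont f(3) smf FE Q \<omega>]; (rule that)?; assumption)
  obtain b :: "nat \<Rightarrow> complex" and \<theta>0 C :: real where \<theta>0: "\<theta>0 < 1/2"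
    and b0: "\<And>p k. prime p \<Longrightarrow> k \<ge> 1 \<Longrightarrow> norm (b (p ^ k)) \<le> C * real p powr (real k * \<theta>0)"
    and prod: "\<And>s. Re s > 1 \<Longrightarrow> (\<lambda>p. if prime p
                 then exp (\<Sum>k. b (p ^ Suc k) * of_nat p powr (- of_nat (Suc k) * s))
                 else 1) has_prod L s"
    using euler unfolding selberg_euler_product_def by blast
  \<comment> \<open>Raising the exponent to at least 0 keeps the strip
    \<open>\<theta> < Re s < 1 - \<theta>\<close> away from 0 and 1, the points excluded from the
    functional equation.\<close>
  define \<theta> where "\<theta> = max \<theta>0 0"
  have \<theta>: "\<theta> < 1/2" "\<theta> \<ge> 0" using \<theta>0 by (auto simp: \<theta>_def)
  have C: "C \<ge> 0"
  proof (rule ccontr)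
    assume "\<not> C \<ge> 0"
    hence "C * real 2 powr (real 1 * \<theta>0) < 0" by (simp add: mult_neg_pos)
    thus False using b0[OF two_is_prime_nat order_refl] norm_ge_zero[of "b (2 ^ 1)"] by linarith
  qed
  have b: "norm (b (p ^ k)) \<le> C * real p powr (real k * \<theta>)" if "prime p" "k \<ge> 1" for p k
  proof -
    have "real p powr (real k * \<theta>0) \<le> real p powr (real k * \<theta>)"
      using prime_gt_0_nat[OF that(1)] by (intro powr_mono mult_left_mono) (auto simp: \<theta>_def)
    thus ?thesis using b0[OF that] C by (meson mult_left_mono order.trans)
  qed

  define \<beta> where "\<beta> = prime_power_coeff b"
  have \<beta>: "norm (\<beta> n) \<le> \<bar>C\<bar> * real n powr 1" if "n > 0" for n
    unfolding \<beta>_def by (rule prime_power_coeff_bound[OF b \<theta>(1) that])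
  have sm\<beta>: "summable (\<lambda>n. norm (\<beta> (Suc n)) * real (Suc n) powr (-3))"
    using polynomial_coeffs_summable[OF \<beta>] by simp
  define D where "D = (\<lambda>s. \<Sum>n. \<beta> (Suc n) * of_nat (Suc n) powr (-s))"
  have D: "(\<lambda>n. \<beta> (Suc n) * of_nat (Suc n) powr (-s)) sums D s" if "Re s \<ge> 3" for s
    unfolding D_def by (rule summable_sums[OF summable_norm_cancel[OF dirichlet_sums_norm_le(1)[OF sm\<beta> that]]])
  have LD: "L s = exp (D s)" if "Re s \<ge> 3" for s
  proof (rule euler_product_eq_exp_dirichlet[of b s])
    show "summable (\<lambda>n. norm (prime_power_coeff b (Suc n) * of_nat (Suc n) powr (-s)))"
      using dirichlet_sums_norm_le(1)[OF sm\<beta> that] by (simp only: \<beta>_def)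
    show "(\<lambda>n. prime_power_coeff b (Suc n) * of_nat (Suc n) powr (-s)) sums D s"
      using D[OF that] by (simp only: \<beta>_def)
  qed (use prod that in auto)
  have \<beta>1: "\<beta> 1 = 0"
  proof -
    have "\<not> (\<exists>(p::nat) k. prime p \<and> 1 = p ^ Suc k)"
      by (metis prime_power_eq_one_iff nat.distinct(1))
    thus ?thesis unfolding \<beta>_def prime_power_coeff_def by (rule if_not_P)
  qed
  \<comment> \<open>The limit of L along the positive real axis is computed from the Euler product
    and from the Dirichlet series, giving \<open>f 1 = 1\<close>. The same limit later identifies
    the constant value of L.\<close>
  have "((\<lambda>x::real. D (of_real x)) \<longlongrightarrow> \<beta> 1) at_top"
    by (rule dirichlet_tendsto_first_coeff[OF sm\<beta> D])
  hence "((\<lambda>x::real. exp (D (of_real x))) \<longlongrightarrow> exp 0) at_top"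
    unfolding \<beta>1 by (intro tendsto_intros)
  moreover have "eventually (\<lambda>x::real. exp (D (of_real x)) = L (of_real x)) at_top"
    using eventually_ge_at_top[of 3] by eventually_elim (use LD in auto)
  ultimately have lim1: "((\<lambda>x::real. L (of_real x)) \<longlongrightarrow> 1) at_top"
    by (simp add: tendsto_cong)
  moreover have "((\<lambda>x::real. L (of_real x)) \<longlongrightarrow> f 1) at_top"
    by (rule dirichlet_tendsto_first_coeff[OF smf, of 2]) (use f(3) in auto)
  ultimately have f1: "f 1 = 1" using tendsto_unique[OF trivial_limit_at_top_linorder] by blast
  have vanish: "b (p ^ Suc k) = 0" if p: "prime p" "p > N" for p k
  proof -
    have "\<beta> (p ^ Suc k) = 0"
    proof (rule dirichlet_polynomial_log_coeffs[OF \<beta> _ _ _ p])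
      show "f 1 \<noteq> 0" using f1 by simp
      show "(\<lambda>n. \<beta> (Suc n) * of_nat (Suc n) powr (-s)) sums D s" if "Re s > 3" for s using D that by simp
      show "exp (D s) = (\<Sum>m<N. f (Suc m) * of_nat (Suc m) powr (-s))" if "Re s > 3" for s
        using LD[of s] N[of s] that by simp
    qed
    moreover have "\<beta> (p ^ Suc k) = b (p ^ Suc k)"
      unfolding \<beta>_def prime_power_coeff_def by (rule if_P) (use p(1) in blast)
    ultimately show ?thesis by simp
  qed

  define B where "B = (\<lambda>p s. \<Sum>k. b (p ^ Suc k) * of_nat p powr (- of_nat (Suc k) * s))"
  define A where "A = {p. prime p \<and> p \<le> N}"
  have A: "finite A" by (simp add: A_def)
  define H where "H = (\<lambda>s. \<Sum>p\<in>A. B p s)"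
  have "B p holomorphic_on {s. Re s > \<theta>}" if "p \<in> A" for p
    unfolding B_def by (rule local_log_holomorphic(1)[of p b C]) (use that b in \<open>auto simp: A_def\<close>)
  hence holH: "H holomorphic_on {s. Re s > \<theta>}"
    unfolding H_def by (intro holomorphic_on_sum)
  define K where "K = (\<Sum>p\<in>A. \<Sum>k. \<bar>C\<bar> * (real p powr (\<theta> - 1/2)) ^ Suc k)"
  have K: "norm (H s) \<le> K" if "Re s \<ge> 1/2" for s
    unfolding H_def K_def
  proof (intro order.trans[OF norm_sum] sum_mono)
    fix p assume "p \<in> A"
    thus "norm (B p s) \<le> (\<Sum>k. \<bar>C\<bar> * (real p powr (\<theta> - 1/2)) ^ Suc k)"
      unfolding B_def using that \<theta>
      by (intro local_log_holomorphic(2)) (auto simp: A_def intro!: b)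
  qed
  have LH1: "L s = exp (H s)" if "Re s > 1" for s
  proof -
    let ?F = "\<lambda>p. if prime p then exp (B p s) else 1"
    have "?F has_prod (\<Prod>p\<in>A. ?F p)"
    proof (rule has_prod_finite[OF A])
      fix p assume p: "p \<notin> A"
      have "B p s = 0" if "prime p"
      proof -
        have "p > N" using p that by (simp add: A_def)
        thus ?thesis unfolding B_def vanish[OF that \<open>p > N\<close>] by simp
      qed
      thus "?F p = 1" by simp
    qed
    moreover have "?F has_prod L s" using prod[OF that] by (simp only: B_def)
    ultimately have "L s = (\<Prod>p\<in>A. ?F p)" by (rule has_prod_unique2[rotated])
    also have "\<dots> = exp (H s)" unfolding H_def exp_sum[OF A] by (rule prod.cong) (auto simp: A_def)
    finally show ?thesis .
  qed
  \<comment> \<open>H is a finite sum of local logarithms, holomorphic to the right of \<theta>, and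
    L is entire; the identity therefore continues beyond the line \<open>Re s = 1/2\<close>.\<close>
  have LH: "L s = exp (H s)" if "Re s > \<theta>" for s
  proof (rule analytic_continuation_open[where s = "{s. Re s > 1}" and s' = "{s. Re s > \<theta>}" and f = L and g = "\<lambda>s. exp (H s)"])
    show "{s::complex. Re s > 1} \<noteq> {}" by (auto intro: exI[of _ 2])
    show "connected {s. Re s > \<theta>}" by (intro convex_connected convex_halfspace_Re_gt)
    show "L holomorphic_on {s. Re s > \<theta>}" by (rule holomorphic_on_subset[OF entire]) auto
    show "(\<lambda>s. exp (H s)) holomorphic_on {s. Re s > \<theta>}" by (intro holomorphic_intros holH)
  qed (use that LH1 \<theta> in \<open>auto simp: open_halfspace_Re_gt\<close>)

  obtain c where c: "\<And>s. Re s > \<theta> \<Longrightarrow> H s = c"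
  proof (rule reflected_log_constant[OF holH \<theta>(1) K, of \<omega> "ln Q"])
    fix s assume s: "\<theta> < Re s" "Re s < 1 - \<theta>"
    have "s \<notin> {0, 1}" using s \<theta> by auto
    have powQ: "of_real Q powr z = exp (z * of_real (ln Q))" for z :: complex
      using Q by (simp add: powr_def Ln_of_real)
    have "exp (H s) * exp (s * of_real (ln Q)) = \<omega> * (exp (cnj (H (1 - cnj s))) * exp ((1 - s) * of_real (ln Q)))"
      using FE[OF \<open>s \<notin> {0, 1}\<close>] LH[of s] LH[of "1 - cnj s"] s unfolding powQ by (simp add: exp_cnj)
    hence "exp (H s) = \<omega> * (exp (cnj (H (1 - cnj s))) * exp ((1 - s) * of_real (ln Q))) / exp (s * of_real (ln Q))"
      by (simp add: field_simps)
    also have "\<dots> = \<omega> * exp (cnj (H (1 - cnj s)) + (1 - s) * of_real (ln Q) - s * of_real (ln Q))"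
      by (simp add: exp_add exp_diff)
    also have "cnj (H (1 - cnj s)) + (1 - s) * of_real (ln Q) - s * of_real (ln Q) = cnj (H (1 - cnj s)) + (1 - 2 * s) * of_real (ln Q)"
      by (simp add: algebra_simps)
    finally show "exp (H s) = \<omega> * exp (cnj (H (1 - cnj s)) + (1 - 2 * s) * of_real (ln Q))" .
  qed ((rule that)?; assumption)+
  have "eventually (\<lambda>x::real. L (of_real x) = exp c) at_top"
    using eventually_gt_at_top[of 1] by eventually_elim (use LH c \<theta> in auto)
  with lim1 have "((\<lambda>x::real. exp c) \<longlongrightarrow> 1) at_top" by (simp add: tendsto_cong)
  hence "exp c = 1" by (simp add: tendsto_const_iff)
  have "L s = 1" for s
  proof (rule analytic_continuation_open[where s = "{s. Re s > \<theta>}" and s' = UNIV and f = L and g = "\<lambda>_. 1"])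
    show "{s::complex. Re s > \<theta>} \<noteq> {}" using \<theta> by (auto intro!: exI[of _ 1])
  qed (use LH c \<open>exp c = 1\<close> entire in \<open>auto simp: open_halfspace_Re_gt\<close>)
  thus ?thesis by auto
qed

theorem theorem4:
  fixes L :: "complex \<Rightarrow> complex" and \<alpha> :: complex
  assumes "L \<in> selberg_class - {\<lambda>_. 1}"
  shows "\<exists>A::real. A > 0 \<and>
           (\<forall>T::real. T \<ge> exp 3 \<longrightarrow>
              (\<exists>\<beta> \<gamma>. alpha_point L \<alpha> (Complex \<beta> \<gamma>) \<and> \<bar>\<gamma> - T\<bar> < A / ln (ln (ln T))))"
proof -
  have L: "L \<in> selberg_class" and nontriv: "L \<noteq> (\<lambda>_. 1)" using assms by auto
  have cont: "selberg_continuation L" using L by (simp add: selberg_class_def)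
  from L have "selberg_functional_equation L" by (simp add: selberg_class_def)
  then obtain Q J lam mu \<omega> where Q: "Q > 0" and lam: "\<forall>j\<in>{1..J}. lam j > 0 \<and> Re (mu j) \<ge> 0" and \<omega>: "norm \<omega> = 1"
    and FE: "\<forall>s. s \<notin> {0, 1} \<longrightarrow>
             (\<forall>j\<in>{1..J}. of_real (lam j) * s + mu j \<notin> \<int>\<^sub>\<le>\<^sub>0 \<and>
                         of_real (lam j) * (1 - cnj s) + mu j \<notin> \<int>\<^sub>\<le>\<^sub>0) \<longrightarrow>
             completed_fun L Q J lam mu s = \<omega> * cnj (completed_fun L Q J lam mu (1 - cnj s))"
    unfolding selberg_functional_equation_def by (elim exE conjE) (rule that)
  \<comment> \<open>For \<open>J = 0\<close> the Gamma product is empty and the condition on poles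
    is vacuous, which leaves the bare functional equation of
    \<open>no_gamma_factors_trivial\<close>.\<close>
  have "J \<noteq> 0"
  proof
    assume [simp]: "J = 0"
    have "L = (\<lambda>_. 1)"
    proof (rule no_gamma_factors_trivial[OF L _ Q \<omega>])
      show "L s * of_real Q powr s = \<omega> * cnj (L (1 - cnj s) * of_real Q powr (1 - cnj s))"
        if "s \<notin> {0, 1}" for s
        using FE[rule_format, of s] that by (simp add: completed_fun_def)
    qed
    with nontriv show False by contradiction
  qed
  hence J: "J \<ge> 1" by simp
  obtain A T0 where "A > 0" "T0 > exp 3"
    "\<And>T. T \<ge> T0 \<Longrightarrow> \<exists>s. L s = \<alpha> \<and> s \<noteq> 1 \<and> \<bar>Im s - T\<bar> < A / ln (ln (ln T))"
  proof (rule alpha_points_gamma_factors[OF L _ Q \<omega> J])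
    show "completed_fun L Q J lam mu s = \<omega> * cnj (completed_fun L Q J lam mu (1 - cnj s))"
      if "s \<notin> {0, 1}" "\<And>j. j \<in> {1..J} \<Longrightarrow> of_real (lam j) * s + mu j \<notin> \<int>\<^sub>\<le>\<^sub>0 \<and> of_real (lam j) * (1 - cnj s) + mu j \<notin> \<int>\<^sub>\<le>\<^sub>0" for s
      using FE that by blast
  qed (use lam in auto)
  thus ?thesis by (rule alpha_point_gap_all[OF cont])
qed

end
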